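(* Let $\dot\varphi\in\mathfrak D_0^\perp\setminus\{0\}$. Then there is no $\ddot\varphi\in\mathfrak D$ such that the family $\varphi(t)=t\,\dot\varphi+\frac{t^2}2\ddot\varphi$ satisfies the obstruction flatness equation to second order at $t=0$, i.e. such that $\mathcal O(\varphi(t))=O(t^3)$ as $t\to0$.
   Context: Let $S^3=\{(z,w)\in\mathbb C^2:|z|^2+|w|^2=1\}$ with standard contact distribution $H$, standard contact form $\theta=-i(\bar z\,dz+\bar w\,dw)|_{TS^3}$, $Z_1=\bar w\,\partial_z-\bar z\,\partial_w$, $Z_{\bar1}=\overline{Z_1}$, Reeb field $T=i(z\partial_z+w\partial_w)-i(\bar z\partial_{\bar z}+\bar w\partial_{\bar w})$. Deformations: a deformation tensor is a smooth $\varphi:S^3\to\mathbb C$ (written $\varphi_1{}^{\bar1}$, with $\varphi_{\bar1}{}^1=\bar\varphi$); if $|\varphi|<1$ it defines the CR structure $J_\varphi$ on $(S^3,H)$ with $(1,0)$-bundle spanned by $\tilde Z_1=Z_1+\varphi Z_{\bar1}$. Its invariants are computed with fixed $\theta$ and the coframe $(\theta,\tilde\theta^1,\tilde\theta^{\bar1})$ dual to $(T,\tilde Z_1,\tilde Z_{\bar1})$: $d\theta=i\tilde h_{1\bar1}\tilde\theta^1\wedge\tilde\theta^{\bar1}$, $\tilde h_{1\bar1}=1-|\varphi|^2$; Tanaka–Webster connection form $\tilde\omega_1{}^1$ and torsion $\tilde A_{\bar1}{}^1$ defined by $d\tilde\theta^1=\tilde\theta^1\wedge\tilde\omega_1{}^1+\tilde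 A_{\bar1}{}^1\theta\wedge\tilde\theta^{\bar1}$, $\tilde\omega_1{}^1+\overline{\tilde\omega_1{}^1}=\tilde h^{1\bar1}d\tilde h_{1\bar1}$; scalar curvature $\tilde R$ by $d\tilde\omega_1{}^1\equiv\tilde R\tilde h_{1\bar1}\tilde\theta^1\wedge\tilde\theta^{\bar1}\pmod\theta$; $\tilde\nabla$ Tanaka–Webster covariant derivative, indices raised/lowered with $\tilde h$. Cartan tensor $\tilde Q_{11}=-\frac16\tilde\nabla_1\tilde\nabla_1\tilde R-\frac i2\tilde R\tilde A_{11}+\tilde\nabla_0\tilde A_{11}+\frac{2i}3\tilde\nabla_1\tilde\nabla^1\tilde A_{11}$; obstruction density $\mathcal O(\varphi)=\frac13(\tilde\nabla^1\tilde\nabla^1\tilde Q_{11}-i\tilde A^{11}\tilde Q_{11})$ (a real function). Spherical harmonics: $H_{p,q}$ is the space of restrictions to $S^3$ of harmonic polynomials on $\mathbb C^2$ homogeneous of degree $p$ in $(z,w)$ and $q$ in $(\bar z,\bar w)$; $u_{p,q}$ denotes the $H_{p,q}$-component of $u$. $\mathfrak D=C^\infty(S^3,\mathbb C)$ and $\mathfrak D_0^\perp=\{\varphi\in\mathfrak D:\varphi_{p,q}=0\text{ unless }q\in\{0,1\}\}$ (the space of solutions of the linearized obstruction flatness equation in the slice). *)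

theory Defs
  imports "HOL-Analysis.Analysis" "HOL-Library.Landau_Symbols"
begin

text \<open>Points of C^2 and complex-valued functions on C^2 (only values on S^3 matter).\<close>

type_synonym C2 = "complex \<times> complex"
type_synonym cfun = "C2 \<Rightarrow> complex"
type_synonym vfield = "cfun \<Rightarrow> cfun"       \<comment> \<open>vector fields act as derivations\<close>
type_synonym oneform = "vfield \<Rightarrow> cfun"

definition S3 :: "C2 set" where
  "S3 = {(z, w). (cmod z)\<^sup>2 + (cmod w)\<^sup>2 = 1}"

coinductive C_inf :: "cfun \<Rightarrow> bool" where
  "(\<forall>x. f differentiable (at x)) \<Longrightarrow>
   (\<forall>v. C_inf (\<lambda>x. frechet_derivative f (at x) v)) \<Longrightarrow> C_inf f"

definition S3_smooth :: "cfun \<Rightarrow> bool" where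
  "S3_smooth f \<longleftrightarrow> (\<exists>g. C_inf g \<and> (\<forall>p\<in>S3. f p = g p))"

text \<open>Flows (preserving S^3) of the real vector fields
  X = Z_1 + Z_1bar, Y = i(Z_1 - Z_1bar) and T.\<close>
definition flowX :: "real \<Rightarrow> C2 \<Rightarrow> C2" where
  "flowX t = (\<lambda>(z, w). (z * of_real (cos t) + cnj w * of_real (sin t),
                         w * of_real (cos t) - cnj z * of_real (sin t)))"

definition flowY :: "real \<Rightarrow> C2 \<Rightarrow> C2" where
  "flowY t = (\<lambda>(z, w). (z * of_real (cos t) + \<i> * cnj w * of_real (sin t),
                         w * of_real (cos t) - \<i> * cnj z * of_real (sin t)))"

definition flowT :: "real \<Rightarrow> C2 \<Rightarrow> C2" where
  "flowT t = (\<lambda>(z, w). (cis t * z, cis t * w))"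

definition along :: "(real \<Rightarrow> C2 \<Rightarrow> C2) \<Rightarrow> vfield" where
  "along fl f = (\<lambda>p. vector_derivative (\<lambda>t. f (fl t p)) (at 0))"

text \<open>Z_1 = w-bar d/dz - z-bar d/dw, its conjugate, and the Reeb field T.\<close>
definition Z1 :: vfield where
  "Z1 f = (\<lambda>p. (along flowX f p - \<i> * along flowY f p) / 2)"

definition Z1b :: vfield where
  "Z1b f = (\<lambda>p. (along flowX f p + \<i> * along flowY f p) / 2)"

definition Tvf :: vfield where
  "Tvf = along flowT"

definition Zt :: "cfun \<Rightarrow> vfield" where
  "Zt \<phi> f = (\<lambda>p. Z1 f p + \<phi> p * Z1b f p)"

definition Ztb :: "cfun \<Rightarrow> vfield" where
  "Ztb \<phi> f = (\<lambda>p. Z1b f p + cnj (\<phi> p) * Z1 f p)"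

definition brk :: "vfield \<Rightarrow> vfield \<Rightarrow> vfield" where
  "brk X Y f = (\<lambda>p. X (Y f) p - Y (X f) p)"

definition cof :: "cfun \<Rightarrow> vfield \<Rightarrow> C2 \<Rightarrow> complex \<times> complex \<times> complex" where
  "cof \<phi> V p = (THE c. \<forall>f. S3_smooth f \<longrightarrow>
      V f p = fst c * Tvf f p + fst (snd c) * Zt \<phi> f p + snd (snd c) * Ztb \<phi> f p)"

definition th0 :: "cfun \<Rightarrow> oneform" where "th0 \<phi> V p = fst (cof \<phi> V p)"
definition th1 :: "cfun \<Rightarrow> oneform" where "th1 \<phi> V p = fst (snd (cof \<phi> V p))"
definition th1b :: "cfun \<Rightarrow> oneform" where "th1b \<phi> V p = snd (snd (cof \<phi> V p))"

definition d1 :: "oneform \<Rightarrow> vfield \<Rightarrow> vfield \<Rightarrow> cfun" where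
  "d1 \<alpha> X Y = (\<lambda>p. X (\<alpha> Y) p - Y (\<alpha> X) p - \<alpha> (brk X Y) p)"

definition wedge :: "oneform \<Rightarrow> oneform \<Rightarrow> vfield \<Rightarrow> vfield \<Rightarrow> cfun" where
  "wedge \<alpha> \<beta> X Y = (\<lambda>p. \<alpha> X p * \<beta> Y p - \<alpha> Y p * \<beta> X p)"

definition hfun :: "cfun \<Rightarrow> cfun" where
  "hfun \<phi> = (\<lambda>p. complex_of_real (1 - (cmod (\<phi> p))\<^sup>2))"

text \<open>Connection form omega = w0 theta + w1 theta^1 + w1b theta^1bar (with coefficients
  frozen at a point) and its conjugate form.\<close>
definition om_at :: "cfun \<Rightarrow> complex \<times> complex \<times> complex \<Rightarrow> oneform" where
  "om_at \<phi> c V = (\<lambda>q. fst c * th0 \<phi> V q + fst (snd c) * th1 \<phi> V q + snd (snd c) * th1b \<phi> V q)"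

definition omc_at :: "cfun \<Rightarrow> complex \<times> complex \<times> complex \<Rightarrow> oneform" where
  "omc_at \<phi> c V = (\<lambda>q. cnj (fst c) * th0 \<phi> V q + cnj (snd (snd c)) * th1 \<phi> V q
                          + cnj (fst (snd c)) * th1b \<phi> V q)"

text \<open>Tanaka-Webster data at p: connection coefficients (w0,w1,w1b) and torsion A_{1bar}^1,
  determined by  d theta^1 = theta^1 ^ omega + A theta ^ theta^1bar  and
  omega + omega-bar = h^{-1} dh  (both evaluated on the frame).\<close>
definition TW :: "cfun \<Rightarrow> C2 \<Rightarrow> (complex \<times> complex \<times> complex) \<times> complex" where
  "TW \<phi> p = (THE (c, a).
      (\<forall>(X, Y) \<in> set [(Tvf, Zt \<phi>), (Tvf, Ztb \<phi>), (Zt \<phi>, Ztb \<phi>)].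
          d1 (th1 \<phi>) X Y p = wedge (th1 \<phi>) (om_at \<phi> c) X Y p
                               + a * wedge (th0 \<phi>) (th1b \<phi>) X Y p) \<and>
      (\<forall>V \<in> set [Tvf, Zt \<phi>, Ztb \<phi>].
          om_at \<phi> c V p + omc_at \<phi> c V p = V (hfun \<phi>) p / hfun \<phi> p))"

definition omega :: "cfun \<Rightarrow> oneform" where
  "omega \<phi> V = (\<lambda>p. om_at \<phi> (fst (TW \<phi> p)) V p)"

definition omegab :: "cfun \<Rightarrow> oneform" where
  "omegab \<phi> V = (\<lambda>p. omc_at \<phi> (fst (TW \<phi> p)) V p)"

definition Ator :: "cfun \<Rightarrow> cfun" where
  "Ator \<phi> p = snd (TW \<phi> p)"

text \<open>Webster scalar curvature: d omega = R h theta^1 ^ theta^1bar mod theta.\<close>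
definition Rscal :: "cfun \<Rightarrow> cfun" where
  "Rscal \<phi> p = (THE r. d1 (omega \<phi>) (Zt \<phi>) (Ztb \<phi>) p
                    = r * hfun \<phi> p * wedge (th1 \<phi>) (th1b \<phi>) (Zt \<phi>) (Ztb \<phi>) p)"

text \<open>Tanaka-Webster covariant derivative along X of the component f of a tensor with
  a lower indices 1 and b lower indices 1bar.\<close>
definition cov :: "cfun \<Rightarrow> nat \<Rightarrow> nat \<Rightarrow> vfield \<Rightarrow> cfun \<Rightarrow> cfun" where
  "cov \<phi> a b X f = (\<lambda>p. X f p - (of_nat a * omega \<phi> X p + of_nat b * omegab \<phi> X p) * f p)"

text \<open>A_{11} = h_{1 1bar} conj(A_{1bar}^1),  A^{11} = h^{1 1bar} h^{1 1bar} A_{1bar 1bar}.\<close>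
definition A11 :: "cfun \<Rightarrow> cfun" where
  "A11 \<phi> p = hfun \<phi> p * cnj (Ator \<phi> p)"

definition Aup11 :: "cfun \<Rightarrow> cfun" where
  "Aup11 \<phi> p = Ator \<phi> p / hfun \<phi> p"

definition Q11 :: "cfun \<Rightarrow> cfun" where
  "Q11 \<phi> p =
     - (1/6) * cov \<phi> 1 0 (Zt \<phi>) (Zt \<phi> (Rscal \<phi>)) p
     - (\<i>/2) * Rscal \<phi> p * A11 \<phi> p
     + cov \<phi> 2 0 Tvf (A11 \<phi>) p
     + (2*\<i>/3) * (cov \<phi> 2 1 (Zt \<phi>) (cov \<phi> 2 0 (Ztb \<phi>) (A11 \<phi>)) p / hfun \<phi> p)"

text \<open>Obstruction density O(phi) = 1/3 (nabla^1 nabla^1 Q_{11} - i A^{11} Q_{11}).\<close>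
definition obstr :: "cfun \<Rightarrow> cfun" where
  "obstr \<phi> p = (1/3) *
     (cov \<phi> 2 1 (Ztb \<phi>) (cov \<phi> 2 0 (Ztb \<phi>) (Q11 \<phi>)) p / (hfun \<phi> p)\<^sup>2
      - \<i> * Aup11 \<phi> p * Q11 \<phi> p)"

definition bihom :: "nat \<Rightarrow> nat \<Rightarrow> cfun \<Rightarrow> bool" where
  "bihom p q P \<longleftrightarrow> (\<exists>c :: nat \<Rightarrow> nat \<Rightarrow> complex. \<forall>z w.
     P (z, w) = (\<Sum>a\<le>p. \<Sum>b\<le>q. c a b * z ^ a * w ^ (p - a) * cnj z ^ b * cnj w ^ (q - b)))"

definition laplacian :: "cfun \<Rightarrow> cfun" where
  "laplacian P x = (\<Sum>e\<in>Basis. frechet_derivative (\<lambda>y. frechet_derivative P (at y) e) (at x) e)"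

definition Hpq :: "nat \<Rightarrow> nat \<Rightarrow> cfun \<Rightarrow> bool" where
  "Hpq p q P \<longleftrightarrow> bihom p q P \<and> (\<forall>x. laplacian P x = 0)"

text \<open>L^2(S^3) pairing, up to a positive constant: integrate the 0-homogeneous extensions
  over the unit ball of R^4 (polar coordinates).\<close>
definition S3_inner :: "cfun \<Rightarrow> cfun \<Rightarrow> complex" where
  "S3_inner f g = integral (ball 0 1)
     (\<lambda>x::C2. f (inverse (norm x) *\<^sub>R x) * cnj (g (inverse (norm x) *\<^sub>R x)))"

definition D0perp :: "cfun \<Rightarrow> bool" where
  "D0perp \<phi> \<longleftrightarrow> S3_smooth \<phi> \<and>
     (\<forall>p q P. 2 \<le> q \<longrightarrow> Hpq p q P \<longrightarrow> S3_inner \<phi> P = 0)"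

end

(* Integrate the obstruction density over the sphere.  The second covariant divergence of the
   Cartan tensor is a divergence for the measure of the fixed contact form, so only
   -(i/3) A^11 Q_11 contributes, and up to O(t^3) its integral is -(i/3) t^2 <q, a>, where a and q
   are the first variations of A_11 and Q_11.  Hence second order flatness forces <q, a> = 0.

   Write Z = Z_1 and W = Z_1bar.  Since W maps H_{p,q} to H_{p+1,q-1}, membership in the slice
   means W W phi = 0; then the variation of R vanishes, a = -(T + 4i) phi and
   q = T a + 3 i a + (2i/3) Z W a.  With N = -ZW and M = -WZ, both nonnegative, T = i (M - N), so
   -i <q, a> = <(M + 3 - 5/3 N) a, a>.  W W phi = 0 implies N (M - 2N + 2) phi = 0, that is, on the
   relevant joint spectrum N = 0 or M = 2N - 2, and there M + 3 - 5/3 N is positive. *)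

theory Submission
  imports Defs
begin

section \<open>Smooth functions and Wirtinger derivatives\<close>

text \<open>The second order term of the family drops out because A^11 and Q_11 both vanish at t =
  0: the t^2 coefficient of their product sees only first variations, so no second variation of
  curvature is ever computed.

  The numbers come from the spectrum. On H_{p,q} one has N = q (p + 1) and M = p (q + 1), so q = 0
  means N = 0 and q = 1 gives M = 2N - 2; there the form is M + 3, respectively N/3 + 1. Moreover a
  = -i (M - N + 4) phi is a nonzero multiple of phi on each of these spaces. The proof still never
  expands in harmonics: W W phi = 0 is tested against them, and positivity is certified by a few
  quadratic forms.

  Two obstacles shape the rest. The hypothesis is pointwise on the sphere while integration needs a
  uniform remainder, so all curvature quantities are kept in one algebra of families that is closed
  under fixed derivations. And the integral is a Lebesgue integral of homogeneous extensions over
  the ball, so the divergence theorem is derived from invariance under the flows that define the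
  frame.\<close>

definition D :: "C2 \<Rightarrow> cfun \<Rightarrow> cfun" where
  "D v f = (\<lambda>x. frechet_derivative f (at x) v)"

lemma C_inf_has_derivative: "C_inf f \<Longrightarrow> (f has_derivative (\<lambda>v. D v f x)) (at x)"
  unfolding D_def by (erule C_inf.cases) (metis frechet_derivative_works)

lemma C_inf_D: "C_inf f \<Longrightarrow> C_inf (D v f)"
  unfolding D_def by (erule C_inf.cases) blast

lemma D_eqI: "(\<And>x. (f has_derivative f' x) (at x)) \<Longrightarrow> D v f = (\<lambda>x. f' x v)"
  unfolding D_def using frechet_derivative_at[of f "f' x" x for x] by (intro ext) simp

lemma C_inf_continuous_on: "C_inf f \<Longrightarrow> continuous_on A f"
  by (rule has_derivative_continuous_on) (rule has_derivative_at_withinI[OF C_inf_has_derivative])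

text \<open>Plain coinduction does not close for products, since the derivative of a product is a
  sum of products. The closure of \<open>C_inf\<close> under the algebra operations is stable under
  differentiation, hence serves as its own coinduction invariant.\<close>

inductive smooth_alg :: "cfun \<Rightarrow> bool" where
  base: "C_inf f \<Longrightarrow> smooth_alg f"
| const: "smooth_alg (\<lambda>x. c)"
| linear: "bounded_linear f \<Longrightarrow> smooth_alg f"
| add: "smooth_alg f \<Longrightarrow> smooth_alg g \<Longrightarrow> smooth_alg (\<lambda>x. f x + g x)"
| mult: "smooth_alg f \<Longrightarrow> smooth_alg g \<Longrightarrow> smooth_alg (\<lambda>x. f x * g x)"
| cnj: "smooth_alg f \<Longrightarrow> smooth_alg (\<lambda>x. cnj (f x))"
| inverse: "smooth_alg f \<Longrightarrow> (\<And>x. f x \<noteq> 0) \<Longrightarrow> smooth_alg (\<lambda>x. inverse (f x))"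

lemma smooth_alg_derivative:
  assumes "smooth_alg f"
  shows "\<exists>f'. (\<forall>x. (f has_derivative (\<lambda>v. f' v x)) (at x)) \<and> (\<forall>v. smooth_alg (f' v))"
  using assms
proof induction
  case (base f)
  then show ?case
    by (intro exI[of _ "\<lambda>v. D v f"]) (auto intro: C_inf_has_derivative C_inf_D smooth_alg.base)
next
  case (const c)
  then show ?case by (intro exI[of _ "\<lambda>v x. 0"]) (auto intro: smooth_alg.const)
next
  case (linear f)
  then show ?case
    by (intro exI[of _ "\<lambda>v x. f v"]) (auto intro: smooth_alg.const bounded_linear_imp_has_derivative)
next
  case (add f g)
  then obtain f' g' where "\<forall>x. (f has_derivative (\<lambda>v. f' v x)) (at x)" "\<forall>v. smooth_alg (f' v)"
    "\<forall>x. (g has_derivative (\<lambda>v. g' v x)) (at x)" "\<forall>v. smooth_alg (g' v)"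
    by blast
  then show ?case
    by (intro exI[of _ "\<lambda>v x. f' v x + g' v x"]) (auto intro!: smooth_alg.add derivative_intros)
next
  case (mult f g)
  then obtain f' g' where "\<forall>x. (f has_derivative (\<lambda>v. f' v x)) (at x)" "\<forall>v. smooth_alg (f' v)"
    "\<forall>x. (g has_derivative (\<lambda>v. g' v x)) (at x)" "\<forall>v. smooth_alg (g' v)"
    by blast
  with mult show ?case
    by (intro exI[of _ "\<lambda>v x. f x * g' v x + f' v x * g x"])
       (auto intro!: smooth_alg.add smooth_alg.mult derivative_intros)
next
  case (cnj f)
  then obtain f' where "\<forall>x. (f has_derivative (\<lambda>v. f' v x)) (at x)" "\<forall>v. smooth_alg (f' v)"
    by blast
  then show ?case
    by (intro exI[of _ "\<lambda>v x. cnj (f' v x)"])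
       (auto intro!: smooth_alg.cnj bounded_linear.has_derivative[OF bounded_linear_cnj])
next
  case (inverse f)
  then obtain f' where "\<forall>x. (f has_derivative (\<lambda>v. f' v x)) (at x)" "\<forall>v. smooth_alg (f' v)"
    by blast
  note f' = this[rule_format]
  have "((\<lambda>x. inverse (f x)) has_derivative (\<lambda>v. (-1) * (inverse (f x) * f' v x * inverse (f x)))) (at x)" for x
    by (rule has_derivative_eq_rhs[OF Deriv.has_derivative_inverse[OF inverse.hyps(2) f'(1)]]) simp
  moreover have "smooth_alg (\<lambda>x. (-1) * (inverse (f x) * f' v x * inverse (f x)))" for v
    by (intro smooth_alg.mult smooth_alg.const smooth_alg.inverse inverse.hyps f')
  ultimately show ?case
    by (intro exI[of _ "\<lambda>v x. (-1) * (inverse (f x) * f' v x * inverse (f x))"] conjI allI)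
qed

lemma smooth_alg_C_inf: "smooth_alg f \<Longrightarrow> C_inf f"
proof (coinduction arbitrary: f)
  case C_inf
  obtain f' where f': "\<forall>x. (f has_derivative (\<lambda>v. f' v x)) (at x)" "\<forall>v. smooth_alg (f' v)"
    using smooth_alg_derivative[OF C_inf] by blast
  have "(\<lambda>x. frechet_derivative f (at x) v) = f' v" for v
    using D_eqI[of f "\<lambda>x v. f' v x" v] f'(1) unfolding D_def by blast
  with f' show ?case by (auto simp: differentiable_def)
qed

lemma C_inf_const: "C_inf (\<lambda>x. c)"
  by (intro smooth_alg_C_inf smooth_alg.const)

lemma C_inf_linear: "bounded_linear f \<Longrightarrow> C_inf f"
  by (intro smooth_alg_C_inf smooth_alg.linear)

lemma C_inf_add: "C_inf f \<Longrightarrow> C_inf g \<Longrightarrow> C_inf (\<lambda>x. f x + g x)"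
  by (rule smooth_alg_C_inf, rule smooth_alg.add) (rule smooth_alg.base, assumption)+

lemma C_inf_mult: "C_inf f \<Longrightarrow> C_inf g \<Longrightarrow> C_inf (\<lambda>x. f x * g x)"
  by (rule smooth_alg_C_inf, rule smooth_alg.mult) (rule smooth_alg.base, assumption)+

lemma C_inf_cnj: "C_inf f \<Longrightarrow> C_inf (\<lambda>x. cnj (f x))"
  by (rule smooth_alg_C_inf, rule smooth_alg.cnj) (rule smooth_alg.base)

lemma C_inf_inverse: "C_inf f \<Longrightarrow> (\<And>x. f x \<noteq> 0) \<Longrightarrow> C_inf (\<lambda>x. inverse (f x))"
  by (rule smooth_alg_C_inf, rule smooth_alg.inverse, rule smooth_alg.base) simp_all

lemma C_inf_minus: "C_inf f \<Longrightarrow> C_inf (\<lambda>x. - f x)"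
  using C_inf_mult[OF C_inf_const[of "-1"]] by simp

lemma C_inf_diff: "C_inf f \<Longrightarrow> C_inf g \<Longrightarrow> C_inf (\<lambda>x. f x - g x)"
  using C_inf_add[OF _ C_inf_minus] by simp

lemma C_inf_divide_const: "C_inf f \<Longrightarrow> C_inf (\<lambda>x. f x / c)"
  using C_inf_mult[OF _ C_inf_const[of "inverse c"]] by (simp add: divide_inverse)

lemma C_inf_power: "C_inf f \<Longrightarrow> C_inf (\<lambda>x. f x ^ n)"
  by (induction n) (auto intro: C_inf_const C_inf_mult)

lemma C_inf_fst: "C_inf fst" and C_inf_snd: "C_inf snd"
  by (auto intro: C_inf_linear bounded_linear_fst bounded_linear_snd)

lemmas C_inf_intros = C_inf_const C_inf_add C_inf_mult C_inf_cnj C_inf_minus C_inf_diff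
  C_inf_divide_const C_inf_power C_inf_fst C_inf_snd

lemma D_const: "D v (\<lambda>x. c) = (\<lambda>x. 0)"
  by (rule D_eqI) auto

lemma D_linear: "bounded_linear f \<Longrightarrow> D v f = (\<lambda>x. f v)"
  by (rule D_eqI) (rule bounded_linear_imp_has_derivative)

lemma D_add: "C_inf f \<Longrightarrow> C_inf g \<Longrightarrow> D v (\<lambda>x. f x + g x) = (\<lambda>x. D v f x + D v g x)"
  by (rule D_eqI) (auto intro!: derivative_intros C_inf_has_derivative)

lemma D_mult: "C_inf f \<Longrightarrow> C_inf g \<Longrightarrow> D v (\<lambda>x. f x * g x) = (\<lambda>x. f x * D v g x + D v f x * g x)"
  by (rule D_eqI) (auto intro!: derivative_intros C_inf_has_derivative)

lemma D_cnj: "C_inf f \<Longrightarrow> D v (\<lambda>x. cnj (f x)) = (\<lambda>x. cnj (D v f x))"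
  by (rule D_eqI) (auto intro!: bounded_linear.has_derivative[OF bounded_linear_cnj] C_inf_has_derivative)

lemma C_inf_line_derivative:
  assumes "C_inf f"
  shows "((\<lambda>t. f (y + t *\<^sub>R v)) has_vector_derivative D v f (y + t *\<^sub>R v)) (at t within A)"
proof -
  interpret bounded_linear "\<lambda>v. D v f (y + t *\<^sub>R v')" for v'
    using C_inf_has_derivative[OF assms] by (rule has_derivative_bounded_linear)
  have "((\<lambda>t. y + t *\<^sub>R v) has_derivative (\<lambda>s. s *\<^sub>R v)) (at t within A)"
    by (auto intro!: derivative_eq_intros)
  from has_derivative_compose[OF this C_inf_has_derivative[OF assms]]
  show ?thesis unfolding has_vector_derivative_def by (simp add: scaleR)
qed

text \<open>Symmetry of second derivatives: differentiate
  \<open>f (x + s u + t v) - f (x + s u) = \<integral>\<^sub>0\<^sup>t D v f (x + s u + \<tau> v) d\<tau>\<close> in \<open>s\<close>, then in \<open>t\<close>.\<close>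
lemma D_commute:
  assumes f: "C_inf f"
  shows "D u (D v f) x = D v (D u f) x"
proof -
  define g where "g = D u (D v f)"
  have C: "C_inf g" "C_inf (D v f)" "C_inf (D u f)"
    by (auto simp: g_def intro!: C_inf_D f)
  have *: "D u f (x + t *\<^sub>R v) = D u f x + integral {0..t} (\<lambda>\<tau>. g (x + \<tau> *\<^sub>R v))" if "t \<ge> 0" for t
  proof -
    define K where "K = (\<lambda>s. integral (cbox 0 t) (\<lambda>\<tau>. D v f ((x + \<tau> *\<^sub>R v) + s *\<^sub>R u)))"
    have cont: "continuous_on S (\<lambda>(s, \<tau>). h ((x + \<tau> *\<^sub>R v) + s *\<^sub>R u))" if "C_inf h" for h S
      unfolding split_beta
      by (rule continuous_on_compose2[OF C_inf_continuous_on[OF that, of UNIV]])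
        (auto intro!: continuous_intros)
    have cont1: "continuous_on S (\<lambda>\<tau>. h ((x + \<tau> *\<^sub>R v) + s *\<^sub>R u))" if "C_inf h" for h S s
      by (rule continuous_on_compose2[OF C_inf_continuous_on[OF that, of UNIV]])
        (auto intro!: continuous_intros)
    have K: "K s = f (x + t *\<^sub>R v + s *\<^sub>R u) - f (x + s *\<^sub>R u)" for s
    proof -
      have "((\<lambda>\<tau>. D v f ((x + s *\<^sub>R u) + \<tau> *\<^sub>R v)) has_integral
          f ((x + s *\<^sub>R u) + t *\<^sub>R v) - f ((x + s *\<^sub>R u) + 0 *\<^sub>R v)) {0..t}"
        by (rule fundamental_theorem_of_calculus[OF that]) (rule C_inf_line_derivative[OF f])
      from integral_unique[OF this] show ?thesis
        unfolding K_def by (simp add: algebra_simps)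
    qed
    have "(K has_vector_derivative integral (cbox 0 t) (\<lambda>\<tau>. g (x + \<tau> *\<^sub>R v + 0 *\<^sub>R u))) (at 0 within UNIV)"
      unfolding K_def
    proof (rule leibniz_rule_vector_derivative)
      fix s \<tau>
      show "((\<lambda>s. D v f (x + \<tau> *\<^sub>R v + s *\<^sub>R u)) has_vector_derivative g (x + \<tau> *\<^sub>R v + s *\<^sub>R u))
        (at s within UNIV)"
        unfolding g_def by (rule C_inf_line_derivative[OF C(2)])
      show "(\<lambda>\<tau>. D v f (x + \<tau> *\<^sub>R v + s *\<^sub>R u)) integrable_on cbox 0 t"
        by (intro integrable_continuous cont1 C)
    qed (auto intro: cont[OF C(1)])
    moreover have "(K has_vector_derivative D u f (x + t *\<^sub>R v + 0 *\<^sub>R u) - D u f (x + 0 *\<^sub>R u)) (at 0 within UNIV)"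
      unfolding K[abs_def] by (intro has_vector_derivative_diff C_inf_line_derivative f)
    ultimately show ?thesis
      using vector_derivative_unique_at by fastforce
  qed
  have "((\<lambda>t. D u f (x + t *\<^sub>R v)) has_vector_derivative D v (D u f) (x + 0 *\<^sub>R v)) (at 0 within {0..1})"
    by (rule C_inf_line_derivative[OF C(3)])
  moreover have "((\<lambda>t. D u f (x + t *\<^sub>R v)) has_vector_derivative 0 + g (x + 0 *\<^sub>R v)) (at 0 within {0..1})"
  proof (rule has_vector_derivative_transform[where f="\<lambda>t. D u f x + integral {0..t} (\<lambda>\<tau>. g (x + \<tau> *\<^sub>R v))"])
    have "continuous_on {0..1} (\<lambda>\<tau>. g (x + \<tau> *\<^sub>R v))"
      by (rule continuous_on_compose2[OF C_inf_continuous_on[OF C(1), of UNIV]])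
        (auto intro!: continuous_intros)
    then show "((\<lambda>t. D u f x + integral {0..t} (\<lambda>\<tau>. g (x + \<tau> *\<^sub>R v))) has_vector_derivative
       0 + g (x + 0 *\<^sub>R v)) (at 0 within {0..1})"
      by (intro has_vector_derivative_add has_vector_derivative_const integral_has_vector_derivative) auto
  qed (use * in auto)
  ultimately have "D v (D u f) (x + 0 *\<^sub>R v) = 0 + g (x + 0 *\<^sub>R v)"
    by (intro vector_derivative_unique_within_closed_interval[of 0 1 0]) auto
  then show ?thesis by (simp add: g_def)
qed

section \<open>Wirtinger derivatives\<close>

definition dz :: vfield where "dz f = (\<lambda>x. (D (1, 0) f x - \<i> * D (\<i>, 0) f x) / 2)"
definition dzb :: vfield where "dzb f = (\<lambda>x. (D (1, 0) f x + \<i> * D (\<i>, 0) f x) / 2)"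
definition dw :: vfield where "dw f = (\<lambda>x. (D (0, 1) f x - \<i> * D (0, \<i>) f x) / 2)"
definition dwb :: vfield where "dwb f = (\<lambda>x. (D (0, 1) f x + \<i> * D (0, \<i>) f x) / 2)"

lemmas wirtinger_defs = dz_def dzb_def dw_def dwb_def

lemma D_wirtinger:
  assumes "C_inf f"
  shows "D (a, b) f x = a * dz f x + cnj a * dzb f x + b * dw f x + cnj b * dwb f x"
proof -
  interpret bounded_linear "\<lambda>v. D v f x"
    using C_inf_has_derivative[OF assms] by (rule has_derivative_bounded_linear)
  have "(a, b) = Re a *\<^sub>R (1, 0) + Im a *\<^sub>R (\<i>, 0) + (Re b *\<^sub>R (0, 1) + Im b *\<^sub>R (0, \<i>))"
    by (simp add: complex_eq_iff)
  then have "D (a, b) f x = Re a *\<^sub>R D (1, 0) f x + Im a *\<^sub>R D (\<i>, 0) f x +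
      (Re b *\<^sub>R D (0, 1) f x + Im b *\<^sub>R D (0, \<i>) f x)"
    by (simp only: add scaleR)
  then show ?thesis
    by (simp add: wirtinger_defs complex_eq_iff field_simps)
qed

lemma C_inf_wirtinger:
  assumes "C_inf f" shows "C_inf (dz f)" "C_inf (dzb f)" "C_inf (dw f)" "C_inf (dwb f)"
  unfolding wirtinger_defs by (intro C_inf_intros C_inf_D assms)+

lemma wirtinger_const: "dz (\<lambda>x. c) = (\<lambda>x. 0)" "dzb (\<lambda>x. c) = (\<lambda>x. 0)" "dw (\<lambda>x. c) = (\<lambda>x. 0)" "dwb (\<lambda>x. c) = (\<lambda>x. 0)"
  by (simp_all add: wirtinger_defs D_const)

lemma wirtinger_add:
  assumes "C_inf f" "C_inf g"
  shows "dz (\<lambda>x. f x + g x) = (\<lambda>x. dz f x + dz g x)" "dzb (\<lambda>x. f x + g x) = (\<lambda>x. dzb f x + dzb g x)"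
    "dw (\<lambda>x. f x + g x) = (\<lambda>x. dw f x + dw g x)" "dwb (\<lambda>x. f x + g x) = (\<lambda>x. dwb f x + dwb g x)"
  by (simp_all add: wirtinger_defs D_add[OF assms] fun_eq_iff add_divide_distrib diff_divide_distrib algebra_simps)

lemma wirtinger_mult:
  assumes "C_inf f" "C_inf g"
  shows "dz (\<lambda>x. f x * g x) = (\<lambda>x. f x * dz g x + dz f x * g x)"
    "dzb (\<lambda>x. f x * g x) = (\<lambda>x. f x * dzb g x + dzb f x * g x)"
    "dw (\<lambda>x. f x * g x) = (\<lambda>x. f x * dw g x + dw f x * g x)"
    "dwb (\<lambda>x. f x * g x) = (\<lambda>x. f x * dwb g x + dwb f x * g x)"
  by (simp_all add: wirtinger_defs D_mult[OF assms] fun_eq_iff add_divide_distrib diff_divide_distrib algebra_simps)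

lemma wirtinger_cnj:
  assumes "C_inf f"
  shows "dz (\<lambda>x. cnj (f x)) = (\<lambda>x. cnj (dzb f x))" "dzb (\<lambda>x. cnj (f x)) = (\<lambda>x. cnj (dz f x))"
    "dw (\<lambda>x. cnj (f x)) = (\<lambda>x. cnj (dwb f x))" "dwb (\<lambda>x. cnj (f x)) = (\<lambda>x. cnj (dw f x))"
  by (simp_all add: wirtinger_defs D_cnj[OF assms])

lemma wirtinger_coord:
  "dz fst = (\<lambda>x. 1)" "dzb fst = (\<lambda>x. 0)" "dw fst = (\<lambda>x. 0)" "dwb fst = (\<lambda>x. 0)"
  "dz snd = (\<lambda>x. 0)" "dzb snd = (\<lambda>x. 0)" "dw snd = (\<lambda>x. 1)" "dwb snd = (\<lambda>x. 0)"
  by (simp_all add: wirtinger_defs D_linear bounded_linear_fst bounded_linear_snd)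

lemma D_lin_comb:
  assumes "C_inf f" "C_inf g"
  shows "D v (\<lambda>x. (f x + c * g x) / 2) = (\<lambda>x. (D v f x + c * D v g x) / 2)"
proof -
  have *: "(\<lambda>x. (f x + c * g x) / 2) = (\<lambda>x. (1/2) * (f x + c * g x))" by auto
  show ?thesis
    unfolding * by (subst D_mult D_add; (intro C_inf_intros assms)?)+ (simp add: D_const)
qed

lemma wirtinger_commute:
  assumes "C_inf f"
  shows "dzb (dz f) = dz (dzb f)" "dw (dz f) = dz (dw f)" "dwb (dz f) = dz (dwb f)"
    "dw (dzb f) = dzb (dw f)" "dwb (dzb f) = dzb (dwb f)" "dwb (dw f) = dw (dwb f)"
proof -
  have L: "D v (\<lambda>x. (D a f x + \<i> * D b f x) / 2) = (\<lambda>x. (D v (D a f) x + \<i> * D v (D b f) x) / 2)"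
    "D v (\<lambda>x. (D a f x - \<i> * D b f x) / 2) = (\<lambda>x. (D v (D a f) x - \<i> * D v (D b f) x) / 2)" for a b v
    using D_lin_comb[of "D a f" "D b f" v "\<i>"] D_lin_comb[of "D a f" "D b f" v "-\<i>"]
    by (simp_all add: C_inf_D[OF assms])
  show "dzb (dz f) = dz (dzb f)" "dw (dz f) = dz (dw f)" "dwb (dz f) = dz (dwb f)"
    "dw (dzb f) = dzb (dw f)" "dwb (dzb f) = dzb (dwb f)" "dwb (dw f) = dw (dwb f)"
    unfolding wirtinger_defs L
    by (rule ext, simp add: D_commute[OF assms, of "(\<i>, 0)" "(1, 0)"]
      D_commute[OF assms, of "(0, 1)" "(b, 0)" for b] D_commute[OF assms, of "(0, \<i>)" "(b, 0)" for b]
      D_commute[OF assms, of "(0, \<i>)" "(0, 1)"] add_divide_distrib diff_divide_distrib algebra_simps)+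
qed

lemma wirtinger_diff:
  assumes "C_inf f" "C_inf g"
  shows "dz (\<lambda>x. f x - g x) = (\<lambda>x. dz f x - dz g x)" "dzb (\<lambda>x. f x - g x) = (\<lambda>x. dzb f x - dzb g x)"
    "dw (\<lambda>x. f x - g x) = (\<lambda>x. dw f x - dw g x)" "dwb (\<lambda>x. f x - g x) = (\<lambda>x. dwb f x - dwb g x)"
  using wirtinger_add[OF assms(1) C_inf_mult[OF C_inf_const[of "-1"] assms(2)]]
    wirtinger_mult[OF C_inf_const[of "-1"] assms(2)] by (simp_all add: wirtinger_const)

section \<open>The frame on the sphere\<close>

lemma along_C_inf:
  assumes "C_inf g" "((\<lambda>t. fl t p) has_vector_derivative (a, b)) (at 0)" "fl 0 p = p"
  shows "along fl g p = a * dz g p + cnj a * dzb g p + b * dw g p + cnj b * dwb g p"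
proof -
  interpret bounded_linear "\<lambda>v. D v g p"
    using C_inf_has_derivative[OF assms(1)] by (rule has_derivative_bounded_linear)
  have "((\<lambda>t. g (fl t p)) has_derivative (\<lambda>t. D (t *\<^sub>R (a, b)) g p)) (at 0)"
    using has_derivative_compose[OF assms(2)[unfolded has_vector_derivative_def] C_inf_has_derivative[OF assms(1)]]
    unfolding assms(3) .
  then have "((\<lambda>t. g (fl t p)) has_vector_derivative D (a, b) g p) (at 0)"
    unfolding has_vector_derivative_def by (simp only: scaleR)
  then show ?thesis
    unfolding along_def using D_wirtinger[OF assms(1)] by (simp add: vector_derivative_at)
qed

lemma flow_derivatives:
  "((\<lambda>t. flowX t p) has_vector_derivative (cnj (snd p), - cnj (fst p))) (at 0)"
  "((\<lambda>t. flowY t p) has_vector_derivative (\<i> * cnj (snd p), - \<i> * cnj (fst p))) (at 0)"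
  "((\<lambda>t. flowT t p) has_vector_derivative (\<i> * fst p, \<i> * snd p)) (at 0)"
proof -
  have "cis t = of_real (cos t) + \<i> * of_real (sin t)" for t
    by (simp add: complex_eq_iff)
  note cis = this[abs_def]
  show "((\<lambda>t. flowX t p) has_vector_derivative (cnj (snd p), - cnj (fst p))) (at 0)"
    "((\<lambda>t. flowY t p) has_vector_derivative (\<i> * cnj (snd p), - \<i> * cnj (fst p))) (at 0)"
    "((\<lambda>t. flowT t p) has_vector_derivative (\<i> * fst p, \<i> * snd p)) (at 0)"
    unfolding flowX_def flowY_def flowT_def cis split_beta
    by (auto intro!: derivative_eq_intros)
qed

text \<open>The velocity of \<open>flowY\<close> is \<open>\<i>\<close> times that of
  \<open>flowX\<close>. In X - iY the conjugate derivatives therefore cancel and the holomorphic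
  ones double; in X + iY it is the other way round.\<close>

lemma vector_fields_C_inf:
  assumes "C_inf g"
  shows "Z1 g = (\<lambda>p. cnj (snd p) * dz g p - cnj (fst p) * dw g p)"
    "Z1b g = (\<lambda>p. snd p * dzb g p - fst p * dwb g p)"
    "Tvf g = (\<lambda>p. \<i> * (fst p * dz g p + snd p * dw g p) - \<i> * (cnj (fst p) * dzb g p + cnj (snd p) * dwb g p))"
proof -
  have "flowX 0 p = p" "flowY 0 p = p" "flowT 0 p = p" for p
    by (simp_all add: flowX_def flowY_def flowT_def split_beta)
  note * = along_C_inf[where fl=flowX, OF assms flow_derivatives(1) this(1)]
    along_C_inf[where fl=flowY, OF assms flow_derivatives(2) this(2)] along_C_inf[where fl=flowT, OF assms flow_derivatives(3) this(3)]
  show "Z1 g = (\<lambda>p. cnj (snd p) * dz g p - cnj (fst p) * dw g p)"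
    "Z1b g = (\<lambda>p. snd p * dzb g p - fst p * dwb g p)"
    "Tvf g = (\<lambda>p. \<i> * (fst p * dz g p + snd p * dw g p) - \<i> * (cnj (fst p) * dzb g p + cnj (snd p) * dwb g p))"
    by (auto simp: Z1_def Z1b_def Tvf_def * algebra_simps add_divide_distrib diff_divide_distrib)
qed

lemma C_inf_vector_fields:
  assumes "C_inf g" shows "C_inf (Z1 g)" "C_inf (Z1b g)" "C_inf (Tvf g)"
  unfolding vector_fields_C_inf[OF assms] by (intro C_inf_intros C_inf_wirtinger assms)+

text \<open>The structure constants of an invariant frame on SU(2). All second derivatives cancel by
  symmetry, and the first order terms come from differentiating the coefficients. The opposite
  T-weights of \<open>Z1\<close> and \<open>Z1b\<close> are what later makes \<open>Tvf\<close>
  commute with \<open>Nop\<close>.\<close>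

lemma C_inf_commutators:
  assumes "C_inf g"
  shows "Z1 (Z1b g) p - Z1b (Z1 g) p = - \<i> * Tvf g p"
    "Tvf (Z1 g) p - Z1 (Tvf g) p = - 2 * \<i> * Z1 g p"
    "Tvf (Z1b g) p - Z1b (Tvf g) p = 2 * \<i> * Z1b g p"
  unfolding vector_fields_C_inf[OF assms] vector_fields_C_inf[OF C_inf_vector_fields(1)[OF assms], unfolded vector_fields_C_inf[OF assms]]
    vector_fields_C_inf[OF C_inf_vector_fields(2)[OF assms], unfolded vector_fields_C_inf[OF assms]]
    vector_fields_C_inf[OF C_inf_vector_fields(3)[OF assms], unfolded vector_fields_C_inf[OF assms]]
  by (simp_all add: wirtinger_mult wirtinger_diff wirtinger_add wirtinger_cnj wirtinger_coord wirtinger_const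
    C_inf_intros C_inf_wirtinger assms wirtinger_commute algebra_simps)

lemma S3_iff: "p \<in> S3 \<longleftrightarrow> fst p * cnj (fst p) + snd p * cnj (snd p) = 1"
proof -
  have "fst p * cnj (fst p) + snd p * cnj (snd p) = of_real ((cmod (fst p))\<^sup>2 + (cmod (snd p))\<^sup>2)"
    by (simp only: complex_norm_square[symmetric] of_real_add)
  moreover have "\<dots> = 1 \<longleftrightarrow> (cmod (fst p))\<^sup>2 + (cmod (snd p))\<^sup>2 = 1"
    by (rule of_real_eq_1_iff)
  ultimately show ?thesis by (simp only: S3_def split_beta mem_Collect_eq)
qed

lemma flow_S3:
  assumes "p \<in> S3" shows "flowX t p \<in> S3" "flowY t p \<in> S3" "flowT t p \<in> S3"
proof -
  have sc: "complex_of_real (sin t) * of_real (sin t) = 1 - of_real (cos t) * of_real (cos t)"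
    using sin_squared_eq[of t] by (metis of_real_1 of_real_diff of_real_mult power2_eq_square)
  have p: "snd p * cnj (snd p) = 1 - fst p * cnj (fst p)"
    using assms by (simp add: S3_iff eq_diff_eq add.commute)
  show "flowX t p \<in> S3" "flowY t p \<in> S3"
    unfolding S3_iff flowX_def flowY_def
    by (simp_all add: split_beta) (use p sc i_squared in algebra)+
  have "cis t * cnj (cis t) = 1" by (simp add: cis_cnj cis_mult)
  with p show "flowT t p \<in> S3" unfolding S3_iff flowT_def
    by (simp add: split_beta) algebra
qed

section \<open>Smooth functions on the sphere and their derivations\<close>

lemma S3_smoothE:
  assumes "S3_smooth f" obtains g where "C_inf g" "\<And>p. p \<in> S3 \<Longrightarrow> f p = g p"
  using assms unfolding S3_smooth_def by blast

lemma S3_smoothI: "C_inf g \<Longrightarrow> (\<And>p. p \<in> S3 \<Longrightarrow> f p = g p) \<Longrightarrow> S3_smooth f"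
  unfolding S3_smooth_def by blast

lemma S3_smooth_cong: "S3_smooth f \<Longrightarrow> (\<And>p. p \<in> S3 \<Longrightarrow> g p = f p) \<Longrightarrow> S3_smooth g"
  unfolding S3_smooth_def by metis

lemma S3_smooth_C_inf: "C_inf f \<Longrightarrow> S3_smooth f"
  by (auto intro: S3_smoothI)

lemma S3_smooth_const: "S3_smooth (\<lambda>p. c)"
  by (intro S3_smooth_C_inf C_inf_const)

lemma S3_smooth_add:
  assumes "S3_smooth f" "S3_smooth g" shows "S3_smooth (\<lambda>p. f p + g p)"
proof -
  from assms obtain f' g' where "C_inf f'" "\<And>p. p \<in> S3 \<Longrightarrow> f p = f' p" "C_inf g'" "\<And>p. p \<in> S3 \<Longrightarrow> g p = g' p"
    by (metis S3_smoothE)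
  then show ?thesis by (intro S3_smoothI[OF C_inf_add[of f' g']]) auto
qed

lemma S3_smooth_mult:
  assumes "S3_smooth f" "S3_smooth g" shows "S3_smooth (\<lambda>p. f p * g p)"
proof -
  from assms obtain f' g' where "C_inf f'" "\<And>p. p \<in> S3 \<Longrightarrow> f p = f' p" "C_inf g'" "\<And>p. p \<in> S3 \<Longrightarrow> g p = g' p"
    by (metis S3_smoothE)
  then show ?thesis by (intro S3_smoothI[OF C_inf_mult[of f' g']]) auto
qed

lemma S3_smooth_cnj:
  assumes "S3_smooth f" shows "S3_smooth (\<lambda>p. cnj (f p))"
proof -
  from assms obtain f' where "C_inf f'" "\<And>p. p \<in> S3 \<Longrightarrow> f p = f' p"
    by (metis S3_smoothE)
  then show ?thesis by (intro S3_smoothI[OF C_inf_cnj[of f']]) auto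
qed

lemma S3_smooth_minus: "S3_smooth f \<Longrightarrow> S3_smooth (\<lambda>p. - f p)"
  using S3_smooth_mult[OF S3_smooth_const[of "-1"]] by simp

lemma S3_smooth_diff: "S3_smooth f \<Longrightarrow> S3_smooth g \<Longrightarrow> S3_smooth (\<lambda>p. f p - g p)"
  using S3_smooth_add[OF _ S3_smooth_minus] by simp

text \<open>The reciprocal of an extension \<open>g\<close> need not be defined off the sphere, but
  \<open>|g|\<^sup>2 + (1 - |p|\<^sup>2)\<^sup>2\<close> vanishes nowhere and equals \<open>|g|\<^sup>2\<close> on the sphere.\<close>
lemma S3_smooth_inverse:
  assumes "S3_smooth f" "\<And>p. p \<in> S3 \<Longrightarrow> f p \<noteq> 0"
  shows "S3_smooth (\<lambda>p. inverse (f p))"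
proof -
  from assms obtain g where g: "C_inf g" "\<And>p. p \<in> S3 \<Longrightarrow> f p = g p"
    by (metis S3_smoothE)
  define s where "s p = 1 - (fst p * cnj (fst p) + snd p * cnj (snd p))" for p :: C2
  define d where "d p = g p * cnj (g p) + s p * cnj (s p)" for p
  have d: "C_inf d" unfolding d_def s_def by (intro C_inf_intros g)
  have "d p \<noteq> 0" for p
  proof -
    have "d p = of_real ((cmod (g p))\<^sup>2 + (cmod (s p))\<^sup>2)"
      unfolding d_def by (simp only: complex_norm_square[symmetric] of_real_add)
    moreover have "(cmod (g p))\<^sup>2 + (cmod (s p))\<^sup>2 \<noteq> 0"
      using assms(2)[of p] g(2)[of p] by (auto simp: sum_power2_eq_zero_iff S3_iff s_def)
    ultimately show ?thesis by (metis of_real_eq_0_iff)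
  qed
  then have "C_inf (\<lambda>p. cnj (g p) * inverse (d p))"
    by (intro C_inf_intros C_inf_inverse g d)
  moreover have "inverse (f p) = cnj (g p) * inverse (d p)" if "p \<in> S3" for p
    using that g(2) assms(2) by (simp add: d_def s_def S3_iff)
  ultimately show ?thesis by (rule S3_smoothI)
qed

lemma S3_smooth_divide:
  "S3_smooth f \<Longrightarrow> S3_smooth g \<Longrightarrow> (\<And>p. p \<in> S3 \<Longrightarrow> g p \<noteq> 0) \<Longrightarrow> S3_smooth (\<lambda>p. f p / g p)"
  unfolding divide_inverse by (intro S3_smooth_mult S3_smooth_inverse)

lemma along_cong:
  assumes "\<And>t q. q \<in> S3 \<Longrightarrow> fl t q \<in> S3" "\<And>q. q \<in> S3 \<Longrightarrow> f q = g q" "p \<in> S3"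
  shows "along fl f p = along fl g p"
  unfolding along_def using assms by simp

lemma vector_fields_cong:
  assumes "\<And>q. q \<in> S3 \<Longrightarrow> f q = g q" "p \<in> S3"
  shows "Z1 f p = Z1 g p" "Z1b f p = Z1b g p" "Tvf f p = Tvf g p"
  using along_cong[of flowX f g p] along_cong[of flowY f g p] along_cong[of flowT f g p] flow_S3 assms
  by (simp_all add: Z1_def Z1b_def Tvf_def)

text \<open>Values off the sphere are arbitrary, so every rule is relative to \<open>S3\<close>. The
  congruence clause expresses tangency: it allows a function to be replaced by any extension, or by
  an expression equal to it on the sphere only, before it is differentiated.\<close>

definition derivation :: "vfield \<Rightarrow> bool" where
  "derivation V \<longleftrightarrow> (\<forall>f. S3_smooth f \<longrightarrow> S3_smooth (V f)) \<and>
    (\<forall>f g. (\<forall>q\<in>S3. f q = g q) \<longrightarrow> (\<forall>p\<in>S3. V f p = V g p)) \<and>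
    (\<forall>f g. S3_smooth f \<longrightarrow> S3_smooth g \<longrightarrow> (\<forall>p\<in>S3. V (\<lambda>q. f q + g q) p = V f p + V g p)) \<and>
    (\<forall>f g. S3_smooth f \<longrightarrow> S3_smooth g \<longrightarrow> (\<forall>p\<in>S3. V (\<lambda>q. f q * g q) p = V f p * g p + f p * V g p)) \<and>
    (\<forall>c. \<forall>p\<in>S3. V (\<lambda>q. c) p = 0)"

lemma derivation_C_infI:
  assumes "\<And>f. C_inf f \<Longrightarrow> C_inf (V f)"
    and cong: "\<And>f g p. (\<And>q. q \<in> S3 \<Longrightarrow> f q = g q) \<Longrightarrow> p \<in> S3 \<Longrightarrow> V f p = V g p"
    and add: "\<And>f g p. C_inf f \<Longrightarrow> C_inf g \<Longrightarrow> V (\<lambda>q. f q + g q) p = V f p + V g p"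
    and mult: "\<And>f g p. C_inf f \<Longrightarrow> C_inf g \<Longrightarrow> V (\<lambda>q. f q * g q) p = V f p * g p + f p * V g p"
    and "\<And>c p. V (\<lambda>q. c) p = 0"
  shows "derivation V"
  unfolding derivation_def
proof (intro conjI allI impI ballI)
  fix f assume "S3_smooth f"
  then obtain f' where "C_inf f'" "\<And>p. p \<in> S3 \<Longrightarrow> f p = f' p" by (rule S3_smoothE) blast
  then show "S3_smooth (V f)" using S3_smoothI[OF assms(1)[of f'], of "V f"] cong[of f f'] by blast
next
  fix f g p assume "S3_smooth f" "S3_smooth g" and p: "p \<in> S3"
  then obtain f' g' where fg: "C_inf f'" "C_inf g'" "\<And>p. p \<in> S3 \<Longrightarrow> f p = f' p" "\<And>p. p \<in> S3 \<Longrightarrow> g p = g' p"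
    by (metis S3_smoothE)
  show "V (\<lambda>q. f q + g q) p = V f p + V g p" "V (\<lambda>q. f q * g q) p = V f p * g p + f p * V g p"
    using add[OF fg(1,2), of p] mult[OF fg(1,2), of p] fg(3,4) p
      cong[of "\<lambda>q. f q + g q" "\<lambda>q. f' q + g' q" p] cong[of "\<lambda>q. f q * g q" "\<lambda>q. f' q * g' q" p]
      cong[of f f' p] cong[of g g' p] by simp_all
next
  fix f g :: cfun and p assume "\<forall>q\<in>S3. f q = g q" "p \<in> S3"
  then show "V f p = V g p" by (intro cong) (rule bspec)
next
  show "V (\<lambda>q. c) p = 0" for c p by (rule assms(5))
qed

lemma derivation_Z1: "derivation Z1" and derivation_Z1b: "derivation Z1b" and derivation_Tvf: "derivation Tvf"
  by (rule derivation_C_infI; (rule vector_fields_cong C_inf_vector_fields, blast+)?;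
    simp add: vector_fields_C_inf C_inf_intros wirtinger_add wirtinger_mult wirtinger_const algebra_simps)+

lemma
  assumes "derivation V"
  shows derivation_smooth: "S3_smooth f \<Longrightarrow> S3_smooth (V f)"
    and derivation_cong: "(\<And>q. q \<in> S3 \<Longrightarrow> f q = g q) \<Longrightarrow> p \<in> S3 \<Longrightarrow> V f p = V g p"
    and derivation_add: "S3_smooth f \<Longrightarrow> S3_smooth g \<Longrightarrow> p \<in> S3 \<Longrightarrow> V (\<lambda>q. f q + g q) p = V f p + V g p"
    and derivation_mult: "S3_smooth f \<Longrightarrow> S3_smooth g \<Longrightarrow> p \<in> S3 \<Longrightarrow> V (\<lambda>q. f q * g q) p = V f p * g p + f p * V g p"
    and derivation_const: "p \<in> S3 \<Longrightarrow> V (\<lambda>q. c) p = 0"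
  using assms unfolding derivation_def by blast+

lemma derivation_minus:
  assumes "derivation V" "S3_smooth f" "p \<in> S3"
  shows "V (\<lambda>q. - f q) p = - V f p"
  using derivation_mult[OF assms(1) S3_smooth_const[of "-1"] assms(2,3)] derivation_const[OF assms(1,3)] by simp

lemma derivation_diff:
  assumes "derivation V" "S3_smooth f" "S3_smooth g" "p \<in> S3"
  shows "V (\<lambda>q. f q - g q) p = V f p - V g p"
  using derivation_add[OF assms(1,2) S3_smooth_minus[OF assms(3)] assms(4)] derivation_minus[OF assms(1,3,4)] by simp

lemma derivation_inverse:
  assumes V: "derivation V" and f: "S3_smooth f" "\<And>q. q \<in> S3 \<Longrightarrow> f q \<noteq> 0" and p: "p \<in> S3"
  shows "V (\<lambda>q. inverse (f q)) p = - V f p * inverse (f p) * inverse (f p)"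
proof -
  have "V (\<lambda>q. f q * inverse (f q)) p = V (\<lambda>q. 1) p"
    using f by (intro derivation_cong[OF V] p) simp
  then have "V f p * inverse (f p) + f p * V (\<lambda>q. inverse (f q)) p = 0"
    using derivation_mult[OF V f(1) S3_smooth_inverse[OF f] p] derivation_const[OF V p] by simp
  then show ?thesis using f(2)[OF p] by (simp add: field_simps add_eq_0_iff2)
qed

lemma derivation_divide:
  assumes V: "derivation V" and f: "S3_smooth f" and h: "S3_smooth h" "\<And>q. q \<in> S3 \<Longrightarrow> h q \<noteq> 0" and p: "p \<in> S3"
  shows "V (\<lambda>q. f q / h q) p = V f p / h p - f p * V h p / (h p)\<^sup>2"
  unfolding divide_inverse
  using derivation_mult[OF V f S3_smooth_inverse[OF h] p] derivation_inverse[OF V h p]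
  by (simp add: power2_eq_square)

lemma derivation_combination:
  assumes V: "derivation V" and W: "derivation W" and a: "S3_smooth a"
  shows "derivation (\<lambda>f p. V f p + a p * W f p)"
  unfolding derivation_def
proof (intro conjI allI impI ballI)
  show "S3_smooth (\<lambda>p. V f p + a p * W f p)" if "S3_smooth f" for f
    using that by (intro S3_smooth_add S3_smooth_mult a derivation_smooth[OF V] derivation_smooth[OF W])
next
  fix f g :: cfun and p assume *: "\<forall>q\<in>S3. f q = g q" "p \<in> S3"
  show "V f p + a p * W f p = V g p + a p * W g p"
    using derivation_cong[OF V, of f g p] derivation_cong[OF W, of f g p] * by simp
next
  fix f g p assume "S3_smooth f" "S3_smooth g" "p \<in> S3"
  then show "V (\<lambda>q. f q + g q) p + a p * W (\<lambda>q. f q + g q) p = V f p + a p * W f p + (V g p + a p * W g p)"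
    "V (\<lambda>q. f q * g q) p + a p * W (\<lambda>q. f q * g q) p = (V f p + a p * W f p) * g p + f p * (V g p + a p * W g p)"
    by (simp_all add: derivation_add[OF V] derivation_add[OF W] derivation_mult[OF V] derivation_mult[OF W] algebra_simps)
qed (simp add: derivation_const V W)

lemma derivation_Zt:
  assumes "S3_smooth \<phi>" shows "derivation (Zt \<phi>)" "derivation (Ztb \<phi>)"
  using derivation_combination[OF derivation_Z1 derivation_Z1b assms]
    derivation_combination[OF derivation_Z1b derivation_Z1 S3_smooth_cnj[OF assms]]
  unfolding Zt_def[abs_def] Ztb_def[abs_def] .

lemma vector_fields_cnj:
  assumes "S3_smooth f" "p \<in> S3"
  shows "Z1 (\<lambda>q. cnj (f q)) p = cnj (Z1b f p)" "Z1b (\<lambda>q. cnj (f q)) p = cnj (Z1 f p)"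
    "Tvf (\<lambda>q. cnj (f q)) p = cnj (Tvf f p)"
proof -
  obtain g where g: "C_inf g" "\<And>p. p \<in> S3 \<Longrightarrow> f p = g p" using assms(1) by (rule S3_smoothE) blast
  have *: "V (\<lambda>q. cnj (f q)) p = V (\<lambda>q. cnj (g q)) p" "V f p = V g p" if "derivation V" for V
    by (rule derivation_cong[OF that _ assms(2)], simp add: g(2))+
  show "Z1 (\<lambda>q. cnj (f q)) p = cnj (Z1b f p)" "Z1b (\<lambda>q. cnj (f q)) p = cnj (Z1 f p)"
    "Tvf (\<lambda>q. cnj (f q)) p = cnj (Tvf f p)"
    unfolding *[OF derivation_Z1] *[OF derivation_Z1b] *[OF derivation_Tvf]
    by (simp_all add: vector_fields_C_inf wirtinger_cnj g C_inf_cnj algebra_simps)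
qed

lemma commutators:
  assumes "S3_smooth f" "p \<in> S3"
  shows "Z1 (Z1b f) p - Z1b (Z1 f) p = - \<i> * Tvf f p"
    "Tvf (Z1 f) p - Z1 (Tvf f) p = - 2 * \<i> * Z1 f p"
    "Tvf (Z1b f) p - Z1b (Tvf f) p = 2 * \<i> * Z1b f p"
proof -
  obtain g where g: "C_inf g" "\<And>p. p \<in> S3 \<Longrightarrow> f p = g p" using assms(1) by (rule S3_smoothE) blast
  have 1: "V f q = V g q" if "derivation V" "q \<in> S3" for V q
    by (rule derivation_cong[OF that(1) _ that(2)]) (rule g(2))
  have 2: "W (V f) p = W (V g) p" if "derivation V" "derivation W" for V W
    by (rule derivation_cong[OF that(2) _ assms(2)]) (rule 1[OF that(1)])
  show "Z1 (Z1b f) p - Z1b (Z1 f) p = - \<i> * Tvf f p"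
    "Tvf (Z1 f) p - Z1 (Tvf f) p = - 2 * \<i> * Z1 f p"
    "Tvf (Z1b f) p - Z1b (Tvf f) p = 2 * \<i> * Z1b f p"
    unfolding 1[OF derivation_Z1 assms(2)] 1[OF derivation_Z1b assms(2)] 1[OF derivation_Tvf assms(2)]
      2[OF derivation_Z1 derivation_Z1b] 2[OF derivation_Z1b derivation_Z1] 2[OF derivation_Z1 derivation_Tvf]
      2[OF derivation_Tvf derivation_Z1] 2[OF derivation_Z1b derivation_Tvf] 2[OF derivation_Tvf derivation_Z1b]
    by (rule C_inf_commutators[OF g(1)])+
qed

section \<open>Tanaka-Webster data of a deformation\<close>

lemma hfun_eq: "hfun \<phi> p = 1 - \<phi> p * cnj (\<phi> p)"
  unfolding hfun_def of_real_diff complex_norm_square by simp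

lemma coord_derivatives:
  assumes "p \<in> S3"
  shows "Tvf fst p = \<i> * fst p" "Tvf snd p = \<i> * snd p"
    "Z1 fst p = cnj (snd p)" "Z1 snd p = - cnj (fst p)" "Z1b fst p = 0" "Z1b snd p = 0"
    "Tvf (\<lambda>q. cnj (fst q)) p = - \<i> * cnj (fst p)" "Tvf (\<lambda>q. cnj (snd q)) p = - \<i> * cnj (snd p)"
    "Z1b (\<lambda>q. cnj (fst q)) p = snd p" "Z1b (\<lambda>q. cnj (snd q)) p = - fst p"
    "Z1 (\<lambda>q. cnj (fst q)) p = 0" "Z1 (\<lambda>q. cnj (snd q)) p = 0"
  by (simp_all add: vector_fields_C_inf wirtinger_cnj wirtinger_coord C_inf_intros)

text \<open>This gives uniqueness of the coframe coefficients. The relation is tested on z, w and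
  their conjugates; |z|^2 + |w|^2 = 1 then allows the resulting linear system to be solved by
  explicit combinations.\<close>

lemma frame_independent:
  assumes p: "p \<in> S3"
    and zero: "\<And>f. C_inf f \<Longrightarrow> a * Tvf f p + b * Z1 f p + c * Z1b f p = 0"
  shows "a = 0 \<and> b = 0 \<and> c = 0"
proof -
  have *: "a * (\<i> * fst p) + b * cnj (snd p) + c * 0 = 0" "a * (\<i> * snd p) + b * - cnj (fst p) + c * 0 = 0"
    "a * (- \<i> * cnj (fst p)) + b * 0 + c * snd p = 0" "a * (- \<i> * cnj (snd p)) + b * 0 + c * - fst p = 0"
    using zero[OF C_inf_fst] zero[OF C_inf_snd] zero[OF C_inf_cnj[OF C_inf_fst]] zero[OF C_inf_cnj[OF C_inf_snd]]
    by (simp_all only: coord_derivatives[OF p])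
  have e: "a * \<i> * fst p + b * cnj (snd p) = 0" "a * \<i> * snd p - b * cnj (fst p) = 0"
    "- a * \<i> * cnj (fst p) + c * snd p = 0" "- a * \<i> * cnj (snd p) - c * fst p = 0"
    using * by algebra+
  have s: "fst p * cnj (fst p) + snd p * cnj (snd p) = 1" using p by (simp add: S3_iff)
  have "b = (a * \<i> * fst p + b * cnj (snd p)) * snd p - (a * \<i> * snd p - b * cnj (fst p)) * fst p"
    using s by algebra
  moreover have "c = (- a * \<i> * cnj (fst p) + c * snd p) * cnj (snd p) - (- a * \<i> * cnj (snd p) - c * fst p) * cnj (fst p)"
    using s by algebra
  moreover have "a * \<i> = (a * \<i> * fst p + b * cnj (snd p)) * cnj (fst p) + (a * \<i> * snd p - b * cnj (fst p)) * cnj (snd p)"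
    using s by algebra
  ultimately show ?thesis unfolding e by simp
qed

locale deformation =
  fixes \<phi> :: cfun
  assumes smooth: "S3_smooth \<phi>" and less_1: "\<And>p. p \<in> S3 \<Longrightarrow> cmod (\<phi> p) < 1"
begin

lemma hfun_nonzero: "p \<in> S3 \<Longrightarrow> hfun \<phi> p \<noteq> 0"
proof -
  assume "p \<in> S3"
  then have "(cmod (\<phi> p))\<^sup>2 < 1" using less_1 by (simp add: power_less_one_iff abs_square_less_1)
  then show ?thesis unfolding hfun_def of_real_eq_0_iff by simp
qed

lemma smooth_hfun: "S3_smooth (hfun \<phi>)"
  unfolding hfun_eq[abs_def] by (intro S3_smooth_diff S3_smooth_const S3_smooth_mult S3_smooth_cnj smooth)

lemmas derivations = derivation_Tvf derivation_Z1 derivation_Z1b derivation_Zt[OF smooth]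

text \<open>Evaluates the definite description in \<open>cof\<close>. For uniqueness, two
  coefficient triples are compared in the undeformed frame; the passage from \<open>Z1\<close>,
  \<open>Z1b\<close> to \<open>Zt\<close>, \<open>Ztb\<close> has determinant \<open>hfun\<close>,
  which is nonzero.\<close>

lemma cof_eqI:
  assumes p: "p \<in> S3"
    and V: "\<And>f. S3_smooth f \<Longrightarrow> V f p = c0 * Tvf f p + c1 * Zt \<phi> f p + c2 * Ztb \<phi> f p"
  shows "cof \<phi> V p = (c0, c1, c2)"
  unfolding cof_def
proof (rule the_equality)
  show "\<forall>f. S3_smooth f \<longrightarrow> V f p = fst (c0, c1, c2) * Tvf f p + fst (snd (c0, c1, c2)) * Zt \<phi> f p +
      snd (snd (c0, c1, c2)) * Ztb \<phi> f p"
    using V by simp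
next
  fix d :: "complex \<times> complex \<times> complex"
  assume d: "\<forall>f. S3_smooth f \<longrightarrow> V f p = fst d * Tvf f p + fst (snd d) * Zt \<phi> f p + snd (snd d) * Ztb \<phi> f p"
  obtain d0 d1 d2 where [simp]: "d = (d0, d1, d2)" by (cases d)
  have "(c0 - d0) * Tvf f p + ((c1 - d1) + (c2 - d2) * cnj (\<phi> p)) * Z1 f p +
      ((c1 - d1) * \<phi> p + (c2 - d2)) * Z1b f p = 0" if "C_inf f" for f
    using V[OF S3_smooth_C_inf[OF that]] d[rule_format, OF S3_smooth_C_inf[OF that]]
    by (simp add: Zt_def Ztb_def algebra_simps)
  from frame_independent[OF p this]
  have e: "c0 - d0 = 0" "(c1 - d1) + (c2 - d2) * cnj (\<phi> p) = 0" "(c1 - d1) * \<phi> p + (c2 - d2) = 0"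
    by auto
  have "(c1 - d1) * hfun \<phi> p = 0" "(c2 - d2) * hfun \<phi> p = 0"
    unfolding hfun_eq using e by algebra+
  then show "d = (c0, c1, c2)" using e(1) hfun_nonzero[OF p] by simp
qed

lemma cof_frame:
  assumes "p \<in> S3"
  shows "cof \<phi> Tvf p = (1, 0, 0)" "cof \<phi> (Zt \<phi>) p = (0, 1, 0)" "cof \<phi> (Ztb \<phi>) p = (0, 0, 1)"
  using assms by (auto intro!: cof_eqI)

lemma th_frame:
  assumes "p \<in> S3"
  shows "th0 \<phi> Tvf p = 1" "th0 \<phi> (Zt \<phi>) p = 0" "th0 \<phi> (Ztb \<phi>) p = 0"
    "th1 \<phi> Tvf p = 0" "th1 \<phi> (Zt \<phi>) p = 1" "th1 \<phi> (Ztb \<phi>) p = 0"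
    "th1b \<phi> Tvf p = 0" "th1b \<phi> (Zt \<phi>) p = 0" "th1b \<phi> (Ztb \<phi>) p = 1"
  by (simp_all add: th0_def th1_def th1b_def cof_frame assms)

lemma Zt_cnj:
  assumes "p \<in> S3"
  shows "Zt \<phi> (\<lambda>q. cnj (\<phi> q)) p = cnj (Ztb \<phi> \<phi> p)" "Ztb \<phi> (\<lambda>q. cnj (\<phi> q)) p = cnj (Zt \<phi> \<phi> p)"
  by (simp_all add: Zt_def Ztb_def vector_fields_cnj[OF smooth assms])

lemma derivation_hfun:
  assumes V: "derivation V" and p: "p \<in> S3"
  shows "V (hfun \<phi>) p = - (V \<phi> p * cnj (\<phi> p) + \<phi> p * V (\<lambda>q. cnj (\<phi> q)) p)"
  unfolding hfun_eq[abs_def]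
  by (simp add: derivation_diff[OF V] derivation_mult[OF V] derivation_const[OF V] S3_smooth_const
     S3_smooth_mult S3_smooth_cnj smooth p)

text \<open>\<open>conn0\<close>, \<open>conn1b\<close> and \<open>tors\<close> are, up to sign,
  components along the first frame field of the brackets of the frame: this is what the structure
  equation says on pairs of frame fields. It leaves the remaining coefficient \<open>conn1\<close>
  free, and metric compatibility determines it.\<close>

definition conn0 :: cfun where
  "conn0 p = - (2 * \<i> * (1 + \<phi> p * cnj (\<phi> p)) + cnj (\<phi> p) * Tvf \<phi> p) / hfun \<phi> p"

text \<open>\<open>(Ztb \<phi> \<phi> - cnj \<phi> * Zt \<phi> \<phi>) / hfun \<phi>\<close>, which simplifies because
  \<open>Ztb \<phi> \<phi> - cnj \<phi> * Zt \<phi> \<phi> = hfun \<phi> * Z1b \<phi>\<close>.\<close>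
definition conn1 :: cfun where
  "conn1 p = Z1b \<phi> p"

definition conn1b :: cfun where
  "conn1b p = - (cnj (Ztb \<phi> \<phi> p) + cnj (\<phi> p) * Ztb \<phi> \<phi> p) / hfun \<phi> p"

definition tors :: cfun where
  "tors p = - (cnj (Tvf \<phi> p) - 4 * \<i> * cnj (\<phi> p)) / hfun \<phi> p"

lemma expand_derivative:
  assumes "derivation V" "S3_smooth f" "p \<in> S3"
  shows "V (Zt \<phi> f) p = V (Z1 f) p + V \<phi> p * Z1b f p + \<phi> p * V (Z1b f) p"
    "V (Ztb \<phi> f) p = V (Z1b f) p + V (\<lambda>q. cnj (\<phi> q)) p * Z1 f p + cnj (\<phi> p) * V (Z1 f) p"
  unfolding Zt_def[abs_def] Ztb_def[abs_def]
  by (simp_all add: derivation_add[OF assms(1)] derivation_mult[OF assms(1)] derivation_smooth derivations S3_smooth_mult S3_smooth_cnj smooth assms)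

text \<open>Each bracket is first written in \<open>Tvf\<close>, \<open>Z1\<close>,
  \<open>Z1b\<close> with the undeformed commutators (the facts \<open>e\<close>), and then
  re-expressed in the deformed frame, which introduces the division by \<open>hfun\<close>.\<close>

lemma cof_brackets:
  assumes p: "p \<in> S3"
  shows "cof \<phi> (brk Tvf (Zt \<phi>)) p =
      (0, conn0 p, (Tvf \<phi> p + 4 * \<i> * \<phi> p) / hfun \<phi> p)"
    "cof \<phi> (brk Tvf (Ztb \<phi>)) p = (0, - tors p, cnj (conn0 p))"
    "cof \<phi> (brk (Zt \<phi>) (Ztb \<phi>)) p = (- \<i> * hfun \<phi> p, - conn1b p, cnj (conn1b p))"
proof -
  have h: "hfun \<phi> p \<noteq> 0" by (rule hfun_nonzero[OF p])
  have hc: "cnj (hfun \<phi> p) = hfun \<phi> p" by (simp add: hfun_eq mult.commute)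
  show "cof \<phi> (brk Tvf (Zt \<phi>)) p =
      (0, conn0 p, (Tvf \<phi> p + 4 * \<i> * \<phi> p) / hfun \<phi> p)"
  proof (rule cof_eqI[OF p])
    fix f assume f: "S3_smooth f"
    have e: "brk Tvf (Zt \<phi>) f p = - 2 * \<i> * Z1 f p + (Tvf \<phi> p + 2 * \<i> * \<phi> p) * Z1b f p"
      unfolding brk_def expand_derivative[OF derivation_Tvf f p] Zt_def[of _ "Tvf f"]
      using commutators[OF f p] by algebra
    show "brk Tvf (Zt \<phi>) f p = 0 * Tvf f p + conn0 p * Zt \<phi> f p +
        (Tvf \<phi> p + 4 * \<i> * \<phi> p) / hfun \<phi> p * Ztb \<phi> f p"
      using h unfolding conn0_def Zt_def[of _ f] Ztb_def[of _ f]
      by (simp add: field_simps) (use e hfun_eq[of \<phi> p] in algebra)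
  qed
  show "cof \<phi> (brk Tvf (Ztb \<phi>)) p = (0, - tors p, cnj (conn0 p))"
  proof (rule cof_eqI[OF p])
    fix f assume f: "S3_smooth f"
    have e: "brk Tvf (Ztb \<phi>) f p = 2 * \<i> * Z1b f p + (cnj (Tvf \<phi> p) - 2 * \<i> * cnj (\<phi> p)) * Z1 f p"
      unfolding brk_def expand_derivative[OF derivation_Tvf f p] Ztb_def[of _ "Tvf f"] vector_fields_cnj[OF smooth p]
      using commutators[OF f p] by algebra
    show "brk Tvf (Ztb \<phi>) f p = 0 * Tvf f p + - tors p * Zt \<phi> f p + cnj (conn0 p) * Ztb \<phi> f p"
      using h unfolding conn0_def Zt_def[of _ f] Ztb_def[of _ f] tors_def complex_cnj_divide hc
      by (simp add: field_simps) (use e hfun_eq[of \<phi> p] in algebra)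
  qed
  show "cof \<phi> (brk (Zt \<phi>) (Ztb \<phi>)) p = (- \<i> * hfun \<phi> p, - conn1b p, cnj (conn1b p))"
  proof (rule cof_eqI[OF p])
    fix f assume f: "S3_smooth f"
    have e: "brk (Zt \<phi>) (Ztb \<phi>) f p = - \<i> * hfun \<phi> p * Tvf f p + cnj (Ztb \<phi> \<phi> p) * Z1 f p - Ztb \<phi> \<phi> p * Z1b f p"
      unfolding brk_def expand_derivative[OF derivation_Zt(1)[OF smooth] f p]
        expand_derivative[OF derivation_Zt(2)[OF smooth] f p] Zt_cnj[OF p] hfun_eq
        Zt_def[of _ "Z1 f"] Zt_def[of _ "Z1b f"] Ztb_def[of _ "Z1 f"] Ztb_def[of _ "Z1b f"]
      using commutators[OF f p] by algebra
    show "brk (Zt \<phi>) (Ztb \<phi>) f p = - \<i> * hfun \<phi> p * Tvf f p + - conn1b p * Zt \<phi> f p +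
        cnj (conn1b p) * Ztb \<phi> f p"
      using h unfolding conn1b_def Zt_def[of _ f] Ztb_def[of _ f] complex_cnj_divide hc
      by (simp add: field_simps) (use e hfun_eq[of \<phi> p] in algebra)
  qed
qed

lemma d1_frame:
  assumes "derivation X" "derivation Y" "p \<in> S3" "\<And>q. q \<in> S3 \<Longrightarrow> \<alpha> X q = c" "\<And>q. q \<in> S3 \<Longrightarrow> \<alpha> Y q = d"
  shows "d1 \<alpha> X Y p = - \<alpha> (brk X Y) p"
  unfolding d1_def
  using derivation_cong[OF assms(1), of "\<alpha> Y" "\<lambda>q. d" p] derivation_cong[OF assms(2), of "\<alpha> X" "\<lambda>q. c" p]
    derivation_const[OF assms(1), of p d] derivation_const[OF assms(2), of p c] assms(3-5) by simp

text \<open>Needed for identifying the connection, and again for the divergence form of the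
  obstruction, where the third equation serves as the formula for the derivative of
  \<open>hfun\<close> along \<open>Ztb\<close>.\<close>

lemma connection_metric:
  assumes p: "p \<in> S3"
  shows "conn0 p + cnj (conn0 p) = Tvf (hfun \<phi>) p / hfun \<phi> p"
    "conn1 p + cnj (conn1b p) = Zt \<phi> (hfun \<phi>) p / hfun \<phi> p"
    "conn1b p + cnj (conn1 p) = Ztb \<phi> (hfun \<phi>) p / hfun \<phi> p"
proof -
  have h: "hfun \<phi> p \<noteq> 0" by (rule hfun_nonzero[OF p])
  have hc: "cnj (hfun \<phi> p) = hfun \<phi> p" by (simp add: hfun_eq mult.commute)
  note * = derivation_hfun[OF derivation_Tvf p] derivation_hfun[OF derivation_Zt(1)[OF smooth] p]
    derivation_hfun[OF derivation_Zt(2)[OF smooth] p]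
  show "conn0 p + cnj (conn0 p) = Tvf (hfun \<phi>) p / hfun \<phi> p"
    using h unfolding * conn0_def complex_cnj_divide hc vector_fields_cnj[OF smooth p]
    by (simp add: field_simps)
  show "conn1 p + cnj (conn1b p) = Zt \<phi> (hfun \<phi>) p / hfun \<phi> p"
    using h unfolding * conn1b_def conn1_def complex_cnj_divide hc Zt_cnj[OF p]
    by (simp add: field_simps Zt_def Ztb_def) (use hfun_eq[of \<phi> p] in algebra)
  show "conn1b p + cnj (conn1 p) = Ztb \<phi> (hfun \<phi>) p / hfun \<phi> p"
    using h unfolding * conn1b_def conn1_def complex_cnj_divide hc Zt_cnj[OF p]
    by (simp add: field_simps Zt_def Ztb_def) (use hfun_eq[of \<phi> p] in algebra)
qed

text \<open>On the three pairs of frame fields the structure equation reads off the first and last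
  connection coefficients and the torsion; the middle coefficient then follows from the metric
  condition along \<open>Zt\<close>.\<close>

lemma TW_eq:
  assumes p: "p \<in> S3"
  shows "TW \<phi> p = ((conn0 p, conn1 p, conn1b p), tors p)"
proof -
  have "d1 (th1 \<phi>) Tvf (Zt \<phi>) p = - conn0 p" "d1 (th1 \<phi>) Tvf (Ztb \<phi>) p = tors p"
    "d1 (th1 \<phi>) (Zt \<phi>) (Ztb \<phi>) p = conn1b p"
    using cof_brackets[OF p]
      d1_frame[where \<alpha>="th1 \<phi>", OF derivations(1,4) p th_frame(4,5)]
      d1_frame[where \<alpha>="th1 \<phi>", OF derivations(1,5) p th_frame(4,6)]
      d1_frame[where \<alpha>="th1 \<phi>", OF derivations(4,5) p th_frame(5,6)]
    by (simp_all add: th1_def[of _ "brk _ _"])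
  note * = this connection_metric[OF p] th_frame[OF p]
  show ?thesis
    unfolding TW_def
  proof (rule the_equality)
    show "case ((conn0 p, conn1 p, conn1b p), tors p) of (c, a) \<Rightarrow>
      (\<forall>(X, Y) \<in> set [(Tvf, Zt \<phi>), (Tvf, Ztb \<phi>), (Zt \<phi>, Ztb \<phi>)].
          d1 (th1 \<phi>) X Y p = wedge (th1 \<phi>) (om_at \<phi> c) X Y p + a * wedge (th0 \<phi>) (th1b \<phi>) X Y p) \<and>
      (\<forall>V \<in> set [Tvf, Zt \<phi>, Ztb \<phi>]. om_at \<phi> c V p + omc_at \<phi> c V p = V (hfun \<phi>) p / hfun \<phi> p)"
      by (simp add: * wedge_def om_at_def omc_at_def)
  next
    fix x :: "(complex \<times> complex \<times> complex) \<times> complex"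
    obtain c0 c1 c2 a where x: "x = ((c0, c1, c2), a)" by (metis prod.exhaust)
    assume "case x of (c, a) \<Rightarrow>
      (\<forall>(X, Y) \<in> set [(Tvf, Zt \<phi>), (Tvf, Ztb \<phi>), (Zt \<phi>, Ztb \<phi>)].
          d1 (th1 \<phi>) X Y p = wedge (th1 \<phi>) (om_at \<phi> c) X Y p + a * wedge (th0 \<phi>) (th1b \<phi>) X Y p) \<and>
      (\<forall>V \<in> set [Tvf, Zt \<phi>, Ztb \<phi>]. om_at \<phi> c V p + omc_at \<phi> c V p = V (hfun \<phi>) p / hfun \<phi> p)"
    then have "conn0 p = c0" "tors p = a" "conn1b p = c2" "c1 + cnj c2 = Zt \<phi> (hfun \<phi>) p / hfun \<phi> p"
      by (simp_all add: x * wedge_def om_at_def omc_at_def)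
    moreover from this have "c1 + cnj c2 = conn1 p + cnj c2"
      using connection_metric(2)[OF p] by simp
    then have "c1 = conn1 p" by (rule add_right_imp_eq)
    ultimately have "c0 = conn0 p" "a = tors p" "c2 = conn1b p" "c1 = conn1 p" by simp_all
    then show "x = ((conn0 p, conn1 p, conn1b p), tors p)"
      by (simp add: x)
  qed
qed

lemma omega_frame:
  assumes "p \<in> S3"
  shows "omega \<phi> Tvf p = conn0 p" "omega \<phi> (Zt \<phi>) p = conn1 p" "omega \<phi> (Ztb \<phi>) p = conn1b p"
    "omegab \<phi> Tvf p = cnj (conn0 p)" "omegab \<phi> (Zt \<phi>) p = cnj (conn1b p)" "omegab \<phi> (Ztb \<phi>) p = cnj (conn1 p)"
  by (simp_all add: omega_def omegab_def om_at_def omc_at_def TW_eq th_frame assms)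

lemma Ator_eq: "p \<in> S3 \<Longrightarrow> Ator \<phi> p = tors p"
  by (simp add: Ator_def TW_eq)

text \<open>The term \<open>\<i> * hfun \<phi> p * conn0 p\<close> stems from the Reeb component of
  the bracket of \<open>Zt\<close> and \<open>Ztb\<close>. At \<phi> = 0 it is the only one that
  survives, and \<open>conn0\<close> = -2i there gives curvature 2.\<close>

lemma Rscal_eq:
  assumes p: "p \<in> S3"
  shows "Rscal \<phi> p = (Zt \<phi> conn1b p - Ztb \<phi> conn1 p + \<i> * hfun \<phi> p * conn0 p
    + conn1 p * conn1b p - conn1b p * cnj (conn1b p)) / hfun \<phi> p"
proof -
  have "omega \<phi> (brk (Zt \<phi>) (Ztb \<phi>)) p = - \<i> * hfun \<phi> p * conn0 p - conn1 p * conn1b p + conn1b p * cnj (conn1b p)"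
    using cof_brackets(3)[OF p] by (simp add: omega_def om_at_def TW_eq p th0_def th1_def th1b_def algebra_simps)
  moreover have "Zt \<phi> (omega \<phi> (Ztb \<phi>)) p = Zt \<phi> conn1b p" "Ztb \<phi> (omega \<phi> (Zt \<phi>)) p = Ztb \<phi> conn1 p"
    by (intro derivation_cong[OF derivation_Zt(1)[OF smooth] _ p] derivation_cong[OF derivation_Zt(2)[OF smooth] _ p] omega_frame; assumption)+
  ultimately have *: "d1 (omega \<phi>) (Zt \<phi>) (Ztb \<phi>) p = Zt \<phi> conn1b p - Ztb \<phi> conn1 p + \<i> * hfun \<phi> p * conn0 p
    + conn1 p * conn1b p - conn1b p * cnj (conn1b p)"
    by (simp add: d1_def)
  show ?thesis
    unfolding Rscal_def * wedge_def th_frame[OF p]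
    by (rule the_equality) (use hfun_nonzero[OF p] in \<open>auto simp: field_simps\<close>)
qed

end

section \<open>Expansion in the deformation parameter\<close>

lemma S3_sphere: "S3 = sphere 0 1"
proof -
  have "(cmod z)\<^sup>2 + (cmod w)\<^sup>2 = 1 \<longleftrightarrow> norm (z, w) = 1" for z w :: complex
    by (simp add: norm_prod_def real_sqrt_eq_1_iff)
  then show ?thesis by (auto simp: S3_def sphere_def)
qed

lemma S3_smooth_bounded:
  assumes "S3_smooth f" obtains B where "B > 0" "\<And>p. p \<in> S3 \<Longrightarrow> cmod (f p) \<le> B"
proof -
  obtain g where g: "C_inf g" "\<And>p. p \<in> S3 \<Longrightarrow> f p = g p" using assms by (rule S3_smoothE) blast
  have "compact (g ` S3)"
    unfolding S3_sphere by (intro compact_continuous_image C_inf_continuous_on g compact_sphere)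
  then obtain B where "B > 0" "\<forall>x\<in>g ` S3. norm x \<le> B"
    using compact_imp_bounded bounded_pos by metis
  then show thesis using g(2) by (intro that[of B]) simp_all
qed

text \<open>The bound 1/2, rather than 1, keeps \<open>hfun\<close> at least 3/4 for all admissible
  t, so that its inverse is bounded uniformly in t and on the sphere.\<close>

locale deformation_family =
  fixes \<phi>1 \<phi>2 :: cfun and \<epsilon> :: real
  assumes smooth1: "S3_smooth \<phi>1" and smooth2: "S3_smooth \<phi>2"
    and eps_pos: "\<epsilon> > 0"
    and less_half: "\<And>t p. \<bar>t\<bar> < \<epsilon> \<Longrightarrow> p \<in> S3 \<Longrightarrow>
      cmod (of_real t * \<phi>1 p + of_real (t\<^sup>2 / 2) * \<phi>2 p) < 1 / 2"
begin

definition \<Phi> :: "real \<Rightarrow> cfun" where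
  "\<Phi> t = (\<lambda>q. of_real t * \<phi>1 q + of_real (t\<^sup>2 / 2) * \<phi>2 q)"

text \<open>The class is rich enough to contain all curvature quantities of \<open>\<Phi> t\<close>, yet its members are
  uniformly bounded and have Taylor expansions with remainders in the class, so that a pointwise
  \<open>O(t\<^sup>3)\<close> hypothesis becomes uniform.\<close>
inductive fam :: "(real \<Rightarrow> cfun) \<Rightarrow> bool" where
  const: "S3_smooth f \<Longrightarrow> fam (\<lambda>t. f)"
| param: "fam (\<lambda>t p. of_real t)"
| add: "fam F \<Longrightarrow> fam G \<Longrightarrow> fam (\<lambda>t p. F t p + G t p)"
| mult: "fam F \<Longrightarrow> fam G \<Longrightarrow> fam (\<lambda>t p. F t p * G t p)"
| inverse_h: "fam (\<lambda>t p. inverse (hfun (\<Phi> t) p))"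
| on_S3: "fam F \<Longrightarrow> (\<And>t p. \<bar>t\<bar> < \<epsilon> \<Longrightarrow> p \<in> S3 \<Longrightarrow> G t p = F t p) \<Longrightarrow> fam G"

lemma smooth_Phi: "S3_smooth (\<Phi> t)"
  unfolding \<Phi>_def by (intro S3_smooth_add S3_smooth_mult S3_smooth_const smooth1 smooth2)

lemma deformation_Phi:
  assumes "\<bar>t\<bar> < \<epsilon>" shows "deformation (\<Phi> t)"
proof
  show "cmod (\<Phi> t p) < 1" if "p \<in> S3" for p
    using less_half[OF assms that] by (simp add: \<Phi>_def)
qed (rule smooth_Phi)

lemma fam_const: "fam (\<lambda>t p. c)"
  using fam.const[OF S3_smooth_const[of c]] .

lemma fam_minus: "fam F \<Longrightarrow> fam (\<lambda>t p. - F t p)"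
  using fam.mult[OF fam_const[of "-1"]] by simp

lemma fam_diff: "fam F \<Longrightarrow> fam G \<Longrightarrow> fam (\<lambda>t p. F t p - G t p)"
  using fam.add[OF _ fam_minus] by simp

lemma fam_Phi: "fam \<Phi>"
proof -
  have "fam (\<lambda>t p. of_real t * \<phi>1 p + of_real t * (of_real t * (1 / 2 * \<phi>2 p)))"
    by (intro fam.add fam.mult fam.param fam_const fam.const smooth1 smooth2)
  then show ?thesis by (rule fam.on_S3) (simp add: \<Phi>_def power2_eq_square)
qed

lemma fam_smooth: "fam F \<Longrightarrow> \<bar>t\<bar> < \<epsilon> \<Longrightarrow> S3_smooth (F t)"
proof (induction rule: fam.induct)
  case inverse_h
  then interpret deformation "\<Phi> t" by (rule deformation_Phi)
  show ?case by (intro S3_smooth_inverse smooth_hfun hfun_nonzero)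
next
  case (on_S3 F G)
  then show ?case by (intro S3_smooth_cong[of "F t" "G t"]) simp_all
qed (simp_all add: S3_smooth_const S3_smooth_add S3_smooth_mult)

lemma hfun_lower_bound:
  assumes "\<bar>t\<bar> < \<epsilon>" "p \<in> S3" shows "cmod (hfun (\<Phi> t) p) \<ge> 3 / 4"
proof -
  have "cmod (\<Phi> t p) \<le> 1 / 2" using less_half[OF assms] by (simp add: \<Phi>_def)
  then have "(cmod (\<Phi> t p))\<^sup>2 \<le> (1 / 2)\<^sup>2" by (rule power_mono) simp
  then show ?thesis unfolding hfun_def norm_of_real by (simp add: power2_eq_square)
qed

lemma fam_bounded: "fam F \<Longrightarrow> \<exists>B. \<forall>t p. \<bar>t\<bar> < \<epsilon> \<longrightarrow> p \<in> S3 \<longrightarrow> cmod (F t p) \<le> B"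
proof (induction rule: fam.induct)
  case (const f)
  then obtain B where "B > 0" "\<And>p. p \<in> S3 \<Longrightarrow> cmod (f p) \<le> B" by (rule S3_smooth_bounded) blast
  then show ?case by blast
next
  case param
  have "\<forall>t p. \<bar>t\<bar> < \<epsilon> \<longrightarrow> p \<in> S3 \<longrightarrow> cmod (of_real t) \<le> \<epsilon>" by simp
  then show ?case by blast
next
  case (add F G)
  then obtain B C where "\<forall>t p. \<bar>t\<bar> < \<epsilon> \<longrightarrow> p \<in> S3 \<longrightarrow> cmod (F t p) \<le> B"
    "\<forall>t p. \<bar>t\<bar> < \<epsilon> \<longrightarrow> p \<in> S3 \<longrightarrow> cmod (G t p) \<le> C" by blast
  then have "\<forall>t p. \<bar>t\<bar> < \<epsilon> \<longrightarrow> p \<in> S3 \<longrightarrow> cmod (F t p + G t p) \<le> B + C"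
    by (blast intro: norm_triangle_mono)
  then show ?case by blast
next
  case (mult F G)
  then obtain B C where *: "\<forall>t p. \<bar>t\<bar> < \<epsilon> \<longrightarrow> p \<in> S3 \<longrightarrow> cmod (F t p) \<le> B"
    "\<forall>t p. \<bar>t\<bar> < \<epsilon> \<longrightarrow> p \<in> S3 \<longrightarrow> cmod (G t p) \<le> C" by blast
  have "cmod (F t p * G t p) \<le> B * C" if "\<bar>t\<bar> < \<epsilon>" "p \<in> S3" for t p
    unfolding norm_mult using *(1)[rule_format, OF that] *(2)[rule_format, OF that]
    by (intro mult_mono) (auto intro: order_trans[OF norm_ge_zero])
  then show ?case by blast
next
  case inverse_h
  have "cmod (inverse (hfun (\<Phi> t) p)) \<le> inverse (3 / 4)" if "\<bar>t\<bar> < \<epsilon>" "p \<in> S3" for t p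
    unfolding norm_inverse using hfun_lower_bound[OF that] by (intro le_imp_inverse_le) auto
  then show ?case by blast
next
  case (on_S3 F G)
  then obtain B where "\<forall>t p. \<bar>t\<bar> < \<epsilon> \<longrightarrow> p \<in> S3 \<longrightarrow> cmod (F t p) \<le> B" by blast
  with on_S3.hyps(2) have "\<forall>t p. \<bar>t\<bar> < \<epsilon> \<longrightarrow> p \<in> S3 \<longrightarrow> cmod (G t p) \<le> B" by simp
  then show ?case by blast
qed

lemma cnj_hfun: "cnj (hfun \<phi> p) = hfun \<phi> p"
  by (simp add: hfun_def)

lemma fam_cnj: "fam F \<Longrightarrow> fam (\<lambda>t p. cnj (F t p))"
proof (induction rule: fam.induct)
  case (on_S3 F G)
  then show ?case by (intro fam.on_S3[OF on_S3.IH]) simp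
qed (simp_all add: cnj_hfun fam.intros(2-5) fam.const[OF S3_smooth_cnj])

text \<open>Only derivations independent of t are covered. That suffices, because \<open>Zt\<close>
  and \<open>Ztb\<close> of the family are combinations of \<open>Z1\<close> and \<open>Z1b\<close>
  with coefficients in the class.\<close>

lemma fam_derivation:
  assumes V: "derivation V" shows "fam F \<Longrightarrow> fam (\<lambda>t. V (F t))"
proof (induction rule: fam.induct)
  case (const f)
  then show ?case by (intro fam.const derivation_smooth[OF V])
next
  case param
  show ?case by (rule fam.on_S3[OF fam_const[of 0]]) (simp add: derivation_const[OF V])
next
  case (add F G)
  show ?case
    by (rule fam.on_S3[OF fam.add[OF add.IH]]) (simp add: derivation_add[OF V] fam_smooth add.hyps)
next
  case (mult F G)
  show ?case
    by (rule fam.on_S3[OF fam.add[OF fam.mult[OF mult.IH(1) mult.hyps(2)] fam.mult[OF mult.hyps(1) mult.IH(2)]]])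
      (simp add: derivation_mult[OF V] fam_smooth mult.hyps)
next
  case inverse_h
  \<comment> \<open>The quotient rule for the inverse of \<open>hfun\<close> differentiates
    \<open>\<Phi>\<close> and its conjugate. No induction hypothesis speaks of these, so their
    derivatives are expanded in t directly.\<close>
  have VPhi: "fam (\<lambda>t. V (\<Phi> t))" "fam (\<lambda>t. V (\<lambda>p. cnj (\<Phi> t p)))"
  proof -
    have *: "fam (\<lambda>t p. of_real t * V f p + of_real t * of_real t * (1 / 2) * V g p)" if "S3_smooth f" "S3_smooth g" for f g
      by (intro fam.add fam.mult fam.param fam_const fam.const derivation_smooth[OF V] that)
    have lin: "V (\<lambda>p. c * f p + d * g p) p = c * V f p + d * V g p"
      if "S3_smooth f" "S3_smooth g" "p \<in> S3" for f g p and c d :: complex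
      using that by (simp add: derivation_add[OF V] derivation_mult[OF V] derivation_const[OF V] S3_smooth_const
        S3_smooth_mult)
    have **: "V (\<lambda>p. of_real t * f p + of_real (t\<^sup>2 / 2) * g p) p = of_real t * V f p + of_real t * of_real t * (1 / 2) * V g p"
      if "S3_smooth f" "S3_smooth g" "p \<in> S3" for f g t p
      unfolding lin[OF that] by (simp add: power2_eq_square)
    show "fam (\<lambda>t. V (\<Phi> t))"
      by (rule fam.on_S3[OF *[OF smooth1 smooth2]]) (unfold \<Phi>_def, rule **[OF smooth1 smooth2])
    show "fam (\<lambda>t. V (\<lambda>p. cnj (\<Phi> t p)))"
      by (rule fam.on_S3[OF *[OF S3_smooth_cnj[OF smooth1] S3_smooth_cnj[OF smooth2]]])
        (unfold \<Phi>_def, simp add: **[OF S3_smooth_cnj[OF smooth1] S3_smooth_cnj[OF smooth2], simplified])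
  qed
  have "fam (\<lambda>t p. (V (\<Phi> t) p * cnj (\<Phi> t p) + \<Phi> t p * V (\<lambda>p. cnj (\<Phi> t p)) p) *
      inverse (hfun (\<Phi> t) p) * inverse (hfun (\<Phi> t) p))"
    by (intro fam.mult fam.add fam_cnj fam_Phi VPhi fam.inverse_h)
  then show ?case
  proof (rule fam.on_S3)
    fix t p assume t: "\<bar>t\<bar> < \<epsilon>" and p: "p \<in> S3"
    interpret deformation "\<Phi> t" using t by (rule deformation_Phi)
    show "V (\<lambda>p. inverse (hfun (\<Phi> t) p)) p = (V (\<Phi> t) p * cnj (\<Phi> t p) + \<Phi> t p * V (\<lambda>p. cnj (\<Phi> t p)) p) *
      inverse (hfun (\<Phi> t) p) * inverse (hfun (\<Phi> t) p)"
      by (simp add: derivation_inverse[OF V smooth_hfun _ p] hfun_nonzero derivation_hfun[OF V p])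
  qed
next
  case (on_S3 F G)
  show ?case
    by (rule fam.on_S3[OF on_S3.IH], rule derivation_cong[OF V], rule on_S3.hyps)
qed

text \<open>An exact identity, from h + |\<Phi>|^2 = 1, in place of a geometric series: the error
  term is again a product of members of the class and carries two factors of t.\<close>

lemma inverse_h_expansion:
  assumes "\<bar>t\<bar> < \<epsilon>" "p \<in> S3"
  shows "inverse (hfun (\<Phi> t) p) = 1 + \<Phi> t p * cnj (\<Phi> t p) * inverse (hfun (\<Phi> t) p)"
proof -
  interpret deformation "\<Phi> t" using assms(1) by (rule deformation_Phi)
  have "hfun (\<Phi> t) p + \<Phi> t p * cnj (\<Phi> t p) = 1" by (simp add: hfun_eq)
  then show ?thesis using hfun_nonzero[OF assms(2)] by (simp add: field_simps)
qed

lemma Phi_factor: "\<Phi> t p = of_real t * (\<phi>1 p + of_real t * (1 / 2 * \<phi>2 p))"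
  by (simp add: \<Phi>_def power2_eq_square algebra_simps)

lemma fam_Phi_factor: "fam (\<lambda>t p. \<phi>1 p + of_real t * (1 / 2 * \<phi>2 p))"
  by (intro fam.add fam.mult fam.param fam_const fam.const smooth1 smooth2)

text \<open>Because the remainder stays in the class, the statement can be iterated. Taylor
  expansions of any order arise in this way without differentiating in t.\<close>

lemma fam_expansion:
  "fam F \<Longrightarrow> \<exists>f R. S3_smooth f \<and> fam R \<and> (\<forall>t p. \<bar>t\<bar> < \<epsilon> \<longrightarrow> p \<in> S3 \<longrightarrow> F t p = f p + of_real t * R t p)"
proof (induction rule: fam.induct)
  case (const f)
  then show ?case by (intro exI[of _ f] exI[of _ "\<lambda>t p. 0"]) (simp add: fam_const)
next
  case param
  show ?case by (intro exI[of _ "\<lambda>p. 0"] exI[of _ "\<lambda>t p. 1"]) (simp add: fam_const S3_smooth_const)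
next
  case (add F G)
  then obtain f R g S where "S3_smooth f" "fam R" "\<forall>t p. \<bar>t\<bar> < \<epsilon> \<longrightarrow> p \<in> S3 \<longrightarrow> F t p = f p + of_real t * R t p"
    "S3_smooth g" "fam S" "\<forall>t p. \<bar>t\<bar> < \<epsilon> \<longrightarrow> p \<in> S3 \<longrightarrow> G t p = g p + of_real t * S t p" by blast
  then show ?case
    by (intro exI[of _ "\<lambda>p. f p + g p"] exI[of _ "\<lambda>t p. R t p + S t p"])
      (simp add: fam.add S3_smooth_add algebra_simps)
next
  case (mult F G)
  then obtain f R g S where "S3_smooth f" "fam R" "\<forall>t p. \<bar>t\<bar> < \<epsilon> \<longrightarrow> p \<in> S3 \<longrightarrow> F t p = f p + of_real t * R t p"
    "S3_smooth g" "fam S" "\<forall>t p. \<bar>t\<bar> < \<epsilon> \<longrightarrow> p \<in> S3 \<longrightarrow> G t p = g p + of_real t * S t p" by blast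
  then show ?case
    by (intro exI[of _ "\<lambda>p. f p * g p"] exI[of _ "\<lambda>t p. R t p * g p + f p * S t p + of_real t * (R t p * S t p)"])
      (simp add: fam.intros(1-4) S3_smooth_mult algebra_simps)
next
  case inverse_h
  have "fam (\<lambda>t p. (\<phi>1 p + of_real t * (1 / 2 * \<phi>2 p)) * cnj (\<Phi> t p) * inverse (hfun (\<Phi> t) p))"
    by (intro fam.mult fam_Phi_factor fam_cnj fam_Phi fam.inverse_h)
  moreover have "inverse (hfun (\<Phi> t) p) = 1 + of_real t *
      ((\<phi>1 p + of_real t * (1 / 2 * \<phi>2 p)) * cnj (\<Phi> t p) * inverse (hfun (\<Phi> t) p))" if "\<bar>t\<bar> < \<epsilon>" "p \<in> S3" for t p
    by (subst inverse_h_expansion[OF that], subst (1) Phi_factor) (simp add: mult.assoc)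
  ultimately show ?case using S3_smooth_const by blast
next
  case (on_S3 F G)
  then obtain f R where "S3_smooth f" "fam R" "\<forall>t p. \<bar>t\<bar> < \<epsilon> \<longrightarrow> p \<in> S3 \<longrightarrow> F t p = f p + of_real t * R t p" by blast
  then show ?case using on_S3.hyps(2) by (intro exI[of _ f] exI[of _ R]) simp
qed

lemma fam_expansion3:
  assumes "fam F"
  obtains a b c R where "fam R"
    "\<And>t p. \<bar>t\<bar> < \<epsilon> \<Longrightarrow> p \<in> S3 \<Longrightarrow> F t p = a p + of_real t * b p + of_real (t\<^sup>2) * c p + of_real (t ^ 3) * R t p"
proof -
  obtain a R where 1: "fam R" "\<And>t p. \<bar>t\<bar> < \<epsilon> \<Longrightarrow> p \<in> S3 \<Longrightarrow> F t p = a p + of_real t * R t p"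
    using fam_expansion[OF assms] by blast
  obtain b S where 2: "fam S" "\<And>t p. \<bar>t\<bar> < \<epsilon> \<Longrightarrow> p \<in> S3 \<Longrightarrow> R t p = b p + of_real t * S t p"
    using fam_expansion[OF 1(1)] by blast
  obtain c U where 3: "fam U" "\<And>t p. \<bar>t\<bar> < \<epsilon> \<Longrightarrow> p \<in> S3 \<Longrightarrow> S t p = c p + of_real t * U t p"
    using fam_expansion[OF 2(1)] by blast
  show thesis
    by (rule that[OF 3(1), of a b c]) (simp add: 1(2) 2(2) 3(2) power2_eq_square power3_eq_cube algebra_simps)
qed

end

section \<open>First variations of the Tanaka-Webster invariants\<close>

context deformation_family
begin

text \<open>The first order jet of a family at t = 0, that is, its value and its first variation.
  The rules below are those of dual numbers; keeping the remainder in \<open>fam\<close> makes them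
  compatible with derivations and bounds it uniformly on the sphere.\<close>

definition lin :: "(real \<Rightarrow> cfun) \<Rightarrow> cfun \<Rightarrow> cfun \<Rightarrow> bool" where
  "lin F f g \<longleftrightarrow> S3_smooth f \<and> S3_smooth g \<and>
    (\<exists>R. fam R \<and> (\<forall>t p. \<bar>t\<bar> < \<epsilon> \<longrightarrow> p \<in> S3 \<longrightarrow> F t p = f p + of_real t * g p + of_real t * of_real t * R t p))"

lemma linI:
  assumes "S3_smooth f" "S3_smooth g" "fam R"
    "\<And>t p. \<bar>t\<bar> < \<epsilon> \<Longrightarrow> p \<in> S3 \<Longrightarrow> F t p = f p + of_real t * g p + of_real t * of_real t * R t p"
  shows "lin F f g"
  unfolding lin_def using assms by blast

lemma linE:
  assumes "lin F f g"
  obtains R where "S3_smooth f" "S3_smooth g" "fam R"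
    "\<And>t p. \<bar>t\<bar> < \<epsilon> \<Longrightarrow> p \<in> S3 \<Longrightarrow> F t p = f p + of_real t * g p + of_real t * of_real t * R t p"
  using assms unfolding lin_def by blast

lemma lin_fam: "lin F f g \<Longrightarrow> fam F"
  by (erule linE, rule fam.on_S3[rotated], assumption) (intro fam.add fam.mult fam.param fam.const)

lemma lin_cong:
  assumes "lin F f g" "\<And>t p. \<bar>t\<bar> < \<epsilon> \<Longrightarrow> p \<in> S3 \<Longrightarrow> G t p = F t p"
    "\<And>p. p \<in> S3 \<Longrightarrow> f' p = f p" "\<And>p. p \<in> S3 \<Longrightarrow> g' p = g p"
  shows "lin G f' g'"
  using assms(1)
proof (rule linE)
  fix R assume *: "S3_smooth f" "S3_smooth g" "fam R"
    "\<And>t p. \<bar>t\<bar> < \<epsilon> \<Longrightarrow> p \<in> S3 \<Longrightarrow> F t p = f p + of_real t * g p + of_real t * of_real t * R t p"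
  show ?thesis
    by (rule linI[OF S3_smooth_cong[OF *(1)] S3_smooth_cong[OF *(2)] *(3)]) (simp_all add: assms(2-4) *(4))
qed

lemmas lin_eqI = lin_cong[OF _ refl]

lemma lin_const: "S3_smooth f \<Longrightarrow> lin (\<lambda>t. f) f (\<lambda>p. 0)"
  by (rule linI[OF _ S3_smooth_const fam_const[of 0]]) simp_all

lemma lin_add:
  assumes "lin F f f'" "lin G g g'" shows "lin (\<lambda>t p. F t p + G t p) (\<lambda>p. f p + g p) (\<lambda>p. f' p + g' p)"
  using assms(1)
proof (rule linE)
  fix R assume 1: "S3_smooth f" "S3_smooth f'" "fam R"
    "\<And>t p. \<bar>t\<bar> < \<epsilon> \<Longrightarrow> p \<in> S3 \<Longrightarrow> F t p = f p + of_real t * f' p + of_real t * of_real t * R t p"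
  obtain S where 2: "S3_smooth g" "S3_smooth g'" "fam S"
    "\<And>t p. \<bar>t\<bar> < \<epsilon> \<Longrightarrow> p \<in> S3 \<Longrightarrow> G t p = g p + of_real t * g' p + of_real t * of_real t * S t p"
    using assms(2) by (rule linE) blast
  show ?thesis
    by (rule linI[OF S3_smooth_add[OF 1(1) 2(1)] S3_smooth_add[OF 1(2) 2(2)] fam.add[OF 1(3) 2(3)]])
      (simp add: 1(4) 2(4) algebra_simps)
qed

lemma lin_mult:
  assumes "lin F f f'" "lin G g g'"
  shows "lin (\<lambda>t p. F t p * G t p) (\<lambda>p. f p * g p) (\<lambda>p. f' p * g p + f p * g' p)"
  using assms(1)
proof (rule linE)
  fix R assume 1: "S3_smooth f" "S3_smooth f'" "fam R"
    "\<And>t p. \<bar>t\<bar> < \<epsilon> \<Longrightarrow> p \<in> S3 \<Longrightarrow> F t p = f p + of_real t * f' p + of_real t * of_real t * R t p"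
  obtain S where 2: "S3_smooth g" "S3_smooth g'" "fam S"
    "\<And>t p. \<bar>t\<bar> < \<epsilon> \<Longrightarrow> p \<in> S3 \<Longrightarrow> G t p = g p + of_real t * g' p + of_real t * of_real t * S t p"
    using assms(2) by (rule linE) blast
  have R: "fam (\<lambda>t p. f p * S t p + f' p * g' p + R t p * G t p + of_real t * (f' p * S t p))"
    by (intro fam.add fam.mult fam.const fam.param 1 2 lin_fam[OF assms(2)])
  have smooth: "S3_smooth (\<lambda>p. f p * g p)" "S3_smooth (\<lambda>p. f' p * g p + f p * g' p)"
    by (intro S3_smooth_add S3_smooth_mult 1 2)+
  show ?thesis
    by (rule linI[OF smooth R]) (simp add: 1(4) 2(4) algebra_simps)
qed

lemma lin_cnj:
  assumes "lin F f f'" shows "lin (\<lambda>t p. cnj (F t p)) (\<lambda>p. cnj (f p)) (\<lambda>p. cnj (f' p))"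
  using assms
proof (rule linE)
  fix R assume 1: "S3_smooth f" "S3_smooth f'" "fam R"
    "\<And>t p. \<bar>t\<bar> < \<epsilon> \<Longrightarrow> p \<in> S3 \<Longrightarrow> F t p = f p + of_real t * f' p + of_real t * of_real t * R t p"
  show ?thesis
    by (rule linI[OF S3_smooth_cnj[OF 1(1)] S3_smooth_cnj[OF 1(2)] fam_cnj[OF 1(3)]]) (simp add: 1(4))
qed

lemma lin_cmult: "lin F f f' \<Longrightarrow> lin (\<lambda>t p. c * F t p) (\<lambda>p. c * f p) (\<lambda>p. c * f' p)"
  using lin_mult[OF lin_const[OF S3_smooth_const[of c]]] by simp

lemma lin_minus: "lin F f f' \<Longrightarrow> lin (\<lambda>t p. - F t p) (\<lambda>p. - f p) (\<lambda>p. - f' p)"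
  using lin_cmult[of F f f' "-1"] by simp

lemma lin_diff:
  assumes "lin F f f'" "lin G g g'" shows "lin (\<lambda>t p. F t p - G t p) (\<lambda>p. f p - g p) (\<lambda>p. f' p - g' p)"
  using lin_add[OF assms(1) lin_minus[OF assms(2)]] by simp

lemma lin_derivation:
  assumes V: "derivation V" and "lin F f f'" shows "lin (\<lambda>t. V (F t)) (V f) (V f')"
  using assms(2)
proof (rule linE)
  fix R assume 1: "S3_smooth f" "S3_smooth f'" "fam R"
    "\<And>t p. \<bar>t\<bar> < \<epsilon> \<Longrightarrow> p \<in> S3 \<Longrightarrow> F t p = f p + of_real t * f' p + of_real t * of_real t * R t p"
  show ?thesis
  proof (rule linI[OF derivation_smooth[OF V 1(1)] derivation_smooth[OF V 1(2)] fam_derivation[OF V 1(3)]])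
    fix t p assume t: "\<bar>t\<bar> < \<epsilon>" and p: "p \<in> S3"
    have "V (F t) p = V (\<lambda>p. f p + of_real t * f' p + of_real t * of_real t * R t p) p"
      by (rule derivation_cong[OF V 1(4)[OF t] p])
    then show "V (F t) p = V f p + of_real t * V f' p + of_real t * of_real t * V (R t) p"
      by (simp add: derivation_add[OF V] derivation_mult[OF V] derivation_const[OF V] S3_smooth_const S3_smooth_add
        S3_smooth_mult 1 fam_smooth[OF 1(3) t] p)
  qed
qed

lemma lin_Phi: "lin \<Phi> (\<lambda>p. 0) \<phi>1"
proof (rule linI[OF S3_smooth_const smooth1])
  show "fam (\<lambda>t p. 1 / 2 * \<phi>2 p)" by (intro fam.mult fam_const fam.const smooth2)
qed (simp add: \<Phi>_def power2_eq_square)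

lemma lin_inverse_h: "lin (\<lambda>t p. inverse (hfun (\<Phi> t) p)) (\<lambda>p. 1) (\<lambda>p. 0)"
proof (rule linI[OF S3_smooth_const S3_smooth_const])
  show "fam (\<lambda>t p. (\<phi>1 p + of_real t * (1 / 2 * \<phi>2 p)) * cnj (\<phi>1 p + of_real t * (1 / 2 * \<phi>2 p)) *
      inverse (hfun (\<Phi> t) p))" (is "fam ?R")
    by (intro fam.mult fam_cnj fam_Phi_factor fam.inverse_h)
  show "inverse (hfun (\<Phi> t) p) = 1 + of_real t * 0 + of_real t * of_real t * ?R t p"
    if "\<bar>t\<bar> < \<epsilon>" "p \<in> S3" for t p
    by (subst inverse_h_expansion[OF that], subst (1 2) Phi_factor) (simp add: algebra_simps)
qed

lemma lin_hfun: "lin (\<lambda>t. hfun (\<Phi> t)) (\<lambda>p. 1) (\<lambda>p. 0)"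
  unfolding hfun_eq[abs_def]
  by (rule lin_eqI[OF lin_diff[OF lin_const[OF S3_smooth_const] lin_mult[OF lin_Phi lin_cnj[OF lin_Phi]]]]) simp_all

lemma lin_divide_h:
  assumes "lin F f f'" shows "lin (\<lambda>t p. F t p / hfun (\<Phi> t) p) f f'"
  unfolding divide_inverse by (rule lin_eqI[OF lin_mult[OF assms lin_inverse_h]]) simp_all

text \<open>The second summand of the variation is that of the frame field itself. It involves only
  the value of the family at t = 0 and so disappears when that value is constant.\<close>

lemma lin_Zt:
  assumes "lin F f f'"
  shows "lin (\<lambda>t. Zt (\<Phi> t) (F t)) (Z1 f) (\<lambda>p. Z1 f' p + \<phi>1 p * Z1b f p)"
  unfolding Zt_def
  by (rule lin_eqI[OF lin_add[OF lin_derivation[OF derivation_Z1 assms] lin_mult[OF lin_Phi lin_derivation[OF derivation_Z1b assms]]]])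
    simp_all

lemma lin_Ztb:
  assumes "lin F f f'"
  shows "lin (\<lambda>t. Ztb (\<Phi> t) (F t)) (Z1b f) (\<lambda>p. Z1b f' p + cnj (\<phi>1 p) * Z1 f p)"
  unfolding Ztb_def
  by (rule lin_eqI[OF lin_add[OF lin_derivation[OF derivation_Z1b assms] lin_mult[OF lin_cnj[OF lin_Phi] lin_derivation[OF derivation_Z1 assms]]]])
    simp_all

lemmas const_derivatives = derivation_const[OF derivation_Z1] derivation_const[OF derivation_Z1b]
  derivation_const[OF derivation_Tvf]

lemma lin_conn0: "lin (\<lambda>t. deformation.conn0 (\<Phi> t)) (\<lambda>p. - 2 * \<i>) (\<lambda>p. 0)"
proof -
  have "lin (\<lambda>t p. (- (2 * \<i>)) * (1 + \<Phi> t p * cnj (\<Phi> t p)) + - (cnj (\<Phi> t p) * Tvf (\<Phi> t) p)) (\<lambda>p. - 2 * \<i>) (\<lambda>p. 0)"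
    by (rule lin_eqI[OF lin_add[OF lin_cmult[OF lin_add[OF lin_const[OF S3_smooth_const[of 1]]
      lin_mult[OF lin_Phi lin_cnj[OF lin_Phi]]]] lin_minus[OF lin_mult[OF lin_cnj[OF lin_Phi] lin_derivation[OF derivation_Tvf lin_Phi]]]]])
      (simp_all add: const_derivatives)
  from lin_divide_h[OF this] show ?thesis
    by (rule lin_cong) (simp_all add: deformation.conn0_def deformation_Phi)
qed

lemma lin_conn1: "lin (\<lambda>t. deformation.conn1 (\<Phi> t)) (\<lambda>p. 0) (Z1b \<phi>1)"
  by (rule lin_cong[OF lin_derivation[OF derivation_Z1b lin_Phi]])
    (simp_all add: deformation.conn1_def deformation_Phi const_derivatives)

lemma lin_Ztb_Phi: "lin (\<lambda>t. Ztb (\<Phi> t) (\<Phi> t)) (\<lambda>p. 0) (Z1b \<phi>1)"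
  by (rule lin_eqI[OF lin_Ztb[OF lin_Phi]]) (simp_all add: const_derivatives)

lemma lin_conn1b: "lin (\<lambda>t. deformation.conn1b (\<Phi> t)) (\<lambda>p. 0) (\<lambda>p. - cnj (Z1b \<phi>1 p))"
proof -
  have "lin (\<lambda>t p. - (cnj (Ztb (\<Phi> t) (\<Phi> t) p) + cnj (\<Phi> t p) * Ztb (\<Phi> t) (\<Phi> t) p)) (\<lambda>p. 0) (\<lambda>p. - cnj (Z1b \<phi>1 p))"
    by (rule lin_eqI[OF lin_minus[OF lin_add[OF lin_cnj[OF lin_Ztb_Phi] lin_mult[OF lin_cnj[OF lin_Phi] lin_Ztb_Phi]]]])
      simp_all
  from lin_divide_h[OF this] show ?thesis
    by (rule lin_cong) (simp_all add: deformation.conn1b_def deformation_Phi)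
qed

text \<open>The \<open>a\<close> of the overview. The constant 4i is the difference between the
  T-weights 2i of \<open>Z1b\<close> and -2i of \<open>Z1\<close>, since the torsion measures how
  the flow of T moves \<phi> \<open>Z1b\<close> relative to \<open>Z1\<close>.\<close>

definition tors1 :: cfun where "tors1 p = - (Tvf \<phi>1 p + 4 * \<i> * \<phi>1 p)"

lemma lin_tors: "lin (\<lambda>t. deformation.tors (\<Phi> t)) (\<lambda>p. 0) (\<lambda>p. cnj (tors1 p))"
proof -
  have "lin (\<lambda>t p. - (cnj (Tvf (\<Phi> t) p) - 4 * \<i> * cnj (\<Phi> t p))) (\<lambda>p. 0) (\<lambda>p. cnj (tors1 p))"
    by (rule lin_eqI[OF lin_minus[OF lin_diff[OF lin_cnj[OF lin_derivation[OF derivation_Tvf lin_Phi]]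
      lin_cmult[OF lin_cnj[OF lin_Phi]]]]])
      (simp_all add: const_derivatives tors1_def)
  from lin_divide_h[OF this] show ?thesis
    by (rule lin_cong) (simp_all add: deformation.tors_def deformation_Phi)
qed

lemma lin_omega:
  "lin (\<lambda>t. omega (\<Phi> t) Tvf) (\<lambda>p. - 2 * \<i>) (\<lambda>p. 0)"
  "lin (\<lambda>t. omega (\<Phi> t) (Zt (\<Phi> t))) (\<lambda>p. 0) (Z1b \<phi>1)"
  "lin (\<lambda>t. omega (\<Phi> t) (Ztb (\<Phi> t))) (\<lambda>p. 0) (\<lambda>p. - cnj (Z1b \<phi>1 p))"
  "lin (\<lambda>t. omegab (\<Phi> t) Tvf) (\<lambda>p. 2 * \<i>) (\<lambda>p. 0)"
  "lin (\<lambda>t. omegab (\<Phi> t) (Zt (\<Phi> t))) (\<lambda>p. 0) (\<lambda>p. - Z1b \<phi>1 p)"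
  "lin (\<lambda>t. omegab (\<Phi> t) (Ztb (\<Phi> t))) (\<lambda>p. 0) (\<lambda>p. cnj (Z1b \<phi>1 p))"
  by (rule lin_cong[OF lin_conn0] lin_cong[OF lin_conn1] lin_cong[OF lin_conn1b]
    lin_cong[OF lin_cnj[OF lin_conn0]] lin_cong[OF lin_cnj[OF lin_conn1b]] lin_cong[OF lin_cnj[OF lin_conn1]];
    simp add: deformation.omega_frame[OF deformation_Phi]; fail)+

lemma lin_cov:
  assumes "lin (\<lambda>t. X t (F t)) d d'" "lin (\<lambda>t. omega (\<Phi> t) (X t)) w w'" "lin (\<lambda>t. omegab (\<Phi> t) (X t)) v v'" "lin F f f'"
  shows "lin (\<lambda>t. cov (\<Phi> t) a b (X t) (F t)) (\<lambda>p. d p - (of_nat a * w p + of_nat b * v p) * f p)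
    (\<lambda>p. d' p - ((of_nat a * w' p + of_nat b * v' p) * f p + (of_nat a * w p + of_nat b * v p) * f' p))"
  unfolding cov_def by (intro lin_diff lin_mult lin_add lin_cmult assms)

lemmas lin_cov_T = lin_cov[OF lin_derivation[OF derivation_Tvf] lin_omega(1,4)]
lemmas lin_cov_Zt = lin_cov[OF lin_Zt lin_omega(2,5)]
lemmas lin_cov_Ztb = lin_cov[OF lin_Ztb lin_omega(3,6)]

lemma lin_A11: "lin (\<lambda>t. A11 (\<Phi> t)) (\<lambda>p. 0) tors1"
  by (rule lin_cong[OF lin_mult[OF lin_hfun lin_cnj[OF lin_tors]]])
    (simp_all add: A11_def deformation.Ator_eq deformation_Phi)

lemma lin_Aup11: "lin (\<lambda>t. Aup11 (\<Phi> t)) (\<lambda>p. 0) (\<lambda>p. cnj (tors1 p))"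
  by (rule lin_cong[OF lin_divide_h[OF lin_tors]])
    (simp_all add: Aup11_def deformation.Ator_eq deformation_Phi)

text \<open>The variation is minus twice the real part of W W \<phi>: one half comes from
  differentiating \<open>conn1b\<close>, the other from differentiating \<open>conn1\<close>.
  Membership in the slice makes it vanish.\<close>

lemma lin_Rscal:
  "lin (\<lambda>t. Rscal (\<Phi> t)) (\<lambda>p. 2) (\<lambda>p. - cnj (Z1b (Z1b \<phi>1) p) - Z1b (Z1b \<phi>1) p)"
proof -
  note * = lin_divide_h[OF lin_diff[OF lin_add[OF lin_add[OF lin_diff[OF lin_Zt[OF lin_conn1b] lin_Ztb[OF lin_conn1]]
    lin_mult[OF lin_cmult[where c="\<i>", OF lin_hfun] lin_conn0]] lin_mult[OF lin_conn1 lin_conn1b]] lin_mult[OF lin_conn1b lin_cnj[OF lin_conn1b]]]]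
  have ii: "\<i> * (2 * \<i>) = - 2" by (simp add: complex_eq_iff)
  show ?thesis
    by (rule lin_cong[OF *])
      (simp_all add: ii deformation.Rscal_eq[OF deformation_Phi] const_derivatives vector_fields_cnj
        derivation_minus[OF derivation_Z1] S3_smooth_cnj derivation_smooth[OF derivation_Z1b] smooth1)
qed

text \<open>The \<open>q\<close> of the overview. The coefficient 3i is 4i - i: the Reeb derivative
  of a tensor with two lower indices contributes -2 times \<open>conn0\<close> = -2i, and the
  curvature term contributes -(i/2) times R = 2.\<close>

definition cartan1 :: cfun where
  "cartan1 p = Tvf tors1 p + 3 * \<i> * tors1 p + (2 * \<i> / 3) * Z1 (Z1b tors1) p"

lemma smooth_tors1: "S3_smooth tors1"
  unfolding tors1_def[abs_def]
  by (intro S3_smooth_minus S3_smooth_add S3_smooth_mult S3_smooth_const smooth1 derivation_smooth[OF derivation_Tvf])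

lemma smooth_cartan1: "S3_smooth cartan1"
  unfolding cartan1_def[abs_def]
  by (intro S3_smooth_add S3_smooth_mult S3_smooth_const smooth_tors1 derivation_smooth[OF derivation_Tvf]
    derivation_smooth[OF derivation_Z1] derivation_smooth[OF derivation_Z1b])

lemma lin_Q11:
  assumes "\<And>p. p \<in> S3 \<Longrightarrow> Z1b (Z1b \<phi>1) p = 0"
  shows "lin (\<lambda>t. Q11 (\<Phi> t)) (\<lambda>p. 0) cartan1"
proof -
  have R: "lin (\<lambda>t. Rscal (\<Phi> t)) (\<lambda>p. 2) (\<lambda>p. 0)"
    by (rule lin_eqI[OF lin_Rscal]) (simp_all add: assms)
  have ZR: "lin (\<lambda>t. Zt (\<Phi> t) (Rscal (\<Phi> t))) (\<lambda>p. 0) (\<lambda>p. 0)"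
    by (rule lin_eqI[OF lin_Zt[OF R]]) (simp_all add: const_derivatives)
  have 1: "lin (\<lambda>t. cov (\<Phi> t) 1 0 (Zt (\<Phi> t)) (Zt (\<Phi> t) (Rscal (\<Phi> t)))) (\<lambda>p. 0) (\<lambda>p. 0)"
    by (rule lin_eqI[OF lin_cov_Zt[OF ZR ZR]]) (simp_all add: const_derivatives)
  have 2: "lin (\<lambda>t p. (\<i> / 2) * Rscal (\<Phi> t) p * A11 (\<Phi> t) p) (\<lambda>p. 0) (\<lambda>p. \<i> * tors1 p)"
    by (rule lin_eqI[OF lin_mult[OF lin_cmult[OF R] lin_A11]]) simp_all
  have 3: "lin (\<lambda>t. cov (\<Phi> t) 2 0 Tvf (A11 (\<Phi> t))) (\<lambda>p. 0) (\<lambda>p. Tvf tors1 p + 4 * \<i> * tors1 p)"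
    by (rule lin_eqI[OF lin_cov_T[OF lin_A11 lin_A11]]) (simp_all add: const_derivatives)
  have 4: "lin (\<lambda>t. cov (\<Phi> t) 2 0 (Ztb (\<Phi> t)) (A11 (\<Phi> t))) (\<lambda>p. 0) (Z1b tors1)"
    by (rule lin_eqI[OF lin_cov_Ztb[OF lin_A11 lin_A11]]) (simp_all add: const_derivatives)
  have 5: "lin (\<lambda>t. cov (\<Phi> t) 2 1 (Zt (\<Phi> t)) (cov (\<Phi> t) 2 0 (Ztb (\<Phi> t)) (A11 (\<Phi> t)))) (\<lambda>p. 0) (Z1 (Z1b tors1))"
    by (rule lin_eqI[OF lin_cov_Zt[OF 4 4]]) (simp_all add: const_derivatives)
  show ?thesis
    unfolding Q11_def
    by (rule lin_eqI[OF lin_add[OF lin_add[OF lin_diff[OF lin_cmult[OF 1] 2] 3] lin_cmult[OF lin_divide_h[OF 5]]]])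
      (simp_all add: cartan1_def algebra_simps)
qed

lemma fam_obstr:
  assumes "\<And>p. p \<in> S3 \<Longrightarrow> Z1b (Z1b \<phi>1) p = 0"
  shows "fam (\<lambda>t. obstr (\<Phi> t))"
proof -
  note Q = lin_Q11[OF assms]
  note cQ = lin_cov_Ztb[OF Q Q]
  have "fam (\<lambda>t p. (1 / 3) * (cov (\<Phi> t) 2 1 (Ztb (\<Phi> t)) (cov (\<Phi> t) 2 0 (Ztb (\<Phi> t)) (Q11 (\<Phi> t))) p *
      inverse (hfun (\<Phi> t) p) * inverse (hfun (\<Phi> t) p) - \<i> * Aup11 (\<Phi> t) p * Q11 (\<Phi> t) p))"
    by (intro fam.mult fam_diff fam_const fam.inverse_h lin_fam[OF lin_cov_Ztb[OF cQ cQ]] lin_fam[OF Q] lin_fam[OF lin_Aup11])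
  then show ?thesis
    by (rule fam.on_S3) (simp only: obstr_def power2_eq_square divide_inverse inverse_mult_distrib mult.assoc)
qed

text \<open>The measure on the sphere is that of the fixed contact form, whatever \<open>t\<close>; hence
  \<open>\<nabla>\<^sup>1\<nabla>\<^sup>1Q\<^sub>1\<^sub>1\<close> has the form \<open>Z1b U + Z1 (cnj \<phi> * U)\<close> with \<open>U = \<nabla>\<^sub>1\<^sub>b Q\<^sub>1\<^sub>1 / (3 h\<^sup>2)\<close>.\<close>
lemma obstr_divergence:
  assumes Q: "fam (\<lambda>t. Q11 (\<Phi> t))" and t: "\<bar>t\<bar> < \<epsilon>"
  obtains U where "S3_smooth U" "\<And>p. p \<in> S3 \<Longrightarrow>
    obstr (\<Phi> t) p = Z1b U p + Z1 (\<lambda>q. cnj (\<Phi> t q) * U q) p - \<i> / 3 * Aup11 (\<Phi> t) p * Q11 (\<Phi> t) p"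
proof -
  interpret deformation "\<Phi> t" using t by (rule deformation_Phi)
  have smooth_Q: "S3_smooth (Q11 (\<Phi> t))" by (rule fam_smooth[OF Q t])
  have smooth_conn: "S3_smooth conn1" "S3_smooth conn1b"
    using fam_smooth[OF lin_fam[OF lin_conn1] t] fam_smooth[OF lin_fam[OF lin_conn1b] t] by simp_all
  define W where "W = cov (\<Phi> t) 2 0 (Ztb (\<Phi> t)) (Q11 (\<Phi> t))"
  have "S3_smooth (\<lambda>p. Ztb (\<Phi> t) (Q11 (\<Phi> t)) p - 2 * conn1b p * Q11 (\<Phi> t) p)"
    by (intro S3_smooth_diff S3_smooth_mult S3_smooth_const smooth_conn smooth_Q derivation_smooth[OF derivation_Zt(2)[OF smooth]])
  then have W: "S3_smooth W"
    by (rule S3_smooth_cong) (simp add: W_def cov_def omega_frame)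
  define U where "U p = (1 / 3) * (W p / (hfun (\<Phi> t) p * hfun (\<Phi> t) p))" for p
  have h2: "S3_smooth (\<lambda>p. hfun (\<Phi> t) p * hfun (\<Phi> t) p)" by (intro S3_smooth_mult smooth_hfun)
  have h0: "hfun (\<Phi> t) p * hfun (\<Phi> t) p \<noteq> 0" if "p \<in> S3" for p using hfun_nonzero[OF that] by simp
  have Whh: "S3_smooth (\<lambda>p. W p / (hfun (\<Phi> t) p * hfun (\<Phi> t) p))"
    by (rule S3_smooth_divide[OF W h2 h0])
  then have U: "S3_smooth U" unfolding U_def[abs_def]
    by (intro S3_smooth_mult S3_smooth_const)
  show thesis
  proof (rule that[OF U])
    fix p assume p: "p \<in> S3"
    define e where "e = conn1b p + cnj (conn1 p)"
    have e: "V (hfun (\<Phi> t)) p = hfun (\<Phi> t) p * e" if "V = Ztb (\<Phi> t)" for V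
      using connection_metric(3)[OF p] hfun_nonzero[OF p] unfolding e_def that by (simp add: field_simps)
    have VU: "V U p = (1 / 3) * ((V W p - 2 * W p * e) / (hfun (\<Phi> t) p)\<^sup>2)" if V: "derivation V" "V = Ztb (\<Phi> t)" for V
    proof -
      have "V U p = (1 / 3) * (V W p / (hfun (\<Phi> t) p * hfun (\<Phi> t) p) -
          W p * V (\<lambda>p. hfun (\<Phi> t) p * hfun (\<Phi> t) p) p / (hfun (\<Phi> t) p * hfun (\<Phi> t) p)\<^sup>2)"
        unfolding U_def[abs_def] derivation_mult[OF V(1) S3_smooth_const Whh p] derivation_const[OF V(1) p]
        by (simp only: derivation_divide[OF V(1) W h2 h0 p]) simp
      also have "\<dots> = (1 / 3) * ((V W p - 2 * W p * e) / (hfun (\<Phi> t) p)\<^sup>2)"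
        unfolding derivation_mult[OF V(1) smooth_hfun smooth_hfun p] e[OF V(2)] using hfun_nonzero[OF p]
        by (simp add: field_simps power2_eq_square)
      finally show ?thesis .
    qed
    have "Z1 (\<lambda>q. cnj (\<Phi> t q) * U q) p = cnj (Z1b (\<Phi> t) p) * U p + cnj (\<Phi> t p) * Z1 U p"
      by (simp add: derivation_mult[OF derivation_Z1] S3_smooth_cnj smooth U p vector_fields_cnj)
    moreover have "Z1b U p + cnj (\<Phi> t p) * Z1 U p = Ztb (\<Phi> t) U p" by (simp add: Ztb_def)
    ultimately have "Z1b U p + Z1 (\<lambda>q. cnj (\<Phi> t q) * U q) p = Ztb (\<Phi> t) U p + cnj (Z1b (\<Phi> t) p) * U p"
      by (simp add: algebra_simps)
    \<comment> \<open>Differentiating 1/h^2 contributes -2 (\<open>conn1b\<close> + cnj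
      \<open>conn1\<close>) and the derivative of cnj \<phi> contributes + cnj \<open>conn1\<close>.
      The sum, -(2 \<open>conn1b\<close> + cnj \<open>conn1\<close>), is exactly the connection term
      for two indices 1 and one index 1bar.\<close>
    also have "\<dots> = (1 / 3) * ((Ztb (\<Phi> t) W p - (2 * conn1b p + cnj (conn1 p)) * W p) / (hfun (\<Phi> t) p)\<^sup>2)"
      unfolding VU[OF derivation_Zt(2)[OF smooth] refl] U_def conn1_def[symmetric] e_def
      using hfun_nonzero[OF p] by (simp add: field_simps power2_eq_square)
    finally have div: "Z1b U p + Z1 (\<lambda>q. cnj (\<Phi> t q) * U q) p =
      (1 / 3) * ((Ztb (\<Phi> t) W p - (2 * conn1b p + cnj (conn1 p)) * W p) / (hfun (\<Phi> t) p)\<^sup>2)" .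
    have "cov (\<Phi> t) 2 1 (Ztb (\<Phi> t)) W p = Ztb (\<Phi> t) W p - (2 * conn1b p + cnj (conn1 p)) * W p"
      by (simp add: cov_def omega_frame[OF p])
    then show "obstr (\<Phi> t) p = Z1b U p + Z1 (\<lambda>q. cnj (\<Phi> t q) * U q) p - \<i> / 3 * Aup11 (\<Phi> t) p * Q11 (\<Phi> t) p"
      unfolding div obstr_def W_def[symmetric] by (simp add: right_diff_distrib)
  qed
qed

end

section \<open>Integration over the sphere\<close>

definition sphere_integral :: "cfun \<Rightarrow> complex" where
  "sphere_integral f = integral (ball 0 1) (\<lambda>x. f (inverse (norm x) *\<^sub>R x))"

lemma S3_inner_sphere_integral: "S3_inner f g = sphere_integral (\<lambda>p. f p * cnj (g p))"
  by (simp add: S3_inner_def sphere_integral_def)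

text \<open>The origin is a null set, and off it the normalization x / |x| is continuous.\<close>

abbreviation punctured_ball :: "C2 set" where "punctured_ball \<equiv> ball 0 1 - {0}"

lemma punctured_ball_lmeasurable: "punctured_ball \<in> lmeasurable"
  by (intro bounded_set_imp_lmeasurable bounded_subset[OF bounded_ball[of 0 1]]) auto

lemma sphere_integral_punctured:
  "sphere_integral f = integral punctured_ball (\<lambda>x. f (inverse (norm x) *\<^sub>R x))"
  unfolding sphere_integral_def
  by (rule integral_spike_set; rule negligible_subset[OF negligible_sing[of 0]]) (simp_all add: subset_eq)

lemma normalize_S3: "x \<noteq> 0 \<Longrightarrow> inverse (norm x) *\<^sub>R x \<in> S3"
  by (simp add: S3_sphere)

lemma sphere_integral_cong:
  assumes "\<And>p. p \<in> S3 \<Longrightarrow> f p = g p" shows "sphere_integral f = sphere_integral g"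
  unfolding sphere_integral_punctured
  by (rule integral_cong) (simp add: assms normalize_S3)

lemma S3_smooth_continuous: "S3_smooth f \<Longrightarrow> continuous_on S3 f"
  by (metis C_inf_continuous_on S3_smoothE continuous_on_cong)

lemma continuous_on_normalize:
  fixes f :: "C2 \<Rightarrow> 'a::topological_space"
  assumes "continuous_on S3 f"
  shows "continuous_on punctured_ball (\<lambda>x. f (inverse (norm x) *\<^sub>R x))"
proof (rule continuous_on_compose2[OF assms])
  show "continuous_on punctured_ball (\<lambda>x. inverse (norm x) *\<^sub>R x)"
    by (intro continuous_intros) simp
  show "(\<lambda>x. inverse (norm x) *\<^sub>R x) ` punctured_ball \<subseteq> S3"
    by (rule image_subsetI) (simp add: normalize_S3)
qed

lemma S3_continuous_bounded:
  fixes f :: "C2 \<Rightarrow> 'a::real_normed_vector"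
  assumes "continuous_on S3 f" obtains B where "B > 0" "\<And>p. p \<in> S3 \<Longrightarrow> norm (f p) \<le> B"
proof -
  have "compact (f ` S3)"
    using assms unfolding S3_sphere by (intro compact_continuous_image compact_sphere)
  then obtain B where "B > 0" "\<forall>x\<in>f ` S3. norm x \<le> B"
    using compact_imp_bounded bounded_pos by metis
  then show thesis by (intro that[of B]) simp_all
qed

lemma normalize_integrable:
  fixes f :: "C2 \<Rightarrow> 'a::euclidean_space"
  assumes f: "continuous_on S3 f" and K: "K \<in> lmeasurable" "K \<subseteq> punctured_ball"
  shows "(\<lambda>x. f (inverse (norm x) *\<^sub>R x)) integrable_on K"
proof -
  obtain B where B: "\<And>p. p \<in> S3 \<Longrightarrow> norm (f p) \<le> B" using S3_continuous_bounded[OF f] by blast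
  show ?thesis
  proof (rule measurable_bounded_by_integrable_imp_integrable)
    show "(\<lambda>x. f (inverse (norm x) *\<^sub>R x)) \<in> borel_measurable (lebesgue_on K)"
      by (rule continuous_imp_measurable_on_sets_lebesgue[OF continuous_on_subset[OF continuous_on_normalize[OF f] K(2)]])
        (rule fmeasurableD[OF K(1)])
    show "(\<lambda>x. B) integrable_on K"
      using K(1) by (rule integrable_on_const)
    show "norm (f (inverse (norm x) *\<^sub>R x)) \<le> B" if "x \<in> K" for x
    proof -
      have "x \<noteq> 0" using that K(2) by blast
      then show ?thesis by (intro B normalize_S3)
    qed
  qed (rule fmeasurableD[OF K(1)])
qed

lemmas normalize_integrable' = normalize_integrable[OF _ punctured_ball_lmeasurable order_refl]

lemma sphere_integral_add:
  assumes "continuous_on S3 f" "continuous_on S3 g"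
  shows "sphere_integral (\<lambda>p. f p + g p) = sphere_integral f + sphere_integral g"
  unfolding sphere_integral_punctured by (intro integral_add normalize_integrable' assms)

lemma sphere_integral_cmult: "sphere_integral (\<lambda>p. c * f p) = c * sphere_integral f"
  unfolding sphere_integral_def by (rule integral_mult_right)

lemma sphere_integral_cnj: "sphere_integral (\<lambda>p. cnj (f p)) = cnj (sphere_integral f)"
  unfolding sphere_integral_def by (rule integral_cnj[symmetric])

lemma sphere_integral_minus: "sphere_integral (\<lambda>p. - f p) = - sphere_integral f"
  using sphere_integral_cmult[of "-1" f] by simp

lemma sphere_integral_diff:
  assumes "continuous_on S3 f" "continuous_on S3 g"
  shows "sphere_integral (\<lambda>p. f p - g p) = sphere_integral f - sphere_integral g"
  using sphere_integral_add[OF assms(1) continuous_on_minus[OF assms(2)]] by (simp add: sphere_integral_minus)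

definition punctured_volume :: real where
  "punctured_volume = integral punctured_ball (\<lambda>x. 1)"

lemma sphere_integral_bound:
  assumes "continuous_on S3 f" "\<And>p. p \<in> S3 \<Longrightarrow> cmod (f p) \<le> B"
  shows "cmod (sphere_integral f) \<le> B * punctured_volume"
proof -
  have "cmod (sphere_integral f) \<le> integral punctured_ball (\<lambda>x. B * 1)"
    unfolding sphere_integral_punctured
    by (rule integral_norm_bound_integral[OF normalize_integrable'[OF assms(1)]])
      (use punctured_ball_lmeasurable in \<open>simp_all add: assms(2) normalize_S3 integrable_on_const\<close>)
  then show ?thesis unfolding punctured_volume_def by (simp only: integral_mult_right)
qed

text \<open>This makes the pairing definite. If f were positive at p, its homogeneous extension
  would be bounded below by a positive constant on a small ball, whose volume then forces a positive
  integral.\<close>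

lemma sphere_integral_eq_0_imp:
  assumes cont: "continuous_on S3 f" and nonneg: "\<And>p. p \<in> S3 \<Longrightarrow> f p \<in> \<real>\<^sub>\<ge>\<^sub>0"
    and zero: "sphere_integral f = 0" and p: "p \<in> S3"
  shows "f p = 0"
proof (rule ccontr)
  assume "f p \<noteq> 0"
  define r where "r x = Re (f (inverse (norm x) *\<^sub>R x))" for x
  have contr: "continuous_on punctured_ball r"
    unfolding r_def by (intro continuous_intros continuous_on_normalize cont)
  have r0: "r x \<ge> 0" if "x \<in> punctured_ball" for x
    using nonneg[OF normalize_S3, of x] that by (auto simp: r_def complex_nonneg_Reals_iff)
  have "continuous_on S3 (\<lambda>p. Re (f p))" by (intro continuous_intros cont)
  then have int: "r integrable_on punctured_ball"
    unfolding r_def by (rule normalize_integrable')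
  \<comment> \<open>A point on the ray through p that is interior to the punctured ball; p itself
    lies on the boundary.\<close>
  define x where "x = (1 / 2 :: real) *\<^sub>R p"
  have "norm p = 1" using p by (simp add: S3_sphere)
  then have x: "x \<in> punctured_ball" "inverse (norm x) *\<^sub>R x = p" by (auto simp: x_def)
  have rx: "r x > 0" using \<open>f p \<noteq> 0\<close> nonneg[OF p] x(2)
    by (auto simp: r_def complex_nonneg_Reals_iff complex_eq_iff less_le)
  have "open punctured_ball" by (simp add: open_Diff)
  then have "isCont r x" using contr x(1) continuous_on_eq_continuous_at by blast
  then have "\<forall>\<^sub>F y in nhds x. r y > r x / 2"
    using rx by (intro order_tendstoD(1)[of r "r x"]) (auto simp: continuous_within tendsto_at_iff_tendsto_nhds)
  moreover have "\<forall>\<^sub>F y in nhds x. y \<in> punctured_ball"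
    using \<open>open punctured_ball\<close> x(1) by (rule eventually_nhds_in_open)
  ultimately have "\<forall>\<^sub>F y in nhds x. r y > r x / 2 \<and> y \<in> punctured_ball" by (rule eventually_conj)
  then obtain d where d: "d > 0" "\<And>y. dist y x < d \<Longrightarrow> r y > r x / 2 \<and> y \<in> punctured_ball"
    unfolding eventually_nhds_metric by blast
  have K: "ball x d \<subseteq> punctured_ball" using d(2) by (metis dist_commute mem_ball subsetI)
  have lm: "ball x d \<in> lmeasurable" by (rule lmeasurable_ball)
  have intK: "r integrable_on ball x d"
    unfolding r_def by (rule normalize_integrable[OF _ lm K]) (intro continuous_intros cont)
  have "r x / 2 * measure lebesgue (ball x d) = integral (ball x d) (\<lambda>y. r x / 2 * 1)"
    by (simp only: integral_mult_right lmeasure_integral[OF lm])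
  also have "\<dots> \<le> integral (ball x d) r"
  proof (rule integral_le)
    show "r integrable_on ball x d"
      by (rule intK)
    show "r x / 2 * 1 \<le> r y" if "y \<in> ball x d" for y
      using d(2)[of y] that by (simp add: dist_commute)
  qed (use lm in \<open>simp add: integrable_on_const\<close>)
  also have "\<dots> \<le> integral punctured_ball r"
    by (rule integral_subset_le[OF K _ int]) (use r0 intK in blast)+
  also have "\<dots> = Re (sphere_integral f)"
    unfolding r_def sphere_integral_punctured by (rule integral_unique[OF has_integral_Re[OF integrable_integral[OF normalize_integrable'[OF cont]]]])
  finally have "r x / 2 * measure lebesgue (ball x d) \<le> 0" using zero by simp
  moreover have "measure lebesgue (ball x d) > 0"
    using content_ball_pos[OF d(1), of x] by simp
  ultimately show False using rx mult_pos_pos[of "r x / 2" "measure lebesgue (ball x d)"] by linarith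
qed

section \<open>Invariance of the integral under the flows, and the divergence theorem\<close>

lemma lborel_shear:
  fixes g :: "'b::euclidean_space \<Rightarrow> 'a::euclidean_space"
  assumes [measurable]: "g \<in> borel_measurable borel"
  shows "distr lborel lborel (\<lambda>x. (fst x + g (snd x), snd x)) = (lborel :: ('a \<times> 'b) measure)"
proof (rule measure_eqI)
  fix A :: "('a \<times> 'b) set" assume "A \<in> sets (distr lborel lborel (\<lambda>x. (fst x + g (snd x), snd x)))"
  then have A [measurable]: "A \<in> sets borel" by simp
  have A' [measurable]: "A \<in> sets (lborel \<Otimes>\<^sub>M lborel)" unfolding lborel_prod using A by simp
  have S: "(\<lambda>x. (fst x + g (snd x), snd x)) \<in> borel_measurable (borel :: ('a \<times> 'b) measure)"
    unfolding borel_prod[symmetric] by measurable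
  have "emeasure (distr lborel lborel (\<lambda>x. (fst x + g (snd x), snd x))) A
      = (\<integral>\<^sup>+x. indicator A (fst x + g (snd x), snd x) \<partial>lborel)"
    using S A by (simp add: nn_integral_distr flip: nn_integral_indicator)
  also have "\<dots> = (\<integral>\<^sup>+w. \<integral>\<^sup>+z. indicator A (z + g w, w) \<partial>lborel \<partial>lborel)"
    unfolding lborel_prod[symmetric] by (subst lborel_pair.nn_integral_snd[symmetric]) simp_all
  also have "\<dots> = (\<integral>\<^sup>+w. \<integral>\<^sup>+z. indicator A (z, w) \<partial>lborel \<partial>lborel)"
  proof (rule nn_integral_cong)
    fix w
    have "(\<integral>\<^sup>+z. indicator A (z, w) \<partial>lborel) = (\<integral>\<^sup>+z. indicator A (z, w) \<partial>distr lborel borel ((+) (g w)))"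
      by (simp only: lborel_distr_plus)
    also have "\<dots> = (\<integral>\<^sup>+z. indicator A (z + g w, w) \<partial>lborel)"
      by (subst nn_integral_distr) (simp_all add: add.commute)
    finally show "(\<integral>\<^sup>+z. indicator A (z + g w, w) \<partial>lborel) = (\<integral>\<^sup>+z. indicator A (z, w) \<partial>lborel)" ..
  qed
  also have "\<dots> = (\<integral>\<^sup>+x. indicator A x \<partial>lborel)"
    unfolding lborel_prod[symmetric] by (subst lborel_pair.nn_integral_snd) simp_all
  finally show "emeasure (distr lborel lborel (\<lambda>x. (fst x + g (snd x), snd x))) A = emeasure lborel A"
    using A by simp
qed simp

lemma lborel_shear':
  fixes g :: "'a::euclidean_space \<Rightarrow> 'b::euclidean_space"
  assumes [measurable]: "g \<in> borel_measurable borel"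
  shows "distr lborel lborel (\<lambda>x. (fst x, snd x + g (fst x))) = (lborel :: ('a \<times> 'b) measure)"
proof (rule measure_eqI)
  fix A :: "('a \<times> 'b) set" assume "A \<in> sets (distr lborel lborel (\<lambda>x. (fst x, snd x + g (fst x))))"
  then have A [measurable]: "A \<in> sets borel" by simp
  have A' [measurable]: "A \<in> sets (lborel \<Otimes>\<^sub>M lborel)" unfolding lborel_prod using A by simp
  have S: "(\<lambda>x. (fst x, snd x + g (fst x))) \<in> borel_measurable (borel :: ('a \<times> 'b) measure)"
    unfolding borel_prod[symmetric] by measurable
  have "emeasure (distr lborel lborel (\<lambda>x. (fst x, snd x + g (fst x)))) A
      = (\<integral>\<^sup>+x. indicator A (fst x, snd x + g (fst x)) \<partial>lborel)"
    using S A by (simp add: nn_integral_distr flip: nn_integral_indicator)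
  also have "\<dots> = (\<integral>\<^sup>+z. \<integral>\<^sup>+w. indicator A (z, w + g z) \<partial>lborel \<partial>lborel)"
    unfolding lborel_prod[symmetric] by (subst lborel.nn_integral_fst[symmetric]) simp_all
  also have "\<dots> = (\<integral>\<^sup>+z. \<integral>\<^sup>+w. indicator A (z, w) \<partial>lborel \<partial>lborel)"
  proof (rule nn_integral_cong)
    fix z
    have "(\<integral>\<^sup>+w. indicator A (z, w) \<partial>lborel) = (\<integral>\<^sup>+w. indicator A (z, w) \<partial>distr lborel borel ((+) (g z)))"
      by (simp only: lborel_distr_plus)
    also have "\<dots> = (\<integral>\<^sup>+w. indicator A (z, w + g z) \<partial>lborel)"
      by (subst nn_integral_distr) (simp_all add: add.commute)
    finally show "(\<integral>\<^sup>+w. indicator A (z, w + g z) \<partial>lborel) = (\<integral>\<^sup>+w. indicator A (z, w) \<partial>lborel)" ..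
  qed
  also have "\<dots> = (\<integral>\<^sup>+x. indicator A x \<partial>lborel)"
    unfolding lborel_prod[symmetric] by (subst lborel.nn_integral_fst) simp_all
  finally show "emeasure (distr lborel lborel (\<lambda>x. (fst x, snd x + g (fst x)))) A = emeasure lborel A"
    using A by simp
qed simp

text \<open>A common form of \<open>flowX\<close> and \<open>flowY\<close>. The map is real linear
  but not complex linear, because of the conjugates; for |e| = 1 it preserves the norm.\<close>

definition rotation :: "complex \<Rightarrow> real \<Rightarrow> C2 \<Rightarrow> C2" where
  "rotation e t x = (fst x * of_real (cos t) + e * cnj (snd x) * of_real (sin t),
     snd x * of_real (cos t) - e * cnj (fst x) * of_real (sin t))"

lemma flow_rotation: "flowX = rotation 1" "flowY = rotation \<i>"
  by (simp_all add: fun_eq_iff flowX_def flowY_def rotation_def)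

lemma continuous_on_rotation: "continuous_on A (rotation e t)"
  unfolding rotation_def by (intro continuous_intros)

text \<open>A rotation is a product of three shears, with parameters \<open>tan (t / 2)\<close>, \<open>- sin t\<close> and \<open>tan (t / 2)\<close>.\<close>
lemma lborel_rotation:
  assumes e: "cmod e = 1" and t: "\<bar>t\<bar> < pi"
  shows "distr lborel lborel (rotation e t) = lborel"
proof -
  define a where "a = e * of_real (tan (t / 2))"
  define b where "b = - e * of_real (sin t)"
  define S1 :: "C2 \<Rightarrow> C2" where "S1 = (\<lambda>x. (fst x + a * cnj (snd x), snd x))"
  define S2 :: "C2 \<Rightarrow> C2" where "S2 = (\<lambda>x. (fst x, snd x + b * cnj (fst x)))"
  have ee: "e * cnj e = 1" using e by (simp add: complex_norm_square[symmetric])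
  have "cos (t / 2) \<noteq> 0" using t by (intro less_imp_neq[symmetric] cos_gt_zero_pi) auto
  have ct: "cos t = 1 - tan (t / 2) * sin t" and st: "sin t = tan (t / 2) * (1 + cos t)"
    using \<open>cos (t / 2) \<noteq> 0\<close> sin_cos_squared_add[of "t / 2"] sin_double[of "t / 2"] cos_double_sin[of "t / 2"] cos_double_cos[of "t / 2"]
    by (simp_all add: tan_def field_simps power2_eq_square)
  have "rotation e t x = S1 (S2 (S1 x))" for x
  proof (rule prod_eqI)
    have C: "complex_of_real (cos t) = 1 - of_real (tan (t / 2)) * of_real (sin t)"
      "complex_of_real (sin t) = of_real (tan (t / 2)) * (1 + of_real (cos t))"
      using ct st by (metis of_real_1 of_real_diff of_real_mult, metis of_real_1 of_real_add of_real_mult)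
    show "fst (rotation e t x) = fst (S1 (S2 (S1 x)))" "snd (rotation e t x) = snd (S1 (S2 (S1 x)))"
      unfolding rotation_def S1_def S2_def a_def b_def by (simp_all) (use C ee in algebra)+
  qed
  then have R: "rotation e t = S1 \<circ> (S2 \<circ> S1)" by (simp add: fun_eq_iff)
  have [measurable]: "S1 \<in> borel_measurable borel" "S2 \<in> borel_measurable borel"
    unfolding S1_def S2_def by (intro borel_measurable_continuous_onI continuous_intros)+
  have "distr lborel lborel S1 = lborel" "distr lborel lborel S2 = lborel"
    unfolding S1_def S2_def
    by (intro lborel_shear lborel_shear' borel_measurable_continuous_onI continuous_intros)+
  moreover have "distr lborel lborel (S1 \<circ> (S2 \<circ> S1)) = distr (distr (distr lborel lborel S1) lborel S2) lborel S1"
    by (simp add: distr_distr comp_assoc)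
  ultimately show ?thesis unfolding R by simp
qed

lemma norm_rotation:
  assumes "cmod e = 1" shows "norm (rotation e t x) = norm x"
proof -
  have ee: "e * cnj e = 1" using assms by (simp add: complex_norm_square[symmetric])
  have sc: "complex_of_real (sin t) * of_real (sin t) = 1 - of_real (cos t) * of_real (cos t)"
    using sin_squared_eq[of t] by (metis of_real_1 of_real_diff of_real_mult power2_eq_square)
  have n: "complex_of_real ((norm y)\<^sup>2) = fst y * cnj (fst y) + snd y * cnj (snd y)" for y :: C2
  proof -
    have "(norm y)\<^sup>2 = (cmod (fst y))\<^sup>2 + (cmod (snd y))\<^sup>2" by (simp add: norm_prod_def)
    then show ?thesis by (simp only: of_real_add complex_norm_square)
  qed
  have "complex_of_real ((norm (rotation e t x))\<^sup>2) = of_real ((norm x)\<^sup>2)"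
    unfolding n rotation_def by simp (use ee sc in algebra)
  then have "(norm (rotation e t x))\<^sup>2 = (norm x)\<^sup>2" by (rule of_real_eq_iff[THEN iffD1])
  then show ?thesis by simp
qed

lemma rotation_S3: "cmod e = 1 \<Longrightarrow> p \<in> S3 \<Longrightarrow> rotation e t p \<in> S3"
  by (simp add: S3_sphere norm_rotation)

lemma rotation_scaleR: "rotation e t (c *\<^sub>R x) = c *\<^sub>R rotation e t x"
  by (simp add: rotation_def scaleR_conv_of_real algebra_simps)

lemma rotation_add: "rotation e (s + t) x = rotation e t (rotation e s x)" if "cmod e = 1"
proof -
  have ee: "e * cnj e = 1" using that by (simp add: complex_norm_square[symmetric])
  show ?thesis
    unfolding rotation_def sin_add cos_add of_real_add of_real_diff of_real_mult
    by (rule prod_eqI) (simp_all, (use ee in algebra)+)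
qed

text \<open>A rotation preserves both the norm and Lebesgue measure, so it commutes with the
  normalization x / |x| and maps the punctured ball to itself.\<close>

lemma sphere_integral_rotation:
  assumes f: "continuous_on S3 f" and e: "cmod e = 1" and t: "\<bar>t\<bar> < pi"
  shows "sphere_integral (\<lambda>p. f (rotation e t p)) = sphere_integral f"
proof -
  define F where "F x = indicator punctured_ball x *\<^sub>R f (inverse (norm x) *\<^sub>R x)" for x
  have F: "F \<in> borel_measurable borel"
    unfolding F_def by (rule borel_measurable_continuous_on_indicator[OF _ continuous_on_normalize[OF f]]) simp
  have rot: "rotation e t \<in> borel_measurable borel"
    by (intro borel_measurable_continuous_onI continuous_on_rotation)
  \<comment> \<open>The change of variables lives on the Lebesgue side, so the gauge integral is
    first identified with a Lebesgue integral; boundedness on a set of finite measure gives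
    integrability.\<close>
  have eq: "integral punctured_ball (\<lambda>x. g (inverse (norm x) *\<^sub>R x)) =
      (\<integral>x. indicator punctured_ball x *\<^sub>R g (inverse (norm x) *\<^sub>R x) \<partial>lborel)" if g: "continuous_on S3 g" for g :: cfun
  proof -
    obtain B where B: "\<And>p. p \<in> S3 \<Longrightarrow> norm (g p) \<le> B" using S3_continuous_bounded[OF g] by blast
    have "set_integrable lborel punctured_ball (\<lambda>x. g (inverse (norm x) *\<^sub>R x))"
      unfolding set_integrable_def
    proof (rule integrableI_bounded_set)
      show "(\<lambda>x. indicator punctured_ball x *\<^sub>R g (inverse (norm x) *\<^sub>R x)) \<in> borel_measurable lborel"
        by (simp add: borel_measurable_continuous_on_indicator[OF _ continuous_on_normalize[OF g]])
      show "emeasure lborel punctured_ball < \<infinity>"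
        by (rule emeasure_bounded_finite) (rule bounded_subset[OF bounded_ball[of 0 1]], simp)
      show "AE x in lborel. x \<in> punctured_ball \<longrightarrow>
          norm (indicator punctured_ball x *\<^sub>R g (inverse (norm x) *\<^sub>R x)) \<le> B"
        by (rule AE_I2) (simp add: B normalize_S3)
    qed simp_all
    from set_borel_integral_eq_integral(2)[OF this] show ?thesis
      by (simp add: set_lebesgue_integral_def)
  qed
  have "continuous_on S3 (\<lambda>p. f (rotation e t p))"
    by (rule continuous_on_compose2[OF f continuous_on_rotation]) (rule image_subsetI, rule rotation_S3[OF e])
  note eq1 = eq[OF this]
  have "sphere_integral (\<lambda>p. f (rotation e t p)) = (\<integral>x. F (rotation e t x) \<partial>lborel)"
  proof -
    have "rotation e t 0 = 0" by (simp add: rotation_def zero_prod_def)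
    moreover have "rotation e t x = 0 \<longleftrightarrow> x = 0" for x
      using norm_rotation[OF e, of t x] by (metis norm_eq_zero)
    ultimately have "F (rotation e t x) = indicator punctured_ball x *\<^sub>R f (rotation e t (inverse (norm x) *\<^sub>R x))" for x
      by (simp add: F_def norm_rotation[OF e] rotation_scaleR indicator_def)
    then show ?thesis unfolding sphere_integral_punctured eq1 by simp
  qed
  also have "\<dots> = (\<integral>x. F x \<partial>distr lborel lborel (rotation e t))"
    using F rot by (subst integral_distr) simp_all
  also have "\<dots> = sphere_integral f"
    unfolding lborel_rotation[OF e t] sphere_integral_punctured eq[OF f] F_def ..
  finally show ?thesis .
qed

text \<open>The integral of f along the flow is constant in the time parameter, so the difference
  quotients integrate to 0. They converge pointwise to the derivative and are dominated by its
  maximum on the sphere, by the fundamental theorem along an orbit.\<close>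

lemma sphere_integral_along:
  assumes f: "C_inf f" and e: "cmod e = 1" and der: "C_inf (along (rotation e) f)"
  and vd: "\<And>p. ((\<lambda>t. f (rotation e t p)) has_vector_derivative along (rotation e) f p) (at 0)"
  shows "sphere_integral (along (rotation e) f) = 0"
proof -
  define g where "g = along (rotation e) f"
  have contf: "continuous_on S3 f" and contg: "continuous_on S3 g"
    using C_inf_continuous_on f der by (auto simp: g_def)
  obtain B where B: "B > 0" "\<And>p. p \<in> S3 \<Longrightarrow> cmod (g p) \<le> B" using S3_continuous_bounded[OF contg] by blast
  have deriv: "((\<lambda>t. f (rotation e t p)) has_vector_derivative g (rotation e s p)) (at s)" for s p
  proof -
    have "((\<lambda>t. t - s) has_vector_derivative 1) (at s)" by (auto intro!: derivative_eq_intros)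
    from vector_diff_chain_at[OF this, of "\<lambda>t. f (rotation e t (rotation e s p))"] vd[of "rotation e s p"]
    show ?thesis by (simp add: o_def rotation_add[OF e, symmetric] g_def)
  qed
  have rot0: "rotation e 0 p = p" for p by (simp add: rotation_def)
  \<comment> \<open>Times tending to 0 that stay positive and below pi, the range in which the
    decomposition into shears is available.\<close>
  define s where "s k = inverse (real (Suc k))" for k
  have s: "s k > 0" "\<bar>s k\<bar> < pi" for k
    using pi_gt3 le_imp_inverse_le[of 1 "real (Suc k)"] by (auto simp: s_def)
  have s_lim: "s \<longlonglongrightarrow> 0" unfolding s_def by (rule LIMSEQ_inverse_real_of_nat)
  define q where "q k p = of_real (inverse (s k)) * (f (rotation e (s k) p) - f p)" for k p
  have contq: "continuous_on S3 (\<lambda>p. f (rotation e (s k) p))" for k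
    by (rule continuous_on_compose2[OF contf continuous_on_rotation]) (rule image_subsetI, rule rotation_S3[OF e])
  have int_q: "sphere_integral (q k) = 0" for k
    unfolding q_def sphere_integral_cmult sphere_integral_diff[OF contq contf]
      sphere_integral_rotation[OF contf e s(2)] by simp
  have bound: "cmod (q k p) \<le> B" if p: "p \<in> S3" for k p
  proof -
    have "((\<lambda>\<tau>. g (rotation e \<tau> p)) has_integral f (rotation e (s k) p) - f (rotation e 0 p)) {0..s k}"
      using s(1)[of k] by (intro fundamental_theorem_of_calculus has_vector_derivative_at_within[OF deriv]) simp
    then have "((\<lambda>\<tau>. g (rotation e \<tau> p)) has_integral f (rotation e (s k) p) - f p) (cbox 0 (s k))"
      by (simp add: rot0)
    from has_integral_bound[OF _ this, of B]
    have "norm (f (rotation e (s k) p) - f p) \<le> B * Henstock_Kurzweil_Integration.content (cbox 0 (s k))"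
      using B rotation_S3[OF e p] by simp
    then show ?thesis
      using s(1)[of k] by (simp add: q_def norm_mult norm_divide field_simps)
  qed
  have lim: "(\<lambda>k. q k p) \<longlonglongrightarrow> g p" for p
  proof -
    have "((\<lambda>h. norm (f (rotation e (0 + h) p) - f (rotation e 0 p) - h *\<^sub>R g p) / norm h) \<longlongrightarrow> 0) (at 0)"
      using vd[of p] unfolding has_vector_derivative_def has_derivative_at g_def by blast
    then have "((\<lambda>h. norm (f (rotation e h p) - f p - h *\<^sub>R g p) / norm h) \<longlongrightarrow> 0) (at 0)"
      by (simp add: rot0)
    moreover have "filterlim s (at 0) sequentially"
      using s_lim s(1) by (auto simp: filterlim_at less_imp_neq[symmetric] intro!: always_eventually)
    ultimately have "(\<lambda>k. norm (f (rotation e (s k) p) - f p - s k *\<^sub>R g p) / norm (s k)) \<longlonglongrightarrow> 0"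
      by (rule filterlim_compose)
    moreover have "norm (f (rotation e (s k) p) - f p - s k *\<^sub>R g p) / norm (s k) = norm (q k p - g p)" for k
    proof -
      have "f (rotation e (s k) p) - f p - s k *\<^sub>R g p = s k *\<^sub>R (q k p - g p)"
        using s(1)[of k] by (simp add: q_def scaleR_conv_of_real field_simps)
      then show ?thesis using s(1)[of k] by simp
    qed
    ultimately have "(\<lambda>k. q k p - g p) \<longlonglongrightarrow> 0" by (simp add: tendsto_norm_zero_iff)
    then show ?thesis by (rule LIM_zero_cancel)
  qed
  have "(\<lambda>k. integral punctured_ball (\<lambda>x. q k (inverse (norm x) *\<^sub>R x))) \<longlonglongrightarrow>
      integral punctured_ball (\<lambda>x. g (inverse (norm x) *\<^sub>R x))"
  proof (rule dominated_convergence(2)[where h="\<lambda>x. B"])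
    show "(\<lambda>x. q k (inverse (norm x) *\<^sub>R x)) integrable_on punctured_ball" for k
      unfolding q_def by (rule normalize_integrable') (intro continuous_intros contq contf)
    show "(\<lambda>x. B) integrable_on punctured_ball"
      by (rule integrable_on_const[OF punctured_ball_lmeasurable])
    show "norm (q k (inverse (norm x) *\<^sub>R x)) \<le> B" if "x \<in> punctured_ball" for k x
      using that by (intro bound normalize_S3) simp
  qed (rule lim)
  then show ?thesis
    using int_q by (simp add: sphere_integral_punctured[symmetric] LIMSEQ_const_iff g_def)
qed

text \<open>\<open>Z1\<close> and \<open>Z1b\<close> are complex combinations of the two flow
  derivatives, each of which integrates to 0.\<close>

lemma sphere_integral_Z:
  assumes "S3_smooth f" shows "sphere_integral (Z1 f) = 0" "sphere_integral (Z1b f) = 0"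
proof -
  obtain g where g: "C_inf g" "\<And>p. p \<in> S3 \<Longrightarrow> f p = g p" using assms by (rule S3_smoothE) blast
  have along: "along flowX g = (\<lambda>p. Z1 g p + Z1b g p)" "along flowY g = (\<lambda>p. \<i> * (Z1 g p - Z1b g p))"
    by (auto simp: Z1_def Z1b_def algebra_simps add_divide_distrib diff_divide_distrib)
  have smooth: "C_inf (along flowX g)" "C_inf (along flowY g)"
    unfolding along by (intro C_inf_intros C_inf_vector_fields g)+
  have vd: "((\<lambda>t. g (fl t p)) has_vector_derivative along fl g p) (at 0)"
    if "((\<lambda>t. fl t p) has_vector_derivative v) (at 0)" for fl p v
    using has_derivative_compose[OF that[unfolded has_vector_derivative_def] C_inf_has_derivative[OF g(1)]]
    unfolding along_def by (intro vector_derivative_works[THEN iffD1]) (auto simp: differentiable_def)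
  have X: "sphere_integral (along flowX g) = 0" "sphere_integral (along flowY g) = 0"
    using smooth vd[OF flow_derivatives(1)] vd[OF flow_derivatives(2)] unfolding flow_rotation
    by (auto intro!: sphere_integral_along g(1))
  have "continuous_on S3 (Z1 g)" "continuous_on S3 (Z1b g)"
    by (intro C_inf_continuous_on C_inf_vector_fields g)+
  then have "sphere_integral (Z1 g) = 0" "sphere_integral (Z1b g) = 0"
    using X unfolding along by (simp_all add: sphere_integral_add sphere_integral_diff sphere_integral_cmult)
  then show "sphere_integral (Z1 f) = 0" "sphere_integral (Z1b f) = 0"
    using vector_fields_cong[of f g] g(2) by (metis (no_types, lifting) sphere_integral_cong)+
qed

section \<open>Spherical harmonics\<close>

definition wlap :: vfield where "wlap f = (\<lambda>x. dz (dzb f) x + dw (dwb f) x)"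

lemma laplacian_eq:
  assumes "C_inf f" shows "laplacian f x = 4 * wlap f x"
proof -
  have D2: "D v (D u f) x = D u (D v f) x" for u v by (rule D_commute[OF assms])
  have L: "D v (\<lambda>x. (D a f x + \<i> * D b f x) / 2) = (\<lambda>x. (D v (D a f) x + \<i> * D v (D b f) x) / 2)" for a b v
    by (rule D_lin_comb) (intro C_inf_D assms)+
  have B: "(Basis :: C2 set) = {(1, 0), (\<i>, 0), (0, 1), (0, \<i>)}"
    by (auto simp: Basis_prod_def Basis_complex_def)
  have "laplacian f x = D (1, 0) (D (1, 0) f) x + (D (\<i>, 0) (D (\<i>, 0) f) x +
      (D (0, 1) (D (0, 1) f) x + D (0, \<i>) (D (0, \<i>) f) x))"
    by (simp add: laplacian_def D_def B)
  also have "\<dots> = 4 * wlap f x"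
    unfolding wlap_def wirtinger_defs L
    by (simp add: D2[of "(\<i>, 0)" "(1, 0)"] D2[of "(0, \<i>)" "(0, 1)"] field_simps)
  finally show ?thesis .
qed

lemma wlap_cmult_diff:
  assumes "C_inf f" "C_inf g"
  shows "wlap (\<lambda>x. k * (f x - g x)) x = k * (wlap f x - wlap g x)"
  unfolding wlap_def
  by (simp add: wirtinger_mult C_inf_const wirtinger_const wirtinger_diff C_inf_diff C_inf_wirtinger assms)
    (simp add: algebra_simps)

lemma wirtinger_power:
  assumes "C_inf f"
  shows "dz (\<lambda>x. f x ^ n) = (\<lambda>x. of_nat n * f x ^ (n - 1) * dz f x)"
    "dzb (\<lambda>x. f x ^ n) = (\<lambda>x. of_nat n * f x ^ (n - 1) * dzb f x)"
    "dw (\<lambda>x. f x ^ n) = (\<lambda>x. of_nat n * f x ^ (n - 1) * dw f x)"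
    "dwb (\<lambda>x. f x ^ n) = (\<lambda>x. of_nat n * f x ^ (n - 1) * dwb f x)"
proof (induction n)
  case (Suc n)
  {
    case 1
    have "dz (\<lambda>x. f x ^ Suc n) = (\<lambda>x. f x * dz (\<lambda>x. f x ^ n) x + dz f x * f x ^ n)"
      by (simp only: power_Suc wirtinger_mult(1)[OF assms C_inf_power[OF assms]])
    also have "\<dots> = (\<lambda>x. of_nat (Suc n) * f x ^ (Suc n - 1) * dz f x)"
      unfolding Suc(1) by (cases n) (simp_all add: fun_eq_iff algebra_simps)
    finally show ?case .
  next
    case 2
    have "dzb (\<lambda>x. f x ^ Suc n) = (\<lambda>x. f x * dzb (\<lambda>x. f x ^ n) x + dzb f x * f x ^ n)"
      by (simp only: power_Suc wirtinger_mult(2)[OF assms C_inf_power[OF assms]])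
    also have "\<dots> = (\<lambda>x. of_nat (Suc n) * f x ^ (Suc n - 1) * dzb f x)"
      unfolding Suc(2) by (cases n) (simp_all add: fun_eq_iff algebra_simps)
    finally show ?case .
  next
    case 3
    have "dw (\<lambda>x. f x ^ Suc n) = (\<lambda>x. f x * dw (\<lambda>x. f x ^ n) x + dw f x * f x ^ n)"
      by (simp only: power_Suc wirtinger_mult(3)[OF assms C_inf_power[OF assms]])
    also have "\<dots> = (\<lambda>x. of_nat (Suc n) * f x ^ (Suc n - 1) * dw f x)"
      unfolding Suc(3) by (cases n) (simp_all add: fun_eq_iff algebra_simps)
    finally show ?case .
  next
    case 4
    have "dwb (\<lambda>x. f x ^ Suc n) = (\<lambda>x. f x * dwb (\<lambda>x. f x ^ n) x + dwb f x * f x ^ n)"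
      by (simp only: power_Suc wirtinger_mult(4)[OF assms C_inf_power[OF assms]])
    also have "\<dots> = (\<lambda>x. of_nat (Suc n) * f x ^ (Suc n - 1) * dwb f x)"
      unfolding Suc(4) by (cases n) (simp_all add: fun_eq_iff algebra_simps)
    finally show ?case .
  }
qed (simp_all add: wirtinger_const)

section \<open>Bihomogeneous polynomials and their harmonic decomposition\<close>

definition monomial :: "nat \<Rightarrow> nat \<Rightarrow> nat \<Rightarrow> nat \<Rightarrow> cfun" where
  "monomial a b c d x = fst x ^ a * snd x ^ b * cnj (fst x) ^ c * cnj (snd x) ^ d"

text \<open>An inductive counterpart of \<open>bihom\<close>, equivalent to it by the two conversion
  lemmas below, so that closure under products and derivatives is proved by induction rather than by
  manipulating double sums.\<close>

inductive bipoly :: "nat \<Rightarrow> nat \<Rightarrow> cfun \<Rightarrow> bool" where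
  monomial: "a + b = p \<Longrightarrow> c + d = q \<Longrightarrow> bipoly p q (\<lambda>x. k * monomial a b c d x)"
| zero: "bipoly p q (\<lambda>x. 0)"
| add: "bipoly p q P \<Longrightarrow> bipoly p q Q \<Longrightarrow> bipoly p q (\<lambda>x. P x + Q x)"

lemma C_inf_monomial: "C_inf (monomial a b c d)"
  unfolding monomial_def[abs_def] by (intro C_inf_intros)

lemma bipoly_C_inf: "bipoly p q P \<Longrightarrow> C_inf P"
  by (induction rule: bipoly.induct) (intro C_inf_intros C_inf_monomial; assumption)+

lemma bipoly_sum: "finite A \<Longrightarrow> (\<And>a. a \<in> A \<Longrightarrow> bipoly p q (P a)) \<Longrightarrow> bipoly p q (\<lambda>x. \<Sum>a\<in>A. P a x)"
  by (induction A rule: finite_induct) (auto intro: bipoly.zero bipoly.add)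

lemma bipoly_bihom: "bipoly p q P \<Longrightarrow> bihom p q P"
proof (induction rule: bipoly.induct)
  case (monomial a b p c d q k)
  define C where "C a' c' = (if a' = a then if c' = c then k else 0 else 0)" for a' c' :: nat
  have "k * monomial a b c d (z, w) =
      (\<Sum>a'\<le>p. \<Sum>c'\<le>q. C a' c' * z ^ a' * w ^ (p - a') * cnj z ^ c' * cnj w ^ (q - c'))" for z w
  proof -
    have "(\<Sum>a'\<le>p. \<Sum>c'\<le>q. C a' c' * z ^ a' * w ^ (p - a') * cnj z ^ c' * cnj w ^ (q - c'))
      = (\<Sum>a'\<le>p. \<Sum>c'\<le>q. if a' = a then if c' = c then k * z ^ a' * w ^ (p - a') * cnj z ^ c' * cnj w ^ (q - c') else 0 else 0)"
      by (intro sum.cong refl) (simp add: C_def)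
    also have "\<dots> = (\<Sum>a'\<le>p. if a' = a then \<Sum>c'\<le>q. if c' = c then k * z ^ a' * w ^ (p - a') * cnj z ^ c' * cnj w ^ (q - c') else 0 else 0)"
      by (intro sum.cong refl) simp
    also have "\<dots> = k * z ^ a * w ^ (p - a) * cnj z ^ c * cnj w ^ (q - c)"
      using monomial by (simp add: sum.delta)
    finally show ?thesis using monomial by (auto simp: monomial_def)
  qed
  then show ?case unfolding bihom_def by (intro exI[of _ C]) blast
next
  case (zero p q)
  show ?case unfolding bihom_def by (intro exI[of _ "\<lambda>a b. 0"]) simp
next
  case (add p q P Q)
  then obtain c d where "\<forall>z w. P (z, w) = (\<Sum>a\<le>p. \<Sum>b\<le>q. c a b * z ^ a * w ^ (p - a) * cnj z ^ b * cnj w ^ (q - b))"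
    "\<forall>z w. Q (z, w) = (\<Sum>a\<le>p. \<Sum>b\<le>q. d a b * z ^ a * w ^ (p - a) * cnj z ^ b * cnj w ^ (q - b))"
    unfolding bihom_def by blast
  then show ?case
    unfolding bihom_def by (intro exI[of _ "\<lambda>a b. c a b + d a b"]) (simp add: sum.distrib algebra_simps)
qed

lemma bihom_bipoly:
  assumes "bihom p q P" shows "bipoly p q P"
proof -
  obtain c where c: "\<And>z w. P (z, w) = (\<Sum>a\<le>p. \<Sum>b\<le>q. c a b * z ^ a * w ^ (p - a) * cnj z ^ b * cnj w ^ (q - b))"
    using assms unfolding bihom_def by blast
  have "P = (\<lambda>x. \<Sum>a\<le>p. \<Sum>b\<le>q. c a b * monomial a (p - a) b (q - b) x)"
  proof
    fix x show "P x = (\<Sum>a\<le>p. \<Sum>b\<le>q. c a b * monomial a (p - a) b (q - b) x)"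
      using c[of "fst x" "snd x"] by (simp add: monomial_def mult.assoc)
  qed
  moreover have "bipoly p q (\<lambda>x. \<Sum>a\<le>p. \<Sum>b\<le>q. c a b * monomial a (p - a) b (q - b) x)"
    by (intro bipoly_sum bipoly.monomial) auto
  ultimately show ?thesis by simp
qed

lemma bipoly_cmult: "bipoly p q P \<Longrightarrow> bipoly p q (\<lambda>x. c * P x)"
proof (induction rule: bipoly.induct)
  case (monomial a b p e d q k)
  then show ?case using bipoly.monomial[of a b p e d q "c * k"] by (simp add: mult.assoc)
qed (simp_all add: bipoly.zero bipoly.add distrib_left)

lemma bipoly_mult:
  assumes "bipoly p q P" "bipoly p' q' Q" shows "bipoly (p + p') (q + q') (\<lambda>x. P x * Q x)"
  using assms(1)
proof (induction rule: bipoly.induct)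
  case (monomial a b p c d q k)
  from assms(2) show ?case
  proof (induction rule: bipoly.induct)
    case (monomial a' b' p' c' d' q' k')
    have "bipoly (p + p') (q + q') (\<lambda>x. (k * k') * monomial (a + a') (b + b') (c + c') (d + d') x)"
      using \<open>a + b = p\<close> \<open>c + d = q\<close> monomial by (intro bipoly.monomial) auto
    then show ?case by (simp add: monomial_def[abs_def] power_add mult_ac)
  qed (simp_all add: bipoly.zero bipoly.add distrib_left)
qed (simp_all add: bipoly.zero bipoly.add distrib_right)

lemma bipoly_coord:
  "bipoly 1 0 fst" "bipoly 1 0 snd" "bipoly 0 1 (\<lambda>x. cnj (fst x))" "bipoly 0 1 (\<lambda>x. cnj (snd x))" "bipoly 0 0 (\<lambda>x. c)"
  using bipoly.monomial[of 1 0 1 0 0 0 1] bipoly.monomial[of 0 1 1 0 0 0 1]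
    bipoly.monomial[of 0 0 0 1 0 1 1] bipoly.monomial[of 0 0 0 0 1 1 1] bipoly.monomial[of 0 0 0 0 0 0 c]
  by (simp_all add: monomial_def[abs_def])

lemma bipoly_minus: "bipoly p q P \<Longrightarrow> bipoly p q (\<lambda>x. - P x)"
  using bipoly_cmult[of p q P "-1"] by simp

lemma bipoly_diff: "bipoly p q P \<Longrightarrow> bipoly p q Q \<Longrightarrow> bipoly p q (\<lambda>x. P x - Q x)"
  using bipoly.add[OF _ bipoly_minus] by simp

lemma wirtinger_monomial:
  "dz (monomial a b c d) = (\<lambda>x. of_nat a * monomial (a - 1) b c d x)"
  "dw (monomial a b c d) = (\<lambda>x. of_nat b * monomial a (b - 1) c d x)"
  "dzb (monomial a b c d) = (\<lambda>x. of_nat c * monomial a b (c - 1) d x)"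
  "dwb (monomial a b c d) = (\<lambda>x. of_nat d * monomial a b c (d - 1) x)"
  unfolding monomial_def[abs_def]
  by (simp_all add: wirtinger_mult wirtinger_power wirtinger_cnj wirtinger_coord C_inf_intros mult_ac)

text \<open>Truncated subtraction is harmless: in degree 0 the derivative is the zero function,
  which has every bidegree.\<close>

lemma bipoly_wirtinger:
  assumes "bipoly p q P"
  shows "bipoly (p - 1) q (dz P)" "bipoly (p - 1) q (dw P)" "bipoly p (q - 1) (dzb P)" "bipoly p (q - 1) (dwb P)"
proof -
  have "bipoly (p - 1) q (dz P) \<and> bipoly (p - 1) q (dw P) \<and> bipoly p (q - 1) (dzb P) \<and> bipoly p (q - 1) (dwb P)"
    using assms
  proof (induction rule: bipoly.induct)
    case (monomial a b p c d q k)
    have "bipoly (p - 1) q (\<lambda>x. (k * of_nat a) * monomial (a - 1) b c d x)"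
      using monomial bipoly.zero[of "p - 1" q] by (cases a) (auto intro: bipoly.monomial)
    moreover have "bipoly (p - 1) q (\<lambda>x. (k * of_nat b) * monomial a (b - 1) c d x)"
      using monomial bipoly.zero[of "p - 1" q] by (cases b) (auto intro: bipoly.monomial)
    moreover have "bipoly p (q - 1) (\<lambda>x. (k * of_nat c) * monomial a b (c - 1) d x)"
      using monomial bipoly.zero[of p "q - 1"] by (cases c) (auto intro: bipoly.monomial)
    moreover have "bipoly p (q - 1) (\<lambda>x. (k * of_nat d) * monomial a b c (d - 1) x)"
      using monomial bipoly.zero[of p "q - 1"] by (cases d) (auto intro: bipoly.monomial)
    ultimately show ?case
      by (simp add: wirtinger_mult C_inf_const C_inf_monomial wirtinger_const wirtinger_monomial mult.assoc)
  next
    case (add p q P Q)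
    then show ?case by (simp add: wirtinger_add bipoly_C_inf bipoly.add)
  qed (simp add: wirtinger_const bipoly.zero)
  then show "bipoly (p - 1) q (dz P)" "bipoly (p - 1) q (dw P)" "bipoly p (q - 1) (dzb P)" "bipoly p (q - 1) (dwb P)"
    by auto
qed

lemma bipoly_degree_0:
  assumes "bipoly p q P"
  shows "p = 0 \<Longrightarrow> dz P = (\<lambda>x. 0)" "p = 0 \<Longrightarrow> dw P = (\<lambda>x. 0)" "q = 0 \<Longrightarrow> dzb P = (\<lambda>x. 0)" "q = 0 \<Longrightarrow> dwb P = (\<lambda>x. 0)"
proof -
  have "(p = 0 \<longrightarrow> dz P = (\<lambda>x. 0) \<and> dw P = (\<lambda>x. 0)) \<and> (q = 0 \<longrightarrow> dzb P = (\<lambda>x. 0) \<and> dwb P = (\<lambda>x. 0))"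
    using assms
    by (induction rule: bipoly.induct)
      (auto simp: wirtinger_mult C_inf_const C_inf_monomial wirtinger_const wirtinger_monomial wirtinger_add bipoly_C_inf)
  then show "p = 0 \<Longrightarrow> dz P = (\<lambda>x. 0)" "p = 0 \<Longrightarrow> dw P = (\<lambda>x. 0)" "q = 0 \<Longrightarrow> dzb P = (\<lambda>x. 0)" "q = 0 \<Longrightarrow> dwb P = (\<lambda>x. 0)"
    by auto
qed

lemma bipoly_euler:
  assumes "bipoly p q P"
  shows "fst x * dz P x + snd x * dw P x = of_nat p * P x"
    "cnj (fst x) * dzb P x + cnj (snd x) * dwb P x = of_nat q * P x"
proof -
  have "fst x * dz P x + snd x * dw P x = of_nat p * P x \<and>
    cnj (fst x) * dzb P x + cnj (snd x) * dwb P x = of_nat q * P x"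
    using assms
  proof (induction rule: bipoly.induct)
    case (monomial a b p c d q k)
    have m: "fst x * (of_nat a * monomial (a - 1) b c d x) = of_nat a * monomial a b c d x"
      "snd x * (of_nat b * monomial a (b - 1) c d x) = of_nat b * monomial a b c d x"
      "cnj (fst x) * (of_nat c * monomial a b (c - 1) d x) = of_nat c * monomial a b c d x"
      "cnj (snd x) * (of_nat d * monomial a b c (d - 1) x) = of_nat d * monomial a b c d x"
      by (cases a, simp_all add: monomial_def, cases b, simp_all, cases c, simp_all, cases d, simp_all)
    have "fst x * (of_nat a * monomial (a - 1) b c d x) + snd x * (of_nat b * monomial a (b - 1) c d x) = of_nat p * monomial a b c d x"
      "cnj (fst x) * (of_nat c * monomial a b (c - 1) d x) + cnj (snd x) * (of_nat d * monomial a b c (d - 1) x) = of_nat q * monomial a b c d x"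
      unfolding m monomial.hyps[symmetric] of_nat_add distrib_right by (rule refl)+
    then have "k * (fst x * (of_nat a * monomial (a - 1) b c d x) + snd x * (of_nat b * monomial a (b - 1) c d x)) = k * (of_nat p * monomial a b c d x)"
      "k * (cnj (fst x) * (of_nat c * monomial a b (c - 1) d x) + cnj (snd x) * (of_nat d * monomial a b c (d - 1) x)) = k * (of_nat q * monomial a b c d x)"
      by simp_all
    then show ?case
      by (simp add: wirtinger_mult C_inf_const C_inf_monomial wirtinger_const wirtinger_monomial algebra_simps)
  next
    case (add p q P Q)
    then show ?case by (simp add: wirtinger_add bipoly_C_inf) (simp add: algebra_simps)
  qed (simp add: wirtinger_const)
  then show "fst x * dz P x + snd x * dw P x = of_nat p * P x"
    "cnj (fst x) * dzb P x + cnj (snd x) * dwb P x = of_nat q * P x" by auto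
qed

definition rsq :: cfun where
  "rsq x = fst x * cnj (fst x) + snd x * cnj (snd x)"

lemma C_inf_rsq: "C_inf rsq"
  unfolding rsq_def[abs_def] by (intro C_inf_intros)

lemma bipoly_rsq: "bipoly 1 1 rsq"
  unfolding rsq_def[abs_def]
  using bipoly.add[OF bipoly_mult[OF bipoly_coord(1,3)] bipoly_mult[OF bipoly_coord(2,4)]] by simp

text \<open>The cross terms of the product rule are the two Euler operators, worth p and q on a
  polynomial of bidegree (p, q); the remaining 2 is \<open>wlap rsq\<close>.\<close>

lemma wlap_rsq_mult:
  assumes P: "bipoly p q P"
  shows "wlap (\<lambda>x. rsq x * P x) x = rsq x * wlap P x + of_nat (p + q + 2) * P x"
proof -
  have C: "C_inf P" using P by (rule bipoly_C_inf)
  have r: "dz rsq = (\<lambda>x. cnj (fst x))" "dzb rsq = (\<lambda>x. fst x)" "dw rsq = (\<lambda>x. cnj (snd x))" "dwb rsq = (\<lambda>x. snd x)"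
    unfolding rsq_def[abs_def]
    by (simp_all add: wirtinger_add wirtinger_mult wirtinger_cnj wirtinger_coord C_inf_intros)
  have "wlap (\<lambda>x. rsq x * P x) x = rsq x * wlap P x + (fst x * dz P x + snd x * dw P x)
      + (cnj (fst x) * dzb P x + cnj (snd x) * dwb P x) + 2 * P x"
    unfolding wlap_def
    by (simp add: wirtinger_mult wirtinger_add wirtinger_coord r C C_inf_rsq C_inf_intros C_inf_wirtinger algebra_simps)
  then show ?thesis unfolding bipoly_euler[OF P] by (simp add: algebra_simps)
qed

text \<open>With \<open>S = (R - rsq * U) / c\<close> the equation for \<open>S\<close> becomes the same kind of equation for \<open>U\<close>,
  with right-hand side \<open>wlap R\<close> of lower degree.\<close>
lemma solve_rsq_wlap:
  fixes c :: real
  assumes "bipoly p q R" "c > 0"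
  shows "\<exists>S. bipoly p q S \<and> (\<forall>x. rsq x * wlap S x + of_real c * S x = R x)"
  using assms
proof (induction q arbitrary: p R c)
  case 0
  let ?S = "\<lambda>x. of_real (inverse c) * R x"
  have S: "bipoly p 0 ?S" by (rule bipoly_cmult[OF 0(1)])
  then show ?case
    using bipoly_degree_0[OF S] \<open>c > 0\<close>
    by (intro exI[of _ ?S]) (simp add: wlap_def wirtinger_const)
next
  case (Suc q)
  show ?case
  proof (cases p)
    case 0
    let ?S = "\<lambda>x. of_real (inverse c) * R x"
    have S: "bipoly 0 (Suc q) ?S" using bipoly_cmult[OF Suc.prems(1)] 0 by simp
    have "wlap ?S x = 0" for x
      unfolding wlap_def using bipoly_degree_0(1)[OF bipoly_wirtinger(3)[OF S]] bipoly_degree_0(2)[OF bipoly_wirtinger(4)[OF S]]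
      by simp
    then show ?thesis
      using S \<open>c > 0\<close> unfolding 0 by (intro exI[of _ ?S]) simp
  next
    case (Suc p')
    have R: "bipoly (Suc p') (Suc q) R" using Suc.prems(1) Suc by simp
    have "bipoly p' q (dz (dzb R))" "bipoly p' q (dw (dwb R))"
      using bipoly_wirtinger(1)[OF bipoly_wirtinger(3)[OF R]] bipoly_wirtinger(2)[OF bipoly_wirtinger(4)[OF R]] by simp_all
    then have "bipoly p' q (wlap R)" unfolding wlap_def by (rule bipoly.add)
    from Suc.IH[OF this, of "c + real (p' + q + 2)"] Suc.prems(2)
    obtain U where U: "bipoly p' q U"
      and eq: "\<And>x. rsq x * wlap U x + of_real (c + real (p' + q + 2)) * U x = wlap R x"
      by force
    let ?S = "\<lambda>x. of_real (inverse c) * (R x - rsq x * U x)"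
    have rU: "bipoly (Suc p') (Suc q) (\<lambda>x. rsq x * U x)" using bipoly_mult[OF bipoly_rsq U] by simp
    have S: "bipoly (Suc p') (Suc q) ?S" by (intro bipoly_cmult bipoly_diff R rU)
    have "wlap ?S x = of_real (inverse c) * (wlap R x - wlap (\<lambda>x. rsq x * U x) x)" for x
      using bipoly_C_inf[OF R] bipoly_C_inf[OF rU]
      by (intro wlap_cmult_diff)
    then have "rsq x * wlap ?S x + of_real c * ?S x = R x" for x
      unfolding wlap_rsq_mult[OF U] eq[symmetric] using \<open>c > 0\<close>
      by (simp add: algebra_simps)
    then show ?thesis using S unfolding Suc by blast
  qed
qed

text \<open>P - rsq * S is harmonic exactly when wlap (rsq * S) = wlap P. By the product formula
  this is the equation solved above with c = p + q + 2.\<close>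

lemma harmonic_decomposition:
  assumes P: "bipoly (Suc p) (Suc q) P"
  obtains H S where "Hpq (Suc p) (Suc q) H" "bipoly p q S" "\<And>x. P x = H x + rsq x * S x"
proof -
  have "bipoly p q (dz (dzb P))" "bipoly p q (dw (dwb P))"
    using bipoly_wirtinger(1)[OF bipoly_wirtinger(3)[OF P]] bipoly_wirtinger(2)[OF bipoly_wirtinger(4)[OF P]] by simp_all
  then have "bipoly p q (wlap P)" unfolding wlap_def by (rule bipoly.add)
  from solve_rsq_wlap[OF this, of "real (p + q + 2)"]
  obtain S where S: "bipoly p q S" and eq: "\<And>x. rsq x * wlap S x + of_real (real (p + q + 2)) * S x = wlap P x"
    by auto
  have rS: "bipoly (Suc p) (Suc q) (\<lambda>x. rsq x * S x)" using bipoly_mult[OF bipoly_rsq S] by simp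
  define H where "H x = P x - rsq x * S x" for x
  have H: "bipoly (Suc p) (Suc q) H" unfolding H_def[abs_def] by (intro bipoly_diff P rS)
  have "wlap H x = wlap P x - wlap (\<lambda>x. rsq x * S x) x" for x
    using bipoly_C_inf[OF P] bipoly_C_inf[OF rS]
    by (simp add: H_def[abs_def] wlap_def wirtinger_diff C_inf_wirtinger)
  then have "wlap H x = 0" for x
    unfolding wlap_rsq_mult[OF S] eq[symmetric] by simp
  then have "Hpq (Suc p) (Suc q) H"
    unfolding Hpq_def using bipoly_bihom[OF H] laplacian_eq[OF bipoly_C_inf[OF H]] by simp
  then show thesis by (rule that[OF _ S]) (simp add: H_def)
qed

lemma bipoly_harmonic:
  assumes "bipoly p q P" "p = 0 \<or> q = 0" shows "Hpq p q P"
proof -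
  have "wlap P x = 0" for x
    using assms(2)
  proof
    assume p: "p = 0"
    show ?thesis unfolding wlap_def
      using bipoly_degree_0(1)[OF bipoly_wirtinger(3)[OF assms(1)] p] bipoly_degree_0(2)[OF bipoly_wirtinger(4)[OF assms(1)] p] by simp
  next
    assume "q = 0"
    then show ?thesis unfolding wlap_def
      using bipoly_degree_0(3,4)[OF assms(1)] by (simp add: wirtinger_const)
  qed
  then show ?thesis
    unfolding Hpq_def using bipoly_bihom[OF assms(1)] laplacian_eq[OF bipoly_C_inf[OF assms(1)]] by simp
qed

lemma Hpq_bipoly: "Hpq p q P \<Longrightarrow> bipoly p q P"
  unfolding Hpq_def by (blast intro: bihom_bipoly)

text \<open>\<open>Z1\<close> commutes with the flat Laplacian: its coefficients are
  antiholomorphic, and the extra mixed terms cancel by symmetry of second derivatives. For p = 0 the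
  result is the zero function, so the truncated degree does no harm.\<close>

lemma Hpq_Z1:
  assumes "Hpq p q P" shows "Hpq (p - 1) (q + 1) (Z1 P)"
proof -
  have P: "bipoly p q P" using assms by (rule Hpq_bipoly)
  have C: "C_inf P" using P by (rule bipoly_C_inf)
  have Z: "Z1 P = (\<lambda>p. cnj (snd p) * dz P p - cnj (fst p) * dw P p)" by (rule vector_fields_C_inf(1)[OF C])
  have ZP: "bipoly (p - 1) (q + 1) (Z1 P)"
    unfolding Z using bipoly_diff[OF bipoly_mult[OF bipoly_coord(4) bipoly_wirtinger(1)[OF P]]
      bipoly_mult[OF bipoly_coord(3) bipoly_wirtinger(2)[OF P]]] by simp
  have "wlap P = (\<lambda>x. 0)"
    using assms laplacian_eq[OF C] by (simp add: Hpq_def fun_eq_iff)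
  then have "dz (wlap P) = (\<lambda>x. 0)" "dw (wlap P) = (\<lambda>x. 0)" by (simp_all add: wirtinger_const)
  moreover have "wlap (Z1 P) x = cnj (snd x) * dz (wlap P) x - cnj (fst x) * dw (wlap P) x" for x
    unfolding Z wlap_def
    by (simp add: wirtinger_mult wirtinger_diff wirtinger_add wirtinger_cnj wirtinger_coord C_inf_intros C C_inf_wirtinger
      wirtinger_commute wirtinger_const algebra_simps)
  ultimately have "wlap (Z1 P) x = 0" for x by simp
  then show ?thesis
    unfolding Hpq_def using bipoly_bihom[OF ZP] laplacian_eq[OF bipoly_C_inf[OF ZP]] by simp
qed

text \<open>On the sphere \<open>rsq\<close> equals 1, so the harmonic decomposition writes P there
  as a harmonic plus a polynomial of smaller bidegree, to which the induction on q applies.\<close>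

lemma orthogonal_bipoly:
  assumes \<psi>: "continuous_on S3 \<psi>"
    and H: "\<And>p q P. Hpq p q P \<Longrightarrow> sphere_integral (\<lambda>x. \<psi> x * cnj (P x)) = 0"
  shows "bipoly p q P \<Longrightarrow> sphere_integral (\<lambda>x. \<psi> x * cnj (P x)) = 0"
proof (induction q arbitrary: p P)
  case 0
  then show ?case by (intro H bipoly_harmonic) auto
next
  case (Suc q)
  show ?case
  proof (cases p)
    case 0
    then show ?thesis using Suc by (intro H bipoly_harmonic) auto
  next
    case (Suc p')
    then obtain K S where K: "Hpq (Suc p') (Suc q) K" "bipoly p' q S" "\<And>x. P x = K x + rsq x * S x"
      using harmonic_decomposition[of p' q P] Suc.prems by blast
    have "rsq x = 1" if "x \<in> S3" for x using that by (simp add: rsq_def S3_iff)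
    then have "sphere_integral (\<lambda>x. \<psi> x * cnj (P x)) = sphere_integral (\<lambda>x. \<psi> x * cnj (K x) + \<psi> x * cnj (S x))"
      by (intro sphere_integral_cong) (simp add: K(3) algebra_simps)
    also have "\<dots> = sphere_integral (\<lambda>x. \<psi> x * cnj (K x)) + sphere_integral (\<lambda>x. \<psi> x * cnj (S x))"
      using bipoly_C_inf[OF Hpq_bipoly[OF K(1)]] bipoly_C_inf[OF K(2)]
      by (intro sphere_integral_add continuous_intros \<psi> C_inf_continuous_on)
    finally show ?thesis using H[OF K(1)] Suc.IH[OF K(2)] by simp
  qed
qed

inductive poly_fun :: "cfun \<Rightarrow> bool" where
  bipoly: "bipoly p q P \<Longrightarrow> poly_fun P"
| add: "poly_fun P \<Longrightarrow> poly_fun Q \<Longrightarrow> poly_fun (\<lambda>x. P x + Q x)"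

lemma poly_fun_mult:
  assumes "poly_fun P" "poly_fun Q" shows "poly_fun (\<lambda>x. P x * Q x)"
  using assms(1)
proof (induction rule: poly_fun.induct)
  case (bipoly p q P)
  from assms(2) show ?case
    by (induction rule: poly_fun.induct)
      (simp_all add: poly_fun.bipoly[OF bipoly_mult[OF bipoly]] poly_fun.add distrib_left)
qed (simp add: poly_fun.add distrib_right)

lemma poly_fun_const: "poly_fun (\<lambda>x. c)"
  by (rule poly_fun.bipoly[OF bipoly_coord(5)])

lemma poly_fun_C_inf: "poly_fun P \<Longrightarrow> C_inf P"
  by (induction rule: poly_fun.induct) (auto intro: bipoly_C_inf C_inf_add)

text \<open>Links the polynomials of the Stone-Weierstrass theorem to bihomogeneous ones. The linear
  case carries the content: real coordinates are combinations of z, w and their conjugates.\<close>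

lemma real_polynomial_poly_fun:
  "real_polynomial_function g \<Longrightarrow> poly_fun (\<lambda>x. of_real (g x))"
proof (induction rule: real_polynomial_function.induct)
  case (linear g)
  then interpret bounded_linear g .
  define c1 :: complex where "c1 = of_real (g (1, 0))"
  define c2 :: complex where "c2 = of_real (g (\<i>, 0))"
  define c3 :: complex where "c3 = of_real (g (0, 1))"
  define c4 :: complex where "c4 = of_real (g (0, \<i>))"
  have eq: "complex_of_real (g x) = (c1 / 2) * fst x + (c1 / 2) * cnj (fst x)
      + ((- \<i> * c2 / 2) * fst x + (\<i> * c2 / 2) * cnj (fst x))
      + ((c3 / 2) * snd x + (c3 / 2) * cnj (snd x))
      + ((- \<i> * c4 / 2) * snd x + (\<i> * c4 / 2) * cnj (snd x))" for x
  proof -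
    have "x = Re (fst x) *\<^sub>R (1, 0) + Im (fst x) *\<^sub>R (\<i>, 0) + (Re (snd x) *\<^sub>R (0, 1) + Im (snd x) *\<^sub>R (0, \<i>))"
      by (simp add: prod_eq_iff complex_eq_iff)
    then have "g x = Re (fst x) * g (1, 0) + Im (fst x) * g (\<i>, 0) + (Re (snd x) * g (0, 1) + Im (snd x) * g (0, \<i>))"
      by (metis add scaleR real_scaleR_def)
    then show ?thesis by (simp add: c1_def c2_def c3_def c4_def complex_eq_iff field_simps)
  qed
  show ?case
    unfolding eq by (intro poly_fun.add poly_fun.bipoly[OF bipoly_cmult[OF bipoly_coord(1)]]
      poly_fun.bipoly[OF bipoly_cmult[OF bipoly_coord(2)]] poly_fun.bipoly[OF bipoly_cmult[OF bipoly_coord(3)]]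
      poly_fun.bipoly[OF bipoly_cmult[OF bipoly_coord(4)]])
qed (simp_all add: poly_fun_const poly_fun.add poly_fun_mult)

text \<open>Completeness of the harmonics. For a polynomial G uniformly close to \<psi>,
  orthogonality to G turns the squared norm of \<psi> into the pairing of \<psi> with \<psi> - G,
  which is arbitrarily small.\<close>

lemma orthogonal_harmonics_imp_0:
  assumes \<psi>: "continuous_on S3 \<psi>"
    and H: "\<And>p q P. Hpq p q P \<Longrightarrow> sphere_integral (\<lambda>x. \<psi> x * cnj (P x)) = 0"
    and x: "x \<in> S3"
  shows "\<psi> x = 0"
proof -
  have ortho: "sphere_integral (\<lambda>x. \<psi> x * cnj (P x)) = 0" if "poly_fun P" for P
    using that
  proof (induction rule: poly_fun.induct)
    case (add P Q)
    have "sphere_integral (\<lambda>x. \<psi> x * cnj (P x) + \<psi> x * cnj (Q x)) =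
        sphere_integral (\<lambda>x. \<psi> x * cnj (P x)) + sphere_integral (\<lambda>x. \<psi> x * cnj (Q x))"
      using add.hyps by (intro sphere_integral_add continuous_intros \<psi> C_inf_continuous_on poly_fun_C_inf)
    then show ?case using add.IH by (simp add: distrib_left)
  qed (rule orthogonal_bipoly[OF \<psi> H])
  obtain B where B: "B > 0" "\<And>p. p \<in> S3 \<Longrightarrow> cmod (\<psi> p) \<le> B" using S3_continuous_bounded[OF \<psi>] by blast
  have cont: "continuous_on S3 (\<lambda>x. \<psi> x * cnj (\<psi> x))" by (intro continuous_intros \<psi>)
  have small: "cmod (sphere_integral (\<lambda>x. \<psi> x * cnj (\<psi> x))) \<le> (2 * B * punctured_volume) * e" if e: "e > 0" for e
  proof -
    have S3: "compact S3" unfolding S3_sphere by (rule compact_sphere)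
    obtain g1 where g1: "real_polynomial_function g1" "\<And>x. x \<in> S3 \<Longrightarrow> \<bar>Re (\<psi> x) - g1 x\<bar> < e"
      using Stone_Weierstrass_real_polynomial_function[OF S3 continuous_on_Re[OF \<psi>] e] by blast
    obtain g2 where g2: "real_polynomial_function g2" "\<And>x. x \<in> S3 \<Longrightarrow> \<bar>Im (\<psi> x) - g2 x\<bar> < e"
      using Stone_Weierstrass_real_polynomial_function[OF S3 continuous_on_Im[OF \<psi>] e] by blast
    define G where "G x = of_real (g1 x) + \<i> * of_real (g2 x)" for x
    have G: "poly_fun G"
      unfolding G_def[abs_def] by (intro poly_fun.add poly_fun_mult poly_fun_const real_polynomial_poly_fun g1 g2)
    have contG: "continuous_on S3 G" by (intro C_inf_continuous_on poly_fun_C_inf G)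
    have "cmod (\<psi> x - G x) \<le> 2 * e" if "x \<in> S3" for x
    proof -
      have "cmod (\<psi> x - G x) \<le> \<bar>Re (\<psi> x - G x)\<bar> + \<bar>Im (\<psi> x - G x)\<bar>" by (rule cmod_le)
      then show ?thesis using g1(2)[OF that] g2(2)[OF that] by (simp add: G_def)
    qed
    then have "cmod (\<psi> x * cnj (\<psi> x - G x)) \<le> B * (2 * e)" if "x \<in> S3" for x
      unfolding norm_mult complex_mod_cnj using that B by (intro mult_mono) auto
    moreover have "continuous_on S3 (\<lambda>x. \<psi> x * cnj (\<psi> x - G x))" by (intro continuous_intros \<psi> contG)
    ultimately have "cmod (sphere_integral (\<lambda>x. \<psi> x * cnj (\<psi> x - G x))) \<le> B * (2 * e) * punctured_volume"
      by (intro sphere_integral_bound)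
    moreover have "sphere_integral (\<lambda>x. \<psi> x * cnj (\<psi> x) - \<psi> x * cnj (G x)) = sphere_integral (\<lambda>x. \<psi> x * cnj (\<psi> x)) - 0"
      unfolding ortho[OF G, symmetric] by (intro sphere_integral_diff continuous_intros \<psi> contG)
    ultimately show ?thesis by (simp add: algebra_simps)
  qed
  have "cmod (sphere_integral (\<lambda>x. \<psi> x * cnj (\<psi> x))) \<le> 0"
  proof (rule field_le_epsilon)
    fix e :: real assume e: "e > 0"
    \<comment> \<open>The added 1 makes C positive, hence a legitimate divisor, without knowing the
      sign or nonvanishing of the volume factor.\<close>
    define C where "C = \<bar>2 * B * punctured_volume\<bar> + 1"
    have "C > 0" by (simp add: C_def)
    have "cmod (sphere_integral (\<lambda>x. \<psi> x * cnj (\<psi> x))) \<le> (2 * B * punctured_volume) * (e / C)"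
      using e \<open>C > 0\<close> by (intro small) simp
    also have "\<dots> \<le> C * (e / C)"
      using e \<open>C > 0\<close> by (intro mult_right_mono) (auto simp: C_def)
    finally show "cmod (sphere_integral (\<lambda>x. \<psi> x * cnj (\<psi> x))) \<le> 0 + e" using \<open>C > 0\<close> by simp
  qed
  then have "\<psi> x * cnj (\<psi> x) = 0"
    by (intro sphere_integral_eq_0_imp[OF cont _ _ x]) (simp_all add: complex_norm_square[symmetric] complex_nonneg_Reals_iff)
  then show ?thesis by simp
qed

lemma sphere_integral_by_parts:
  assumes "S3_smooth f" "S3_smooth g"
  shows "sphere_integral (\<lambda>p. Z1b f p * cnj (g p)) = - sphere_integral (\<lambda>p. f p * cnj (Z1 g p))"
    "sphere_integral (\<lambda>p. Z1 f p * cnj (g p)) = - sphere_integral (\<lambda>p. f p * cnj (Z1b g p))"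
proof -
  note cont = S3_smooth_continuous[OF assms(1)] S3_smooth_continuous[OF assms(2)]
    S3_smooth_continuous[OF derivation_smooth[OF derivation_Z1 assms(1)]] S3_smooth_continuous[OF derivation_smooth[OF derivation_Z1 assms(2)]]
    S3_smooth_continuous[OF derivation_smooth[OF derivation_Z1b assms(1)]] S3_smooth_continuous[OF derivation_smooth[OF derivation_Z1b assms(2)]]
  have fg: "S3_smooth (\<lambda>p. f p * cnj (g p))" by (intro S3_smooth_mult S3_smooth_cnj assms)
  have "sphere_integral (\<lambda>p. Z1b f p * cnj (g p) + f p * cnj (Z1 g p)) = sphere_integral (Z1b (\<lambda>p. f p * cnj (g p)))"
    by (rule sphere_integral_cong)
      (simp add: derivation_mult[OF derivation_Z1b] S3_smooth_cnj vector_fields_cnj assms)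
  then show "sphere_integral (\<lambda>p. Z1b f p * cnj (g p)) = - sphere_integral (\<lambda>p. f p * cnj (Z1 g p))"
    unfolding sphere_integral_Z(2)[OF fg]
    by (subst (asm) sphere_integral_add) (auto intro!: continuous_intros cont simp: eq_neg_iff_add_eq_0)
  have "sphere_integral (\<lambda>p. Z1 f p * cnj (g p) + f p * cnj (Z1b g p)) = sphere_integral (Z1 (\<lambda>p. f p * cnj (g p)))"
    by (rule sphere_integral_cong)
      (simp add: derivation_mult[OF derivation_Z1] S3_smooth_cnj vector_fields_cnj assms)
  then show "sphere_integral (\<lambda>p. Z1 f p * cnj (g p)) = - sphere_integral (\<lambda>p. f p * cnj (Z1b g p))"
    unfolding sphere_integral_Z(1)[OF fg]
    by (subst (asm) sphere_integral_add) (auto intro!: continuous_intros cont simp: eq_neg_iff_add_eq_0)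
qed

text \<open>Two integrations by parts move both \<open>Z1b\<close> onto the test harmonic as
  \<open>Z1\<close>. They raise its second degree q to q + 2, precisely the range in which the slice
  condition asserts orthogonality.\<close>

lemma D0perp_Z1b_Z1b:
  assumes "D0perp \<phi>" "p \<in> S3"
  shows "Z1b (Z1b \<phi>) p = 0"
proof -
  have \<phi>: "S3_smooth \<phi>" and ortho: "\<And>p q P. 2 \<le> q \<Longrightarrow> Hpq p q P \<Longrightarrow> S3_inner \<phi> P = 0"
    using assms(1) unfolding D0perp_def by blast+
  show ?thesis
  proof (rule orthogonal_harmonics_imp_0[OF _ _ assms(2)])
    show "continuous_on S3 (Z1b (Z1b \<phi>))"
      by (intro S3_smooth_continuous derivation_smooth[OF derivation_Z1b] \<phi>)
  next
    fix p q P assume P: "Hpq p q P"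
    have sP: "S3_smooth P" by (rule S3_smooth_C_inf[OF bipoly_C_inf[OF Hpq_bipoly[OF P]]])
    have "sphere_integral (\<lambda>x. Z1b (Z1b \<phi>) x * cnj (P x)) = sphere_integral (\<lambda>x. \<phi> x * cnj (Z1 (Z1 P) x))"
      by (simp add: sphere_integral_by_parts \<phi> sP derivation_smooth[OF derivation_Z1b] derivation_smooth[OF derivation_Z1])
    also have "\<dots> = 0"
      using ortho[OF _ Hpq_Z1[OF Hpq_Z1[OF P]]] by (simp add: S3_inner_sphere_integral)
    finally show "sphere_integral (\<lambda>x. Z1b (Z1b \<phi>) x * cnj (P x)) = 0" .
  qed
qed

section \<open>Positivity and the second order obstruction\<close>

lemma S3_inner_cong:
  assumes "\<And>p. p \<in> S3 \<Longrightarrow> f p = f' p" "\<And>p. p \<in> S3 \<Longrightarrow> g p = g' p"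
  shows "S3_inner f g = S3_inner f' g'"
  unfolding S3_inner_sphere_integral by (rule sphere_integral_cong) (simp add: assms)

lemma S3_inner_cnj: "cnj (S3_inner f g) = S3_inner g f"
  unfolding S3_inner_sphere_integral sphere_integral_cnj[symmetric] by (simp add: mult.commute)

lemma S3_inner_add_left:
  assumes "S3_smooth f" "S3_smooth g" "S3_smooth h"
  shows "S3_inner (\<lambda>p. f p + g p) h = S3_inner f h + S3_inner g h"
  unfolding S3_inner_sphere_integral distrib_right
  by (intro sphere_integral_add continuous_intros S3_smooth_continuous assms)

lemma S3_inner_cmult_left: "S3_inner (\<lambda>p. c * f p) h = c * S3_inner f h"
  unfolding S3_inner_sphere_integral mult.assoc by (rule sphere_integral_cmult)

lemma S3_inner_diff_left:
  assumes "S3_smooth f" "S3_smooth g" "S3_smooth h"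
  shows "S3_inner (\<lambda>p. f p - g p) h = S3_inner f h - S3_inner g h"
  unfolding S3_inner_sphere_integral left_diff_distrib
  by (intro sphere_integral_diff continuous_intros S3_smooth_continuous assms)

lemma S3_inner_add_right:
  assumes "S3_smooth f" "S3_smooth g" "S3_smooth h"
  shows "S3_inner h (\<lambda>p. f p + g p) = S3_inner h f + S3_inner h g"
  using S3_inner_add_left[OF assms] by (metis S3_inner_cnj complex_cnj_add)

lemma S3_inner_cmult_right: "S3_inner h (\<lambda>p. c * f p) = cnj c * S3_inner h f"
  using S3_inner_cmult_left[of c f h] by (metis S3_inner_cnj complex_cnj_mult)

lemma S3_inner_diff_right:
  assumes "S3_smooth f" "S3_smooth g" "S3_smooth h"
  shows "S3_inner h (\<lambda>p. f p - g p) = S3_inner h f - S3_inner h g"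
  using S3_inner_diff_left[OF assms] by (metis S3_inner_cnj complex_cnj_diff)

lemma S3_inner_self:
  assumes "S3_smooth f"
  shows "\<exists>r\<ge>0. S3_inner f f = complex_of_real r \<and> (r = 0 \<longrightarrow> (\<forall>p\<in>S3. f p = 0))"
proof -
  define g where "g p = (cmod (f p))\<^sup>2" for p
  have ff: "f x * cnj (f x) = of_real (g x)" for x by (simp only: complex_norm_square g_def)
  have cont: "continuous_on S3 f" by (rule S3_smooth_continuous[OF assms])
  have "continuous_on S3 g" unfolding g_def by (intro continuous_intros cont)
  from integral_linear[OF normalize_integrable'[OF this] bounded_linear_of_real[where 'a=complex]]
  have eq: "S3_inner f f = of_real (integral punctured_ball (\<lambda>x. g (inverse (norm x) *\<^sub>R x)))"
    unfolding S3_inner_sphere_integral sphere_integral_punctured ff by (simp add: o_def)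
  show ?thesis
  proof (intro exI conjI impI)
    show "S3_inner f f = of_real (integral punctured_ball (\<lambda>x. g (inverse (norm x) *\<^sub>R x)))" by (rule eq)
    show "integral punctured_ball (\<lambda>x. g (inverse (norm x) *\<^sub>R x)) \<ge> 0"
      by (cases "(\<lambda>x. g (inverse (norm x) *\<^sub>R x)) integrable_on punctured_ball")
        (auto intro!: integral_nonneg simp: not_integrable_integral g_def)
    assume 0: "integral punctured_ball (\<lambda>x. g (inverse (norm x) *\<^sub>R x)) = 0"
    show "\<forall>p\<in>S3. f p = 0"
    proof
      fix p assume p: "p \<in> S3"
      have "f p * cnj (f p) = 0"
      proof (rule sphere_integral_eq_0_imp[where f="\<lambda>p. f p * cnj (f p)", OF _ _ _ p])
        show "continuous_on S3 (\<lambda>p. f p * cnj (f p))" by (intro continuous_intros cont)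
        show "f p * cnj (f p) \<in> \<real>\<^sub>\<ge>\<^sub>0" for p unfolding ff by (simp add: g_def)
        show "sphere_integral (\<lambda>p. f p * cnj (f p)) = 0"
          using eq 0 by (simp add: S3_inner_sphere_integral)
      qed
      then show "f p = 0" by simp
    qed
  qed
qed

text \<open>Since the adjoint of \<open>Z1b\<close> is - \<open>Z1\<close> for the sphere pairing,
  \<open>Nop\<close> and \<open>Mop\<close> are the nonnegative operators W*W and Z*Z. They replace
  the harmonic decomposition in what follows.\<close>

definition Nop :: vfield where "Nop f = (\<lambda>p. - Z1 (Z1b f) p)"
definition Mop :: vfield where "Mop f = (\<lambda>p. - Z1b (Z1 f) p)"

lemma S3_smooth_ops:
  assumes "S3_smooth f" shows "S3_smooth (Z1 f)" "S3_smooth (Z1b f)" "S3_smooth (Tvf f)" "S3_smooth (Nop f)" "S3_smooth (Mop f)"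
  unfolding Nop_def Mop_def
  by (intro S3_smooth_minus derivation_smooth[OF derivation_Z1] derivation_smooth[OF derivation_Z1b] derivation_smooth[OF derivation_Tvf] assms)+

lemma S3_inner_Nop: assumes "S3_smooth f" "S3_smooth g" shows "S3_inner (Nop f) g = S3_inner (Z1b f) (Z1b g)"
  unfolding S3_inner_sphere_integral Nop_def
  using sphere_integral_by_parts(2)[OF S3_smooth_ops(2)[OF assms(1)] assms(2)] by (simp add: sphere_integral_minus)

lemma S3_inner_Mop: assumes "S3_smooth f" "S3_smooth g" shows "S3_inner (Mop f) g = S3_inner (Z1 f) (Z1 g)"
  unfolding S3_inner_sphere_integral Mop_def
  using sphere_integral_by_parts(1)[OF S3_smooth_ops(1)[OF assms(1)] assms(2)] by (simp add: sphere_integral_minus)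

lemma S3_inner_Nop_adjoint: "S3_smooth f \<Longrightarrow> S3_smooth g \<Longrightarrow> S3_inner (Nop f) g = S3_inner f (Nop g)"
  using S3_inner_Nop[of f g] S3_inner_Nop[of g f] by (metis S3_inner_cnj)

lemma S3_inner_Mop_adjoint: "S3_smooth f \<Longrightarrow> S3_smooth g \<Longrightarrow> S3_inner (Mop f) g = S3_inner f (Mop g)"
  using S3_inner_Mop[of f g] S3_inner_Mop[of g f] by (metis S3_inner_cnj)

lemma ops_linear:
  assumes "S3_smooth f" "S3_smooth g" "p \<in> S3"
  shows "Nop (\<lambda>q. f q + g q) p = Nop f p + Nop g p" "Nop (\<lambda>q. f q - g q) p = Nop f p - Nop g p" "Nop (\<lambda>q. c * f q) p = c * Nop f p"
    "Mop (\<lambda>q. f q + g q) p = Mop f p + Mop g p" "Mop (\<lambda>q. f q - g q) p = Mop f p - Mop g p" "Mop (\<lambda>q. c * f q) p = c * Mop f p"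
proof -
  have lin: "V (W (\<lambda>q. f q + g q)) p = V (W f) p + V (W g) p" "V (W (\<lambda>q. f q - g q)) p = V (W f) p - V (W g) p"
    "V (W (\<lambda>q. c * f q)) p = c * V (W f) p" if V: "derivation V" and W: "derivation W" for V W
  proof -
    have "V (W (\<lambda>q. f q + g q)) p = V (\<lambda>q. W f q + W g q) p"
      by (rule derivation_cong[OF V _ assms(3)]) (rule derivation_add[OF W assms(1,2)])
    then show "V (W (\<lambda>q. f q + g q)) p = V (W f) p + V (W g) p"
      using derivation_add[OF V derivation_smooth[OF W assms(1)] derivation_smooth[OF W assms(2)] assms(3)] by simp
    have "V (W (\<lambda>q. f q - g q)) p = V (\<lambda>q. W f q - W g q) p"
      by (rule derivation_cong[OF V _ assms(3)]) (rule derivation_diff[OF W assms(1,2)])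
    then show "V (W (\<lambda>q. f q - g q)) p = V (W f) p - V (W g) p"
      using derivation_diff[OF V derivation_smooth[OF W assms(1)] derivation_smooth[OF W assms(2)] assms(3)] by simp
    have "V (W (\<lambda>q. c * f q)) p = V (\<lambda>q. c * W f q) p"
      by (rule derivation_cong[OF V _ assms(3)]) (simp add: derivation_mult[OF W S3_smooth_const assms(1)] derivation_const[OF W])
    then show "V (W (\<lambda>q. c * f q)) p = c * V (W f) p"
      using derivation_mult[OF V S3_smooth_const derivation_smooth[OF W assms(1)] assms(3), of c] derivation_const[OF V assms(3)] by simp
  qed
  note ZW = lin[OF derivation_Z1 derivation_Z1b] and WZ = lin[OF derivation_Z1b derivation_Z1]
  show "Nop (\<lambda>q. f q + g q) p = Nop f p + Nop g p" "Nop (\<lambda>q. f q - g q) p = Nop f p - Nop g p" "Nop (\<lambda>q. c * f q) p = c * Nop f p"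
    "Mop (\<lambda>q. f q + g q) p = Mop f p + Mop g p" "Mop (\<lambda>q. f q - g q) p = Mop f p - Mop g p" "Mop (\<lambda>q. c * f q) p = c * Mop f p"
    unfolding Nop_def Mop_def ZW WZ by simp_all
qed

lemma Tvf_ops: "S3_smooth f \<Longrightarrow> p \<in> S3 \<Longrightarrow> Tvf f p = \<i> * (Mop f p - Nop f p)"
  using arg_cong[OF commutators(1)[of f p], of "(*) \<i>"] by (simp add: Nop_def Mop_def algebra_simps)

lemma ops_cong:
  assumes "\<And>q. q \<in> S3 \<Longrightarrow> f q = g q" "p \<in> S3" shows "Nop f p = Nop g p" "Mop f p = Mop g p"
  unfolding Nop_def Mop_def using assms(2)
  by (simp_all add: derivation_cong[OF derivation_Z1 derivation_cong[OF derivation_Z1b assms(1)]]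
    derivation_cong[OF derivation_Z1b derivation_cong[OF derivation_Z1 assms(1)]])

text \<open>The T-weights of \<open>Z1\<close> and \<open>Z1b\<close> are opposite, so
  \<open>Tvf\<close> commutes with \<open>Nop\<close>. As \<open>Tvf\<close> is i (M - N),
  commutation with M follows.\<close>

lemma Mop_Nop_commute:
  assumes f: "S3_smooth f" and p: "p \<in> S3" shows "Mop (Nop f) p = Nop (Mop f) p"
proof -
  note sm = S3_smooth_ops[OF f]
  have "Tvf (Nop f) p = Nop (Tvf f) p"
  proof -
    have "Tvf (Nop f) p = - Tvf (Z1 (Z1b f)) p"
      unfolding Nop_def by (rule derivation_minus[OF derivation_Tvf S3_smooth_ops(1)[OF sm(2)] p])
    also have "\<dots> = - (Z1 (Tvf (Z1b f)) p - 2 * \<i> * Z1 (Z1b f) p)"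
      using commutators(2)[OF sm(2) p] by (simp add: algebra_simps)
    also have "Z1 (Tvf (Z1b f)) p = Z1 (\<lambda>q. Z1b (Tvf f) q + 2 * \<i> * Z1b f q) p"
      using commutators(3)[OF f] by (intro derivation_cong[OF derivation_Z1 _ p]) (simp add: algebra_simps)
    also have "\<dots> = Z1 (Z1b (Tvf f)) p + 2 * \<i> * Z1 (Z1b f) p"
      by (simp add: derivation_add[OF derivation_Z1] derivation_mult[OF derivation_Z1] derivation_const[OF derivation_Z1]
        S3_smooth_mult S3_smooth_const sm S3_smooth_ops[OF sm(3)] p)
    finally show ?thesis by (simp add: Nop_def)
  qed
  moreover have "Nop (Tvf f) p = Nop (\<lambda>q. \<i> * (Mop f q - Nop f q)) p"
    by (rule ops_cong(1)[OF _ p]) (rule Tvf_ops[OF f])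
  moreover have "\<dots> = \<i> * (Nop (Mop f) p - Nop (Nop f) p)"
    using ops_linear(3)[OF S3_smooth_diff[OF sm(5,4)] S3_smooth_const p] ops_linear(2)[OF sm(5,4) p] by simp
  moreover have "Tvf (Nop f) p = \<i> * (Mop (Nop f) p - Nop (Nop f) p)" by (rule Tvf_ops[OF sm(4) p])
  ultimately show ?thesis by simp
qed

text \<open>The operator form of q = 0 or q = 1. As W f is killed by W, the product W Z acts on it
  as iT; commuting T past W yields W M f = 2 W N f - 2 W f, and applying -Z gives the claim.\<close>

lemma Nop_Mop:
  assumes f: "S3_smooth f" and WW: "\<And>q. q \<in> S3 \<Longrightarrow> Z1b (Z1b f) q = 0" and p: "p \<in> S3"
  shows "Nop (Mop f) p = 2 * Nop (Nop f) p - 2 * Nop f p"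
proof -
  note sm = S3_smooth_ops[OF f]
  have ZWW: "Z1 (Z1b (Z1b f)) q = 0" if "q \<in> S3" for q
    using derivation_cong[OF derivation_Z1, of "Z1b (Z1b f)" "\<lambda>q. 0"] WW that derivation_const[OF derivation_Z1] by simp
  have W: "Z1b (Mop f) q = 2 * Z1b (Nop f) q - 2 * Z1b f q" if q: "q \<in> S3" for q
  proof -
    have N: "Z1b (Nop f) q = - \<i> * Tvf (Z1b f) q"
      unfolding Nop_def derivation_minus[OF derivation_Z1b S3_smooth_ops(1)[OF sm(2)] q]
      using commutators(1)[OF sm(2) q] ZWW[OF q] by (simp add: algebra_simps)
    have "Z1b (Z1b (Z1 f)) q = Z1b (\<lambda>q. Z1 (Z1b f) q + \<i> * Tvf f q) q"
      using commutators(1)[OF f] by (intro derivation_cong[OF derivation_Z1b _ q]) (simp add: algebra_simps)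
    also have "\<dots> = Z1b (Z1 (Z1b f)) q + \<i> * Z1b (Tvf f) q"
      by (simp add: derivation_add[OF derivation_Z1b] derivation_mult[OF derivation_Z1b] derivation_const[OF derivation_Z1b]
        S3_smooth_mult S3_smooth_const sm S3_smooth_ops[OF sm(2)] q)
    also have "Z1b (Z1 (Z1b f)) q = \<i> * Tvf (Z1b f) q"
      using commutators(1)[OF sm(2) q] ZWW[OF q] by (simp add: algebra_simps)
    also have "Z1b (Tvf f) q = Tvf (Z1b f) q - 2 * \<i> * Z1b f q"
      using commutators(3)[OF f q] by (simp add: algebra_simps)
    finally have "Z1b (Z1b (Z1 f)) q = 2 * \<i> * Tvf (Z1b f) q + 2 * Z1b f q"
      by (simp add: algebra_simps)
    then show ?thesis
      unfolding N unfolding Mop_def derivation_minus[OF derivation_Z1b S3_smooth_ops(2)[OF sm(1)] q]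
      by (simp add: algebra_simps)
  qed
  have "Nop (Mop f) p = - Z1 (\<lambda>q. 2 * Z1b (Nop f) q - 2 * Z1b f q) p"
    unfolding Nop_def[of "Mop f"] using derivation_cong[OF derivation_Z1 W p] by simp
  also have "Z1 (\<lambda>q. 2 * Z1b (Nop f) q - 2 * Z1b f q) p = 2 * Z1 (Z1b (Nop f)) p - 2 * Z1 (Z1b f) p"
    by (simp add: derivation_diff[OF derivation_Z1] derivation_mult[OF derivation_Z1] derivation_const[OF derivation_Z1]
      S3_smooth_mult S3_smooth_const sm S3_smooth_ops[OF sm(4)] p)
  also have "Z1 (Z1b (Nop f)) p = - Nop (Nop f) p" by (simp only: Nop_def[of "Nop f"] minus_minus)
  also have "Z1 (Z1b f) p = - Nop f p" by (simp only: Nop_def minus_minus)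
  finally show ?thesis by simp
qed

text \<open>The positivity of \<open>M + 3 - 5/3 N\<close> on the joint spectrum is certified without spectral
  theory: with \<open>u = N \<phi>\<close> one has \<open>N \<beta> = N u + 2 u\<close> and \<open>M u = 2 N u - 2 u\<close>, and the two inequalities
  \<open>\<langle>M (\<beta> - u), \<beta> - u\<rangle> \<ge> 0\<close> and \<open>\<parallel>\<beta> - 3/2 u\<parallel>\<^sup>2 \<ge> 0\<close> bound the quadratic form below by
  \<open>1/3 \<langle>N u, u\<rangle> + 19/12 \<parallel>u\<parallel>\<^sup>2 + 10/3 \<langle>u, \<phi>\<rangle>\<close>.\<close>
lemma positivity:
  assumes \<phi>: "S3_smooth \<phi>" and WW: "\<And>q. q \<in> S3 \<Longrightarrow> Z1b (Z1b \<phi>) q = 0"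
    and \<beta>_def: "\<beta> = (\<lambda>q. Mop \<phi> q - Nop \<phi> q + 4 * \<phi> q)"
    and zero: "S3_inner (\<lambda>q. Mop \<beta> q + 3 * \<beta> q - (5 / 3) * Nop \<beta> q) \<beta> = 0" and p: "p \<in> S3"
  shows "\<phi> p = 0"
proof -
  define u where "u = Nop \<phi>"
  note sm\<phi> = \<phi> S3_smooth_ops[OF \<phi>]
  have u: "S3_smooth u" unfolding u_def by (rule sm\<phi>)
  have \<beta>: "S3_smooth \<beta>" unfolding \<beta>_def by (intro S3_smooth_add S3_smooth_diff S3_smooth_mult S3_smooth_const sm\<phi>)
  note sm = sm\<phi> u \<beta> S3_smooth_ops[OF u] S3_smooth_ops[OF \<beta>] S3_smooth_add S3_smooth_diff S3_smooth_mult S3_smooth_const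
  have N\<beta>: "Nop \<beta> q = Nop u q + 2 * u q" if q: "q \<in> S3" for q
  proof -
    have "Nop \<beta> q = Nop (Mop \<phi>) q - Nop (Nop \<phi>) q + 4 * Nop \<phi> q"
      unfolding \<beta>_def by (simp add: ops_linear[of _ "\<lambda>q. 0"] ops_linear sm\<phi> S3_smooth_diff S3_smooth_mult S3_smooth_const q)
    then show ?thesis using Nop_Mop[OF \<phi> WW q] by (simp add: u_def)
  qed
  have Mu: "Mop u q = 2 * Nop u q - 2 * u q" if q: "q \<in> S3" for q
    using Mop_Nop_commute[OF \<phi> q] Nop_Mop[OF \<phi> WW q] by (simp add: u_def)
  obtain k1 where k1: "k1 \<ge> 0" "S3_inner (Z1b \<phi>) (Z1b \<phi>) = of_real k1" "k1 = 0 \<Longrightarrow> \<forall>p\<in>S3. Z1b \<phi> p = 0"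
    using S3_inner_self[OF sm\<phi>(3)] by blast
  obtain k2 where k2: "k2 \<ge> 0" "S3_inner u u = of_real k2" using S3_inner_self[OF u] by blast
  obtain k3 where k3: "k3 \<ge> 0" "S3_inner (Z1b u) (Z1b u) = of_real k3" using S3_inner_self[OF S3_smooth_ops(2)[OF u]] by blast
  obtain A where A: "A \<ge> 0" "S3_inner (Z1 \<beta>) (Z1 \<beta>) = of_real A" using S3_inner_self[OF S3_smooth_ops(1)[OF \<beta>]] by blast
  obtain B where B: "B \<ge> 0" "S3_inner \<beta> \<beta> = of_real B" "B = 0 \<Longrightarrow> \<forall>p\<in>S3. \<beta> p = 0" using S3_inner_self[OF \<beta>] by blast
  have u\<phi>: "S3_inner u \<phi> = of_real k1" unfolding u_def using S3_inner_Nop[OF \<phi> \<phi>] k1(2) by simp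
  have Nuu: "S3_inner (Nop u) u = of_real k3" using S3_inner_Nop[OF u u] k3(2) by simp
  have \<phi>u: "S3_inner \<phi> u = of_real k1" using S3_inner_cnj[of u \<phi>] u\<phi> by simp
  have \<phi>Nu: "S3_inner \<phi> (Nop u) = of_real k2"
    using S3_inner_Nop_adjoint[OF \<phi> u] k2(2) by (simp add: u_def)
  have "S3_inner u \<beta> = S3_inner \<phi> (Nop \<beta>)"
    unfolding u_def by (rule S3_inner_Nop_adjoint[OF \<phi> \<beta>])
  also have "\<dots> = S3_inner \<phi> (\<lambda>q. Nop u q + 2 * u q)" by (rule S3_inner_cong) (simp_all add: N\<beta>)
  also have "\<dots> = of_real (k2 + 2 * k1)"
    by (simp add: S3_inner_add_right S3_inner_cmult_right sm \<phi>u \<phi>Nu)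
  finally have u\<beta>: "S3_inner u \<beta> = of_real (k2 + 2 * k1)" .
  have \<beta>u: "S3_inner \<beta> u = of_real (k2 + 2 * k1)" using S3_inner_cnj[of u \<beta>] u\<beta> by simp
  have "S3_inner (Nop u) \<beta> = S3_inner u (Nop \<beta>)" by (rule S3_inner_Nop_adjoint[OF u \<beta>])
  also have "\<dots> = S3_inner u (\<lambda>q. Nop u q + 2 * u q)" by (rule S3_inner_cong) (simp_all add: N\<beta>)
  also have "\<dots> = of_real (k3 + 2 * k2)"
    using S3_inner_Nop_adjoint[OF u u] by (simp add: S3_inner_add_right S3_inner_cmult_right sm k2(2) Nuu)
  finally have Nu\<beta>: "S3_inner (Nop u) \<beta> = of_real (k3 + 2 * k2)" .
  have "S3_inner (Nop \<beta>) \<beta> = S3_inner (\<lambda>q. Nop u q + 2 * u q) \<beta>" by (rule S3_inner_cong) (simp_all add: N\<beta>)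
  also have "\<dots> = of_real (k3 + 4 * k2 + 4 * k1)"
    by (simp add: S3_inner_add_left S3_inner_cmult_left sm Nu\<beta> u\<beta>)
  finally have N\<beta>\<beta>: "S3_inner (Nop \<beta>) \<beta> = of_real (k3 + 4 * k2 + 4 * k1)" .
  have "S3_inner (Mop u) \<beta> = S3_inner (\<lambda>q. 2 * Nop u q - 2 * u q) \<beta>" by (rule S3_inner_cong) (simp_all add: Mu)
  also have "\<dots> = of_real (2 * k3 + 2 * k2 - 4 * k1)"
    by (simp add: S3_inner_diff_left S3_inner_cmult_left sm Nu\<beta> u\<beta>)
  finally have Mu\<beta>: "S3_inner (Mop u) \<beta> = of_real (2 * k3 + 2 * k2 - 4 * k1)" .
  have "S3_inner (Mop u) u = S3_inner (\<lambda>q. 2 * Nop u q - 2 * u q) u" by (rule S3_inner_cong) (simp_all add: Mu)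
  also have "\<dots> = of_real (2 * k3 - 2 * k2)"
    by (simp add: S3_inner_diff_left S3_inner_cmult_left sm Nuu k2(2))
  finally have Muu: "S3_inner (Mop u) u = of_real (2 * k3 - 2 * k2)" .
  have M\<beta>\<beta>: "S3_inner (Mop \<beta>) \<beta> = of_real A" using S3_inner_Mop[OF \<beta> \<beta>] A(2) by simp
  have M\<beta>u: "S3_inner (Mop \<beta>) u = of_real (2 * k3 + 2 * k2 - 4 * k1)"
    using S3_inner_Mop_adjoint[OF \<beta> u] S3_inner_cnj[of "Mop u" \<beta>] Mu\<beta> by simp
  have 0: "A + 3 * B - (5 / 3) * (k3 + 4 * k2 + 4 * k1) = 0"
  proof -
    have "S3_inner (\<lambda>q. Mop \<beta> q + 3 * \<beta> q - (5 / 3) * Nop \<beta> q) \<beta> =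
        of_real A + 3 * of_real B - (5 / 3) * of_real (k3 + 4 * k2 + 4 * k1)"
      by (simp only: S3_inner_add_left S3_inner_diff_left S3_inner_cmult_left sm M\<beta>\<beta> N\<beta>\<beta> B(2))
    then have "complex_of_real (A + 3 * B - (5 / 3) * (k3 + 4 * k2 + 4 * k1)) = 0"
      using zero by simp
    then show ?thesis by (rule of_real_eq_0_iff[THEN iffD1])
  qed
  have 1: "A \<ge> 2 * k3 + 6 * k2 - 8 * k1"
  proof -
    \<comment> \<open>On H_{p,1} this difference is only 2 \<phi>, because \<beta> = (N + 2) \<phi>
      and u = N \<phi> there, so little is lost in discarding its form.\<close>
    define v where "v = (\<lambda>q. \<beta> q - u q)"
    have v: "S3_smooth v" unfolding v_def by (intro sm)
    obtain r where r: "r \<ge> 0" "S3_inner (Z1 v) (Z1 v) = of_real r" using S3_inner_self[OF S3_smooth_ops(1)[OF v]] by blast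
    have "of_real r = S3_inner (Mop v) v" using S3_inner_Mop[OF v v] r(2) by simp
    also have "\<dots> = S3_inner (\<lambda>q. Mop \<beta> q - Mop u q) v"
      by (rule S3_inner_cong) (simp_all add: v_def ops_linear(5)[OF \<beta> u])
    also have "\<dots> = of_real (A - 2 * (2 * k3 + 2 * k2 - 4 * k1) + (2 * k3 - 2 * k2))"
      unfolding v_def by (simp add: S3_inner_diff_left S3_inner_diff_right sm M\<beta>\<beta> M\<beta>u Mu\<beta> Muu)
    finally have "r = A - 2 * (2 * k3 + 2 * k2 - 4 * k1) + (2 * k3 - 2 * k2)" by (rule of_real_eq_iff[THEN iffD1])
    then show ?thesis using r(1) by simp
  qed
  have 2: "B \<ge> (3 / 4) * k2 + 6 * k1"
  proof -
    \<comment> \<open>Subtracting c u gives B >= (2c - c^2) k2 + 4c k1. The final coefficient of k1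
      is positive for c > 11/9 and that of k2 for 2c - c^2 > 2/9; c = 3/2 satisfies both.\<close>
    define v where "v = (\<lambda>q. \<beta> q - (3 / 2) * u q)"
    have v: "S3_smooth v" unfolding v_def by (intro sm)
    obtain r where r: "r \<ge> 0" "S3_inner v v = of_real r" using S3_inner_self[OF v] by blast
    have "of_real r = S3_inner v v" using r(2) by simp
    also have "\<dots> = of_real (B - 3 * (k2 + 2 * k1) + (9 / 4) * k2)"
      unfolding v_def
      by (simp only: S3_inner_diff_left S3_inner_diff_right S3_inner_cmult_left S3_inner_cmult_right sm u\<beta> \<beta>u k2(2) B(2))
        (simp add: field_simps)
    finally have "r = B - 3 * (k2 + 2 * k1) + (9 / 4) * k2" by (rule of_real_eq_iff[THEN iffD1])
    then show ?thesis using r(1) by simp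
  qed
  have 3: "3 * A + 9 * B = 5 * k3 + 20 * k2 + 20 * k1" using 0 by (simp add: field_simps)
  have 4: "4 * B \<ge> 3 * k2 + 24 * k1" using 2 by simp
  have "k1 \<le> 0" using 3 1 4 k2(1) k3(1) by linarith
  moreover have "k2 \<le> 0" using 3 1 4 k1(1) k3(1) by linarith
  moreover have "k3 \<le> 0" using 3 1 4 k1(1) k2(1) by linarith
  ultimately have k: "k1 = 0" "k2 = 0" "k3 = 0" using k1(1) k2(1) k3(1) by simp_all
  have "B = 0" using 3 A(1) B(1) unfolding k by linarith
  have Z: "Z1b \<phi> q = 0" if "q \<in> S3" for q using k1(3) k(1) that by blast
  have "Nop \<phi> q = 0" if "q \<in> S3" for q
    unfolding Nop_def using derivation_cong[OF derivation_Z1, of "Z1b \<phi>" "\<lambda>q. 0" q] Z that derivation_const[OF derivation_Z1] by simp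
  then have \<phi>4: "Mop \<phi> q + 4 * \<phi> q = 0" if "q \<in> S3" for q using B(3)[OF \<open>B = 0\<close>] that by (simp add: \<beta>_def)
  \<comment> \<open>With \<beta> = 0 and N \<phi> = 0 only (M + 4) \<phi> = 0 is left, and pairing
    it with \<phi> gives a sum of two nonnegative terms.\<close>
  obtain s where s: "s \<ge> 0" "S3_inner (Z1 \<phi>) (Z1 \<phi>) = of_real s" using S3_inner_self[OF sm\<phi>(2)] by blast
  obtain r where r: "r \<ge> 0" "S3_inner \<phi> \<phi> = of_real r" "r = 0 \<Longrightarrow> \<forall>p\<in>S3. \<phi> p = 0" using S3_inner_self[OF \<phi>] by blast
  have "complex_of_real (s + 4 * r) = S3_inner (\<lambda>q. Mop \<phi> q + 4 * \<phi> q) \<phi>"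
    using S3_inner_Mop[OF \<phi> \<phi>] by (simp add: S3_inner_add_left S3_inner_cmult_left sm s(2) r(2))
  also have "\<dots> = S3_inner (\<lambda>q. 0 * \<phi> q) \<phi>" by (rule S3_inner_cong) (simp_all add: \<phi>4)
  also have "\<dots> = 0" unfolding S3_inner_cmult_left by simp
  finally have "s + 4 * r = 0" by (rule of_real_eq_0_iff[THEN iffD1])
  then have "r = 0" using s(1) r(1) by linarith
  then show ?thesis using r(3) p by blast
qed

section \<open>Comparison of orders in t and the conclusion\<close>

lemma small_polynomial_imp_0:
  fixes a b c :: complex
  assumes "\<forall>\<^sub>F t in at (0::real). cmod (a + of_real t * b + of_real (t\<^sup>2) * c) \<le> C * \<bar>t\<bar> ^ 3"
  shows "a = 0 \<and> b = 0 \<and> c = 0"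
proof -
  have nz: "\<forall>\<^sub>F t in at (0::real). t \<noteq> 0" by (simp add: eventually_at_filter)
  have "((\<lambda>t. a + of_real t * b + of_real (t\<^sup>2) * c) \<longlongrightarrow> 0) (at (0::real))"
    by (rule Lim_null_comparison[OF assms]) (auto intro!: tendsto_eq_intros)
  moreover have "((\<lambda>t. a + of_real t * b + of_real (t\<^sup>2) * c) \<longlongrightarrow> a) (at (0::real))"
    by (auto intro!: tendsto_eq_intros)
  ultimately have a: "a = 0" using tendsto_unique[OF trivial_limit_at] by blast
  have "\<forall>\<^sub>F t in at (0::real). cmod (b + of_real t * c) \<le> C * \<bar>t\<bar>\<^sup>2"
    using assms nz
  proof eventually_elim
    case (elim t)
    have "a + of_real t * b + of_real (t\<^sup>2) * c = of_real t * (b + of_real t * c)"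
      by (simp add: a power2_eq_square algebra_simps)
    then have "\<bar>t\<bar> * cmod (b + of_real t * c) \<le> \<bar>t\<bar> * (C * \<bar>t\<bar>\<^sup>2)"
      using elim(1) by (simp add: norm_mult power2_eq_square power3_eq_cube mult_ac)
    then show ?case using elim(2) by simp
  qed
  note b_bound = this
  have "((\<lambda>t. b + of_real t * c) \<longlongrightarrow> 0) (at (0::real))"
    by (rule Lim_null_comparison[OF b_bound]) (auto intro!: tendsto_eq_intros)
  moreover have "((\<lambda>t. b + of_real t * c) \<longlongrightarrow> b) (at (0::real))"
    by (auto intro!: tendsto_eq_intros)
  ultimately have b: "b = 0" using tendsto_unique[OF trivial_limit_at] by blast
  have "\<forall>\<^sub>F t in at (0::real). cmod c \<le> C * \<bar>t\<bar>"
    using b_bound nz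
  proof eventually_elim
    case (elim t)
    have "\<bar>t\<bar> * cmod c \<le> \<bar>t\<bar> * (C * \<bar>t\<bar>)"
      using elim(1) by (simp add: b norm_mult power2_eq_square mult_ac)
    then show ?case using elim(2) by simp
  qed
  then have "((\<lambda>t. c) \<longlongrightarrow> 0) (at (0::real))"
    by (rule Lim_null_comparison) (auto intro!: tendsto_eq_intros)
  then have "c = 0" by (simp add: tendsto_const_iff)
  with a b show ?thesis by simp
qed

context deformation_family
begin

text \<open>The constant in the O-hypothesis may depend on p, but it is used only to annihilate the
  three Taylor coefficients at that p. What remains is t^3 times a member of \<open>fam\<close>,
  hence bounded uniformly over the sphere.\<close>

lemma obstr_remainder:
  assumes WW: "\<And>p. p \<in> S3 \<Longrightarrow> Z1b (Z1b \<phi>1) p = 0"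
    and O: "\<And>p. p \<in> S3 \<Longrightarrow> (\<lambda>t::real. obstr (\<Phi> t) p) \<in> O[at 0](\<lambda>t. of_real (t ^ 3))"
  obtains R where "fam R" "\<And>t p. \<bar>t\<bar> < \<epsilon> \<Longrightarrow> p \<in> S3 \<Longrightarrow> obstr (\<Phi> t) p = of_real (t ^ 3) * R t p"
proof -
  have fam: "fam (\<lambda>t. obstr (\<Phi> t))" by (rule fam_obstr) (rule WW)
  obtain a b c R where R: "fam R" and exp: "\<And>t p. \<bar>t\<bar> < \<epsilon> \<Longrightarrow> p \<in> S3 \<Longrightarrow>
      obstr (\<Phi> t) p = a p + of_real t * b p + of_real (t\<^sup>2) * c p + of_real (t ^ 3) * R t p"
    by (rule fam_expansion3[OF fam]) (rule that)
  obtain B where B: "\<And>t p. \<bar>t\<bar> < \<epsilon> \<Longrightarrow> p \<in> S3 \<Longrightarrow> cmod (R t p) \<le> B"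
    using fam_bounded[OF R] by blast
  have near: "\<forall>\<^sub>F t in at (0::real). \<bar>t\<bar> < \<epsilon>"
    using eps_pos by (auto simp: eventually_at intro!: exI[of _ \<epsilon>])
  have abc: "a p = 0 \<and> b p = 0 \<and> c p = 0" if p: "p \<in> S3" for p
  proof -
    obtain C where "\<forall>\<^sub>F t in at (0::real). cmod (obstr (\<Phi> t) p) \<le> C * cmod (of_real (t ^ 3))"
      using O[OF p] by (auto elim!: landau_o.bigE)
    then have "\<forall>\<^sub>F t in at (0::real). cmod (a p + of_real t * b p + of_real (t\<^sup>2) * c p) \<le> (C + B) * \<bar>t\<bar> ^ 3"
      using near
    proof eventually_elim
      case (elim t)
      have "a p + of_real t * b p + of_real (t\<^sup>2) * c p = obstr (\<Phi> t) p - of_real (t ^ 3) * R t p"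
        using exp[OF elim(2) p] by simp
      also have "cmod \<dots> \<le> cmod (obstr (\<Phi> t) p) + cmod (of_real (t ^ 3) * R t p)" by (rule norm_triangle_ineq4)
      also have "cmod (of_real (t ^ 3) * R t p) \<le> \<bar>t\<bar> ^ 3 * B"
        unfolding norm_mult norm_of_real power_abs by (intro mult_left_mono B elim p) simp
      finally show ?case using elim(1) by (simp add: norm_power power_abs algebra_simps)
    qed
    then show ?thesis by (rule small_polynomial_imp_0)
  qed
  show thesis by (rule that[OF R]) (simp add: exp abc)
qed

text \<open>Integration removes the divergence part, including all of its dependence on \<phi>2.
  What is left equates t^2 times the pairing with t^3 times a bounded quantity, so the pairing is
  0.\<close>

lemma second_order_obstruction:
  assumes WW: "\<And>p. p \<in> S3 \<Longrightarrow> Z1b (Z1b \<phi>1) p = 0"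
    and O: "\<And>p. p \<in> S3 \<Longrightarrow> (\<lambda>t::real. obstr (\<Phi> t) p) \<in> O[at 0](\<lambda>t. of_real (t ^ 3))"
  shows "S3_inner cartan1 tors1 = 0"
proof -
  obtain R where R: "fam R" "\<And>t p. \<bar>t\<bar> < \<epsilon> \<Longrightarrow> p \<in> S3 \<Longrightarrow> obstr (\<Phi> t) p = of_real (t ^ 3) * R t p"
    by (rule obstr_remainder) (rule WW O that; assumption)+
  have Q: "lin (\<lambda>t. Q11 (\<Phi> t)) (\<lambda>p. 0) cartan1" by (rule lin_Q11) (rule WW)
  obtain A' where A': "fam A'" "\<And>t p. \<bar>t\<bar> < \<epsilon> \<Longrightarrow> p \<in> S3 \<Longrightarrow> Aup11 (\<Phi> t) p = 0 + of_real t * cnj (tors1 p) + of_real t * of_real t * A' t p"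
    using lin_Aup11 by (rule linE) blast
  obtain Q' where Q': "fam Q'" "\<And>t p. \<bar>t\<bar> < \<epsilon> \<Longrightarrow> p \<in> S3 \<Longrightarrow> Q11 (\<Phi> t) p = 0 + of_real t * cartan1 p + of_real t * of_real t * Q' t p"
    using Q by (rule linE) blast
  \<comment> \<open>Collects, divided by t^3, everything beyond the leading t^2 term: the remainder
    of the obstruction and the higher terms of the product of \<open>Aup11\<close> and
    \<open>Q11\<close>. The factor \<open>3 * \<i>\<close> undoes the -i/3 in front of that
    product.\<close>
  define S where "S t p = 3 * \<i> * R t p - (cnj (tors1 p) * Q' t p + A' t p * cartan1 p + of_real t * (A' t p * Q' t p))" for t p
  have "fam (\<lambda>t p. S t p)"
    unfolding S_def by (intro fam.add fam_diff fam.mult fam_const fam.param fam.const R(1) A'(1) Q'(1) S3_smooth_cnj smooth_tors1 smooth_cartan1)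
  then have S: "fam S" by simp
  obtain B where B: "\<And>t p. \<bar>t\<bar> < \<epsilon> \<Longrightarrow> p \<in> S3 \<Longrightarrow> cmod (S t p) \<le> B"
    using fam_bounded[OF S] by blast
  define J where "J = S3_inner cartan1 tors1"
  have J: "J = of_real t * sphere_integral (S t)" if t: "\<bar>t\<bar> < \<epsilon>" "t \<noteq> 0" for t
  proof -
    obtain U where U: "S3_smooth U" "\<And>p. p \<in> S3 \<Longrightarrow>
        obstr (\<Phi> t) p = Z1b U p + Z1 (\<lambda>q. cnj (\<Phi> t q) * U q) p - \<i> / 3 * Aup11 (\<Phi> t) p * Q11 (\<Phi> t) p"
      using obstr_divergence[OF lin_fam[OF Q] t(1)] by blast
    define W where "W q = cnj (\<Phi> t q) * U q" for q
    have W: "S3_smooth W" unfolding W_def[abs_def] by (intro S3_smooth_mult S3_smooth_cnj smooth_Phi U)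
    have eq: "of_real (t\<^sup>2) * (cartan1 p * cnj (tors1 p)) =
        (- 3 * \<i>) * (Z1b U p + Z1 W p) + of_real (t ^ 3) * S t p" if p: "p \<in> S3" for p
    proof -
      have "Aup11 (\<Phi> t) p * Q11 (\<Phi> t) p = of_real (t\<^sup>2) * (cartan1 p * cnj (tors1 p)) +
          of_real (t ^ 3) * (3 * \<i> * R t p - S t p)"
        unfolding A'(2)[OF t(1) p] Q'(2)[OF t(1) p] S_def
        by (simp add: power2_eq_square power3_eq_cube algebra_simps)
      moreover have "\<i> * (Aup11 (\<Phi> t) p * Q11 (\<Phi> t) p) = 3 * (Z1b U p + Z1 W p - of_real (t ^ 3) * R t p)"
        using U(2)[OF p] R(2)[OF t(1) p] by (simp add: W_def[abs_def] field_simps)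
      ultimately show ?thesis using i_squared by algebra
    qed
    have "of_real (t\<^sup>2) * J = sphere_integral (\<lambda>p. of_real (t\<^sup>2) * (cartan1 p * cnj (tors1 p)))"
      unfolding J_def S3_inner_sphere_integral sphere_integral_cmult ..
    also have "\<dots> = sphere_integral (\<lambda>p. (- 3 * \<i>) * (Z1b U p + Z1 W p) + of_real (t ^ 3) * S t p)"
      by (rule sphere_integral_cong) (rule eq)
    also have "\<dots> = (- 3 * \<i>) * (sphere_integral (Z1b U) + sphere_integral (Z1 W)) + of_real (t ^ 3) * sphere_integral (S t)"
    proof -
      have "continuous_on S3 (Z1b U)" "continuous_on S3 (Z1 W)" "continuous_on S3 (S t)"
        by (intro S3_smooth_continuous S3_smooth_ops U W fam_smooth[OF S t(1)])+
      then show ?thesis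
        by (simp only: sphere_integral_add sphere_integral_cmult continuous_on_add continuous_on_mult continuous_on_const)
    qed
    also have "\<dots> = of_real (t\<^sup>2) * (of_real t * sphere_integral (S t))"
      by (simp add: sphere_integral_Z U(1) W power2_eq_square power3_eq_cube mult.assoc)
    finally show ?thesis using t(2) by simp
  qed
  have near: "\<forall>\<^sub>F t in at (0::real). \<bar>t\<bar> < \<epsilon> \<and> t \<noteq> 0"
    unfolding eventually_at using eps_pos by (intro exI[of _ \<epsilon>]) (simp add: dist_real_def)
  then have "\<forall>\<^sub>F t in at (0::real). cmod J \<le> \<bar>t\<bar> * (B * punctured_volume)"
  proof eventually_elim
    case (elim t)
    have "cmod (sphere_integral (S t)) \<le> B * punctured_volume"
      using elim by (intro sphere_integral_bound S3_smooth_continuous fam_smooth[OF S] B) auto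
    then show ?case using J[of t] elim by (simp add: norm_mult mult_left_mono)
  qed
  then have "((\<lambda>t. J) \<longlongrightarrow> 0) (at (0::real))"
    by (rule Lim_null_comparison) (auto intro!: tendsto_eq_intros)
  then show ?thesis by (simp add: tendsto_const_iff J_def)
qed

text \<open>With T = i (M - N) one gets a = -i \<beta> and q = i (M + 3 - 5/3 N) a. The two factors
  cancel in q, so the vanishing pairing is, up to a unit, the quadratic form of M + 3 - 5/3 N at
  \<beta>.\<close>

lemma phi1_eq_0:
  assumes WW: "\<And>p. p \<in> S3 \<Longrightarrow> Z1b (Z1b \<phi>1) p = 0"
    and O: "\<And>p. p \<in> S3 \<Longrightarrow> (\<lambda>t::real. obstr (\<Phi> t) p) \<in> O[at 0](\<lambda>t. of_real (t ^ 3))"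
    and p: "p \<in> S3"
  shows "\<phi>1 p = 0"
proof -
  define \<beta> where "\<beta> = (\<lambda>q. Mop \<phi>1 q - Nop \<phi>1 q + 4 * \<phi>1 q)"
  note sm = smooth1 S3_smooth_ops[OF smooth1]
  have \<beta>: "S3_smooth \<beta>" unfolding \<beta>_def by (intro S3_smooth_add S3_smooth_diff S3_smooth_mult S3_smooth_const sm)
  define E where "E = (\<lambda>q. Mop \<beta> q + 3 * \<beta> q - (5 / 3) * Nop \<beta> q)"
  have a: "tors1 q = - \<i> * \<beta> q" if "q \<in> S3" for q
    by (simp add: tors1_def \<beta>_def Tvf_ops[OF smooth1 that] algebra_simps)
  have q: "cartan1 q = E q" if q: "q \<in> S3" for q
  proof -
    have "cartan1 q = \<i> * (Mop tors1 q - Nop tors1 q) + 3 * \<i> * tors1 q - (2 * \<i> / 3) * Nop tors1 q"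
      by (simp add: cartan1_def Tvf_ops[OF smooth_tors1 q]) (simp add: Nop_def)
    moreover have "Mop tors1 q = - \<i> * Mop \<beta> q" "Nop tors1 q = - \<i> * Nop \<beta> q"
      using ops_cong[of tors1 "\<lambda>q. - \<i> * \<beta> q" q] a q ops_linear(3,6)[OF \<beta> \<beta> q, of "- \<i>"] by simp_all
    ultimately show ?thesis unfolding a[OF q] E_def by (simp add: algebra_simps)
  qed
  have "S3_inner E (\<lambda>q. - \<i> * \<beta> q) = S3_inner cartan1 tors1"
    by (rule S3_inner_cong) (simp_all add: a q)
  also have "\<dots> = 0" by (rule second_order_obstruction) (rule WW O; assumption)+
  finally have "S3_inner E \<beta> = 0"
    unfolding S3_inner_cmult_right by simp
  then show ?thesis
    unfolding E_def by (intro positivity[OF smooth1 _ \<beta>_def _ p] WW)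
qed

end

theorem theorem1p3:
  fixes \<phi>d :: "complex \<times> complex \<Rightarrow> complex"
  assumes "D0perp \<phi>d"
    and "\<exists>p\<in>S3. \<phi>d p \<noteq> 0"
  shows "\<not> (\<exists>\<phi>dd. S3_smooth \<phi>dd \<and>
            (\<forall>p\<in>S3. (\<lambda>t::real. obstr (\<lambda>q. of_real t * \<phi>d q + of_real (t\<^sup>2 / 2) * \<phi>dd q) p)
                       \<in> O[at 0](\<lambda>t. of_real (t ^ 3))))"
proof
  assume "\<exists>\<phi>dd. S3_smooth \<phi>dd \<and>
            (\<forall>p\<in>S3. (\<lambda>t::real. obstr (\<lambda>q. of_real t * \<phi>d q + of_real (t\<^sup>2 / 2) * \<phi>dd q) p)
                       \<in> O[at 0](\<lambda>t. of_real (t ^ 3)))"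
  then obtain \<phi>dd where dd: "S3_smooth \<phi>dd" and O: "\<And>p. p \<in> S3 \<Longrightarrow>
      (\<lambda>t::real. obstr (\<lambda>q. of_real t * \<phi>d q + of_real (t\<^sup>2 / 2) * \<phi>dd q) p) \<in> O[at 0](\<lambda>t. of_real (t ^ 3))"
    by blast
  have d: "S3_smooth \<phi>d" using assms(1) by (simp add: D0perp_def)
  obtain B where B: "B > 0" "\<And>p. p \<in> S3 \<Longrightarrow> cmod (\<phi>d p) \<le> B" using S3_smooth_bounded[OF d] by blast
  obtain C where C: "C > 0" "\<And>p. p \<in> S3 \<Longrightarrow> cmod (\<phi>dd p) \<le> C" using S3_smooth_bounded[OF dd] by blast
  \<comment> \<open>For |t| <= 1 one has t^2/2 <= |t|, so both terms of the family together are at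
    most |t| (B + C), which the second bound keeps below 1/2.\<close>
  define \<epsilon> where "\<epsilon> = min 1 (1 / (2 * (B + C)))"
  interpret deformation_family \<phi>d \<phi>dd \<epsilon>
  proof
    show "\<epsilon> > 0" using B(1) C(1) by (simp add: \<epsilon>_def)
    fix t :: real and p assume t: "\<bar>t\<bar> < \<epsilon>" and p: "p \<in> S3"
    have t1: "\<bar>t\<bar> \<le> 1" and t2: "\<bar>t\<bar> * (B + C) < 1 / 2"
      using t B(1) C(1) by (simp_all add: \<epsilon>_def field_simps)
    have "t\<^sup>2 / 2 \<le> \<bar>t\<bar>"
      using mult_left_mono[OF t1, of "\<bar>t\<bar>"] abs_mult_self_eq[of t] by (simp add: power2_eq_square)
    then have "t\<^sup>2 / 2 * cmod (\<phi>dd p) \<le> \<bar>t\<bar> * C"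
      using C(2)[OF p] by (intro mult_mono) auto
    moreover have "\<bar>t\<bar> * cmod (\<phi>d p) \<le> \<bar>t\<bar> * B"
      using B(2)[OF p] by (intro mult_left_mono) auto
    moreover have "cmod (of_real t * \<phi>d p + of_real (t\<^sup>2 / 2) * \<phi>dd p) \<le> \<bar>t\<bar> * cmod (\<phi>d p) + t\<^sup>2 / 2 * cmod (\<phi>dd p)"
      by (rule order_trans[OF norm_triangle_ineq]) (simp only: norm_mult norm_of_real, simp)
    ultimately show "cmod (of_real t * \<phi>d p + of_real (t\<^sup>2 / 2) * \<phi>dd p) < 1 / 2"
      using t2 by (simp add: distrib_left)
  qed (rule d dd)+
  have "\<phi>d p = 0" if "p \<in> S3" for p
  proof (rule phi1_eq_0[OF _ _ that])
    show "Z1b (Z1b \<phi>d) q = 0" if "q \<in> S3" for q by (rule D0perp_Z1b_Z1b[OF assms(1) that])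
    show "(\<lambda>t::real. obstr (\<Phi> t) q) \<in> O[at 0](\<lambda>t. of_real (t ^ 3))" if "q \<in> S3" for q
      unfolding \<Phi>_def by (rule O[OF that])
  qed
  with assms(2) show False by blast
qed

end
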